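(* Let $t\in2\mathbb Z^{\le0}$, $\underline k:=-\tfrac t2$, and let $\lambda\in\mathcal I$ be $\underline k$-singular. Then the eigenvalue polynomial $\boldsymbol f_\lambda$ of the categorical Capelli operator $\boldsymbol D_{t,\lambda}$ is $$\boldsymbol f_\lambda=\lim_{s\to t}\frac{\boldsymbol c_{\lambda^\dagger}(s)-\boldsymbol c_\lambda(s)}{H_{\lambda^\dagger}\left(-\frac s2\right)}\,P^{-\frac s2}_{\lambda^\dagger}.$$
   Context: Deligne category. $\mathsf{Rep}(O_t)$ is Deligne's Karoubian $\mathbb C$-linear rigid symmetric monoidal category generated by a self-dual object $\mathsf V_t$ of categorical dimension $t$, with symmetric evaluation $\boldsymbol\epsilon:\mathsf V_t\otimes\mathsf V_t\to\mathbf 1$ and coevaluation $\boldsymbol\iota:\mathbf 1\to\mathsf V_t\otimes\mathsf V_t$, $\boldsymbol\epsilon\boldsymbol\iota=t$, so that $\mathrm{End}(\mathsf V_t^{\otimes d})$ is the Brauer algebra $Br_d(t)$. In its inductive completion put $\mathsf P:=\bigoplus_{d\ge0}\mathsf P^d$, $\mathsf P^d:=\mathsf S^d(\mathsf V_t)$, and $\mathsf{PD}:=\mathsf P\otimes\bigoplus_{p\ge0}\mathsf S^p(\mathsf V_t^* )$. $\mathsf{PD}$ is an associative algebra object acting on $\mathsf P$ as polynomial-coefficient differential operators: $\mathsf P$ acts by multiplication, $\mathsf V_t^*$ by the derivations of $\mathsf P$ extending the evaluation $\mathsf V_t^*\otimes\mathsf V_t\to\mathbf 1$, and $\mathsf S^p(\mathsf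 V_t^* )$ by their composites (giving contractions $\mathsf S^p(\mathsf V_t^* )\otimes\mathsf S^q(\mathsf V_t)\to\mathsf S^{q-p}(\mathsf V_t)$, zero if $p>q$). Put $\mathsf A_t:=\mathrm{Hom}(\mathbf 1,\bigoplus_p\mathsf S^p(\mathsf V_t)\otimes\mathsf S^p(\mathsf V_t^* ))$; this is an algebra acting faithfully on $\mathsf P$. Let $\boldsymbol E_t\in\mathsf A_t$ be the element given by the coevaluation of $\mathsf V_t$ (it acts on $\mathsf P^d$ by $d$). Let $\boldsymbol\Theta_t$ be $\tfrac12$ times multiplication by the element $\mathbf 1\to\mathsf S^2(\mathsf V_t)$ given by $\boldsymbol\iota$, and $\boldsymbol\Delta_t$ be $\tfrac12$ times the action of the corresponding element $\mathbf 1\to\mathsf S^2(\mathsf V_t^* )$; then $[\boldsymbol E_t,\boldsymbol\Delta_t]=-2\boldsymbol\Delta_t$, $[\boldsymbol E_t,\boldsymbol\Theta_t]=2\boldsymbol\Theta_t$, $[\boldsymbol\Delta_t,\boldsymbol\Theta_t]=\boldsymbol E_t+\tfrac t2$. The Casimir operator is $\boldsymbol C_t:=\boldsymbol E_t^2+t\boldsymbol E_t-4\boldsymbol\Theta_t\boldsymbol\Delta_t-2\boldsymbol E_t$, and $\boldsymbol C_{t,d}$ is its restriction to $\mathsf P^d$. Partitions. $\mathcal I:=\{(\lambda_1,\lambda_2)\in\mathbb Z^2:\lambda_1\ge\lambda_2\ge0\}$, $|\lambda|=\lambda_1+\lambda_2$. For an integer $k\ge0$, $\lambda\in\mathcal I$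 is $k$-regular if $\lambda_1\le k$ or $\lambda_1-\lambda_2=k+1$ or $\lambda_1-\lambda_2\ge2k+3$; $k$-quasiregular if $\lambda_1\ge k+1$ and $\lambda_1-\lambda_2\le k$; $k$-singular if $k+2\le\lambda_1-\lambda_2\le2k+2$. $\mathcal I'_k$ is the set of $k$-regular and $k$-quasiregular elements. With $k=\underline k$, $\lambda^\dagger:=(\lambda_2+\underline k+1,\lambda_1-\underline k-1)$; this interchanges $\underline k$-quasiregular and $\underline k$-singular elements. Components. For $s\in\mathbb C$ set $\boldsymbol c_\lambda(s):=(\lambda_1-\lambda_2)(\lambda_1-\lambda_2+s-2)$. The minimal polynomial of $\boldsymbol C_{t,d}$ is $\prod_{0\le a\le d,\,a\equiv d\,(2)}(x-a(a+t-2))$; for $|\lambda|=d$ let $m_\lambda\in\{1,2\}$ be the multiplicity of its root $\boldsymbol c_\lambda(t)$ and $\mathsf V_{t,\lambda}:=\ker((\boldsymbol C_{t,d}-\boldsymbol c_\lambda(t))^{m_\lambda})\subseteq\mathsf P^d$. Then (for $t\in2\mathbb Z^{\le0}$) $\mathsf P^d\cong\bigoplus_{\lambda\in\mathcal I'_{\underline k},|\lambda|=d}\mathsf V_{t,\lambda}$ with indecomposable summands. Capelli operators. For $\underline k$-singular $\lambda$, with $d=|\lambda|$, $\boldsymbol D_{t,\lambda}\in\mathsf A_t$ is the element $\mathbf 1\to\mathsf V_{t,\lambda^\dagger}\otimes\mathsf V_{t,\lambda^\dagger}^*$ corresponding to the (nilpotent, square-zero) endomorphism $(\boldsymbol C_{t,d}-\boldsymbol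 c_\lambda(t))|_{\mathsf V_{t,\lambda^\dagger}}$ under $\mathrm{End}(\mathsf V_{t,\lambda^\dagger})\cong\mathrm{Hom}(\mathbf 1,\mathsf V_{t,\lambda^\dagger}\otimes\mathsf V_{t,\lambda^\dagger}^* )$, where $\mathsf V_{t,\lambda^\dagger}\otimes\mathsf V_{t,\lambda^\dagger}^*$ is a direct summand of $\mathsf S^d(\mathsf V_t)\otimes\mathsf S^d(\mathsf V_t^* )$ via the identification $\mathsf S^d(\mathsf V_t^* )\cong\mathsf S^d(\mathsf V_t)^*$ given by the contraction pairing above. For $\boldsymbol D\in\mathsf A_t$ the eigenvalue polynomial $\boldsymbol f_{\boldsymbol D}\in\mathbb C[x,y]$ is the unique symmetric polynomial such that for all $\mu\in\mathcal I'_{\underline k}$, $\boldsymbol D|_{\mathsf V_{t,\mu}}=\boldsymbol f_{\boldsymbol D}(\mu_1-\underline k-1,\mu_2)\cdot1+\boldsymbol\eta_\mu$ with $\boldsymbol\eta_\mu^2=0$. Write $\boldsymbol f_\lambda:=\boldsymbol f_{\boldsymbol D_{t,\lambda}}$. Knop–Sahi polynomials. With $a^{\underline r}:=a(a-1)\cdots(a-r+1)$, $$P_\lambda^\kappa(x,y):=\sum_{i+j\le\lambda_1-\lambda_2}\frac{(\lambda_1-\lambda_2)!\,(\kappa+1)^{\underline{\lambda_1-\lambda_2-i}}(\kappa+1)^{\underline{\lambda_1-\lambda_2-j}}}{i!\,j!\,(\lambda_1-\lambda_2-i-j)!\,(\kappa+1)^{\underline{\lambda_1-\lambda_2}}}\,x^{\underline{\lambda_2+i}}y^{\underline{\lambda_2+j}}\in\mathbb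 Q(\kappa)[x,y]$$ (sum over $i,j\ge 0$), $H_\lambda(\kappa):=(\lambda_1-\lambda_2)!\,\lambda_2!\,(\lambda_1-1-\kappa)^{\underline{\lambda_2}}$. $P^{-s/2}_{\lambda}$ is the specialization at $\kappa=-s/2$; limits of polynomials are coefficientwise. *)

theory Defs
  imports
    Complex_Main
    "HOL-Library.Poly_Mapping"
    "HOL-Combinatorics.Permutations"
    "HOL-Computational_Algebra.Polynomial"
begin

section \<open>The Brauer category\<close>

text \<open>
  A Brauer diagram from \<open>m\<close> to \<open>n\<close> is a perfect matching of the \<open>m\<close> source points \<open>Inl i\<close> and the
  \<open>n\<close> target points \<open>Inr j\<close>, given as the symmetric relation ``is matched with''.
\<close>

type_synonym diag = "(nat + nat) rel"

definition diagrams :: "nat \<Rightarrow> nat \<Rightarrow> diag set" where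
  "diagrams m n =
     {a. Field a = Inl ` {..<m} \<union> Inr ` {..<n} \<and> sym a \<and> irrefl a \<and> single_valued a}"

datatype level = Bot nat | Mid nat | Top nat

text \<open>
  Stacking \<open>b : n \<rightarrow> p\<close> on top of \<open>a : m \<rightarrow> n\<close>: the targets of \<open>a\<close> and the sources of \<open>b\<close> become the
  middle points. Outer points are matched in the composite if they are joined by a path; the
  components consisting of middle points only are the closed loops.
\<close>

definition glue :: "diag \<Rightarrow> diag \<Rightarrow> level rel" where
  "glue b a = map_prod (case_sum Bot Mid) (case_sum Bot Mid) ` a \<union>
              map_prod (case_sum Mid Top) (case_sum Mid Top) ` b"

definition dcomp :: "diag \<Rightarrow> diag \<Rightarrow> diag" where
  "dcomp b a = {(x, y). x \<noteq> y \<and> (case_sum Bot Top x, case_sum Bot Top y) \<in> (glue b a)\<^sup>*}"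

definition loops :: "diag \<Rightarrow> diag \<Rightarrow> nat" where
  "loops b a = card {C. \<exists>j. Mid j \<in> Field (glue b a) \<and> C = (glue b a)\<^sup>* `` {Mid j} \<and> C \<subseteq> range Mid}"

text \<open>Juxtaposition, \<open>b\<close> being placed to the right of a diagram \<open>m \<rightarrow> n\<close>.\<close>

definition dtens :: "nat \<Rightarrow> nat \<Rightarrow> diag \<Rightarrow> diag \<Rightarrow> diag" where
  "dtens m n a b = a \<union> map_prod (map_sum ((+) m) ((+) n)) (map_sum ((+) m) ((+) n)) ` b"

text \<open>
  Morphisms \<open>V\<^sup>\<otimes>\<^sup>m \<rightarrow> V\<^sup>\<otimes>\<^sup>n\<close> are the formal complex linear combinations of Brauer diagrams; composition
  is bilinear, each closed loop contributing a factor \<open>t\<close>.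
\<close>

type_synonym bmor = "diag \<Rightarrow>\<^sub>0 complex"

definition bhom :: "nat \<Rightarrow> nat \<Rightarrow> bmor set" where
  "bhom m n = {F. Poly_Mapping.keys F \<subseteq> diagrams m n}"

definition bscale :: "complex \<Rightarrow> bmor \<Rightarrow> bmor" where
  "bscale c F = Poly_Mapping.map ((*) c) F"

definition bcomp :: "bmor \<Rightarrow> complex \<Rightarrow> bmor \<Rightarrow> bmor" (\<open>_ \<odot>\<^bsub>_\<^esub> _\<close> [71, 0, 70] 70) where
  "G \<odot>\<^bsub>t\<^esub> F =
     (\<Sum>a \<in> Poly_Mapping.keys F. \<Sum>b \<in> Poly_Mapping.keys G.
        Poly_Mapping.single (dcomp b a)
          (t ^ loops b a * Poly_Mapping.lookup G b * Poly_Mapping.lookup F a))"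

text \<open>\<open>btens m n F G\<close> is \<open>F \<otimes> G\<close> for \<open>F : m \<rightarrow> n\<close>.\<close>

definition btens :: "nat \<Rightarrow> nat \<Rightarrow> bmor \<Rightarrow> bmor \<Rightarrow> bmor" where
  "btens m n F G =
     (\<Sum>a \<in> Poly_Mapping.keys F. \<Sum>b \<in> Poly_Mapping.keys G.
        Poly_Mapping.single (dtens m n a b) (Poly_Mapping.lookup F a * Poly_Mapping.lookup G b))"

definition bperm :: "nat \<Rightarrow> (nat \<Rightarrow> nat) \<Rightarrow> bmor" where
  "bperm n \<pi> =
     Poly_Mapping.single ({(Inl i, Inr (\<pi> i)) |i. i < n} \<union> {(Inr (\<pi> i), Inl i) |i. i < n}) 1"

definition bid :: "nat \<Rightarrow> bmor" where
  "bid n = bperm n id"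

text \<open>The evaluation \<open>V \<otimes> V \<rightarrow> 1\<close> and the coevaluation \<open>1 \<rightarrow> V \<otimes> V\<close>; the latter is the case \<open>d = 1\<close> of
  \<open>1 \<rightarrow> V\<^sup>\<otimes>\<^sup>d \<otimes> V\<^sup>\<otimes>\<^sup>d\<close> joining the \<open>i\<close>-th to the \<open>(d + i)\<close>-th factor.\<close>

definition bcap :: bmor where
  "bcap = Poly_Mapping.single {(Inl 0, Inl 1), (Inl 1, Inl 0)} 1"

definition bcups :: "nat \<Rightarrow> bmor" where
  "bcups d =
     Poly_Mapping.single ({(Inr i, Inr (d + i)) |i. i < d} \<union> {(Inr (d + i), Inr i) |i. i < d}) 1"

abbreviation bcup :: bmor where
  "bcup \<equiv> bcups 1"


section \<open>The Karoubi envelope\<close>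

text \<open>
  \<open>Rep(O\<^sub>t)\<close> is the Karoubi envelope of the additive envelope of the Brauer category. Only objects
  \<open>(n, e)\<close>, the image of an idempotent \<open>e\<close> of \<open>V\<^sup>\<otimes>\<^sup>n\<close>, are needed; every other object is a direct sum of
  these, so kernels may be tested on them. An object of the inductive completion such as \<open>P\<close> is
  represented by its family of graded pieces. The object \<open>V\<close> is identified with its dual through the
  evaluation.
\<close>

type_synonym kobj = "nat \<times> bmor"

definition kobjs :: "complex \<Rightarrow> kobj set" where
  "kobjs t = {(n, e). e \<in> bhom n n \<and> e \<odot>\<^bsub>t\<^esub> e = e}"

definition khom :: "complex \<Rightarrow> kobj \<Rightarrow> kobj \<Rightarrow> bmor set" where
  "khom t X Y = {F \<in> bhom (fst X) (fst Y). snd Y \<odot>\<^bsub>t\<^esub> F = F \<and> F \<odot>\<^bsub>t\<^esub> snd X = F}"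

text \<open>The identity morphism of \<open>(n, e)\<close> is \<open>e\<close>.\<close>

definition kid :: "kobj \<Rightarrow> bmor" where
  "kid X = snd X"

definition kunit :: kobj where
  "kunit = (0, bid 0)"

definition ktens :: "kobj \<Rightarrow> kobj \<Rightarrow> kobj" where
  "ktens X Y = (fst X + fst Y, btens (fst X) (fst X) (snd X) (snd Y))"

definition is_kernel :: "complex \<Rightarrow> kobj \<Rightarrow> bmor \<Rightarrow> kobj \<Rightarrow> bmor \<Rightarrow> kobj \<Rightarrow> bool" where
  "is_kernel t K i X h Y \<longleftrightarrow>
     K \<in> kobjs t \<and> i \<in> khom t K X \<and> h \<in> khom t X Y \<and> h \<odot>\<^bsub>t\<^esub> i = 0 \<and>
     (\<forall>Z \<in> kobjs t. \<forall>g \<in> khom t Z X. h \<odot>\<^bsub>t\<^esub> g = 0 \<longrightarrow> (\<exists>!u. u \<in> khom t Z K \<and> i \<odot>\<^bsub>t\<^esub> u = g))"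

definition kpow :: "complex \<Rightarrow> kobj \<Rightarrow> bmor \<Rightarrow> nat \<Rightarrow> bmor" where
  "kpow t X F n = ((\<lambda>G. F \<odot>\<^bsub>t\<^esub> G) ^^ n) (kid X)"

definition kpoly :: "complex \<Rightarrow> kobj \<Rightarrow> complex poly \<Rightarrow> bmor \<Rightarrow> bmor" where
  "kpoly t X p F = (\<Sum>i\<le>degree p. bscale (coeff p i) (kpow t X F i))"

definition kminpoly :: "complex \<Rightarrow> kobj \<Rightarrow> bmor \<Rightarrow> complex poly" where
  "kminpoly t X F =
     (THE p. lead_coeff p = 1 \<and> kpoly t X p F = 0 \<and> (\<forall>q. kpoly t X q F = 0 \<longrightarrow> p dvd q))"


section \<open>Polynomials and differential operators\<close>

definition symz :: "nat \<Rightarrow> bmor" where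
  "symz d = bscale (1 / fact d) (\<Sum>\<pi> | \<pi> permutes {..<d}. bperm d \<pi>)"

text \<open>\<open>P\<^sup>d = S\<^sup>d(V)\<close>, which is also \<open>S\<^sup>d(V\<^sup>*)\<close>.\<close>

definition Sym :: "nat \<Rightarrow> kobj" where
  "Sym d = (d, symz d)"

definition mult :: "complex \<Rightarrow> nat \<Rightarrow> nat \<Rightarrow> bmor" where
  "mult t a b = symz (a + b) \<odot>\<^bsub>t\<^esub> btens a a (symz a) (symz b)"

text \<open>
  The derivation \<open>V\<^sup>* \<otimes> P\<^sup>q \<rightarrow> P\<^sup>q\<^sup>-\<^sup>1\<close> extending the evaluation, by the Leibniz rule: in the \<open>i\<close>-th term the
  \<open>i\<close>-th factor is moved to the front and contracted with the vector of \<open>V\<^sup>*\<close>, and the remaining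
  factors are multiplied.
\<close>

definition derivation :: "complex \<Rightarrow> nat \<Rightarrow> bmor" where
  "derivation t q =
     (\<Sum>i<q. symz (q - 1) \<odot>\<^bsub>t\<^esub> btens 2 0 bcap (bid (q - 1)) \<odot>\<^bsub>t\<^esub>
             btens 1 1 (bid 1) (bperm q (Transposition.transpose 0 i) \<odot>\<^bsub>t\<^esub> symz q))"

text \<open>Composites of \<open>p\<close> derivations, first on \<open>(V\<^sup>*)\<^sup>\<otimes>\<^sup>p \<otimes> P\<^sup>q\<close>, then on \<open>S\<^sup>p(V\<^sup>*) \<otimes> P\<^sup>q\<close>, with values in \<open>P\<^sup>q\<^sup>-\<^sup>p\<close>.
  Both vanish if \<open>p > q\<close>, since \<open>derivation t 0 = 0\<close>.\<close>

primrec contr_tensor :: "complex \<Rightarrow> nat \<Rightarrow> nat \<Rightarrow> bmor" where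
  "contr_tensor t 0 q = symz q"
| "contr_tensor t (Suc p) q =
     derivation t (q - p) \<odot>\<^bsub>t\<^esub> btens 1 1 (bid 1) (contr_tensor t p q)"

definition contr :: "complex \<Rightarrow> nat \<Rightarrow> nat \<Rightarrow> bmor" where
  "contr t p q = contr_tensor t p q \<odot>\<^bsub>t\<^esub> btens p p (symz p) (symz q)"

text \<open>\<open>A\<^sub>t\<close>, with an element given by its components \<open>1 \<rightarrow> S\<^sup>p(V) \<otimes> S\<^sup>p(V\<^sup>*)\<close>, and its action on \<open>P\<^sup>q\<close>, to which
  the components with \<open>p > q\<close> do not contribute.\<close>

definition A_alg :: "complex \<Rightarrow> (nat \<Rightarrow> bmor) set" where
  "A_alg t = {D. finite {p. D p \<noteq> 0} \<and> (\<forall>p. D p \<in> khom t kunit (ktens (Sym p) (Sym p)))}"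

definition act :: "complex \<Rightarrow> (nat \<Rightarrow> bmor) \<Rightarrow> nat \<Rightarrow> bmor" where
  "act t D q =
     (\<Sum>p\<le>q. mult t p (q - p) \<odot>\<^bsub>t\<^esub> btens p p (symz p) (contr t p q) \<odot>\<^bsub>t\<^esub>
              btens 0 (p + p) (D p) (symz q))"

definition E_elt :: "nat \<Rightarrow> bmor" where
  "E_elt p = (if p = 1 then bcup else 0)"

text \<open>\<open>\<Theta> : P\<^sup>d \<rightarrow> P\<^sup>d\<^sup>+\<^sup>2\<close> and \<open>\<Delta> : P\<^sup>d \<rightarrow> P\<^sup>d\<^sup>-\<^sup>2\<close> (the latter is zero if \<open>d < 2\<close>).\<close>

definition Theta :: "complex \<Rightarrow> nat \<Rightarrow> bmor" where
  "Theta t d = bscale (1/2) (mult t 2 d \<odot>\<^bsub>t\<^esub> btens 0 2 (symz 2 \<odot>\<^bsub>t\<^esub> bcup) (symz d))"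

definition Delta :: "complex \<Rightarrow> nat \<Rightarrow> bmor" where
  "Delta t d = bscale (1/2) (contr t 2 d \<odot>\<^bsub>t\<^esub> btens 0 2 (symz 2 \<odot>\<^bsub>t\<^esub> bcup) (symz d))"

definition casimir :: "complex \<Rightarrow> nat \<Rightarrow> bmor" where
  "casimir t d =
     (act t E_elt d \<odot>\<^bsub>t\<^esub> act t E_elt d) + bscale t (act t E_elt d)
       - bscale 4 (Theta t (d - 2) \<odot>\<^bsub>t\<^esub> Delta t d) - bscale 2 (act t E_elt d)"


section \<open>Partitions and components\<close>

definition partitions2 :: "(nat \<times> nat) set" where
  "partitions2 = {(l1, l2). l2 \<le> l1}"

definition psize :: "nat \<times> nat \<Rightarrow> nat" where
  "psize lam = fst lam + snd lam"

definition k_regular :: "nat \<Rightarrow> nat \<times> nat \<Rightarrow> bool" where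
  "k_regular k lam \<longleftrightarrow>
     fst lam \<le> k \<or> fst lam - snd lam = k + 1 \<or> fst lam - snd lam \<ge> 2 * k + 3"

definition k_quasiregular :: "nat \<Rightarrow> nat \<times> nat \<Rightarrow> bool" where
  "k_quasiregular k lam \<longleftrightarrow> fst lam \<ge> k + 1 \<and> fst lam - snd lam \<le> k"

definition k_singular :: "nat \<Rightarrow> nat \<times> nat \<Rightarrow> bool" where
  "k_singular k lam \<longleftrightarrow> k + 2 \<le> fst lam - snd lam \<and> fst lam - snd lam \<le> 2 * k + 2"

definition I' :: "nat \<Rightarrow> (nat \<times> nat) set" where
  "I' k = {lam \<in> partitions2. k_regular k lam \<or> k_quasiregular k lam}"

definition dagger :: "nat \<Rightarrow> nat \<times> nat \<Rightarrow> nat \<times> nat" where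
  "dagger k lam = (snd lam + k + 1, fst lam - k - 1)"

definition c_eig :: "nat \<times> nat \<Rightarrow> complex \<Rightarrow> complex" where
  "c_eig lam s = of_nat (fst lam - snd lam) * (of_nat (fst lam - snd lam) + s - 2)"

definition casimir_shift :: "complex \<Rightarrow> nat \<times> nat \<Rightarrow> bmor" where
  "casimir_shift t lam = casimir t (psize lam) - bscale (c_eig lam t) (kid (Sym (psize lam)))"

definition m_mult :: "complex \<Rightarrow> nat \<times> nat \<Rightarrow> nat" where
  "m_mult t lam = order (c_eig lam t) (kminpoly t (Sym (psize lam)) (casimir t (psize lam)))"

text \<open>
  The decomposition of \<open>P\<^sup>d\<close> into the generalized eigenspaces \<open>ker ((C - c\<^sub>\<lambda>(t))\<^sup>m)\<close> with \<open>m = m\<^sub>\<lambda>\<close>, given by the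
  family of idempotents \<open>e \<lambda>\<close> of \<open>End(P\<^sup>d)\<close> that project onto the summands; \<open>e \<lambda>\<close> is also the inclusion
  of the summand \<open>(d, e \<lambda>)\<close> into \<open>P\<^sup>d\<close>.
\<close>

definition is_decomposition :: "complex \<Rightarrow> nat \<Rightarrow> nat \<Rightarrow> (nat \<times> nat \<Rightarrow> bmor) \<Rightarrow> bool" where
  "is_decomposition t k d e \<longleftrightarrow>
     (\<forall>lam. lam \<in> I' k \<and> psize lam = d \<longrightarrow>
        is_kernel t (d, e lam) (e lam) (Sym d)
          (kpow t (Sym d) (casimir_shift t lam) (m_mult t lam)) (Sym d)) \<and>
     (\<forall>lam. \<not> (lam \<in> I' k \<and> psize lam = d) \<longrightarrow> e lam = 0) \<and>
     (\<forall>lam \<in> I' k. \<forall>mu \<in> I' k. lam \<noteq> mu \<longrightarrow> e lam \<odot>\<^bsub>t\<^esub> e mu = 0) \<and>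
     (\<forall>lam \<in> I' k. e lam \<in> khom t (Sym d) (Sym d)) \<and>
     (\<Sum>lam | lam \<in> I' k \<and> psize lam = d. e lam) = kid (Sym d)"

definition V_idem :: "complex \<Rightarrow> nat \<Rightarrow> nat \<times> nat \<Rightarrow> bmor" where
  "V_idem t k lam = (THE e. is_decomposition t k (psize lam) e) lam"

definition V_obj :: "complex \<Rightarrow> nat \<Rightarrow> nat \<times> nat \<Rightarrow> kobj" where
  "V_obj t k lam = (psize lam, V_idem t k lam)"


section \<open>Capelli operators and eigenvalue polynomials\<close>

text \<open>
  The coevaluation \<open>1 \<rightarrow> S\<^sup>d(V) \<otimes> S\<^sup>d(V\<^sup>*)\<close> for the duality whose evaluation is the contraction pairing
  \<open>contr t d d : S\<^sup>d(V\<^sup>*) \<otimes> S\<^sup>d(V) \<rightarrow> 1\<close>. The latter is \<open>d!\<close> times the pairing inherited from \<open>V\<^sup>\<otimes>\<^sup>d\<close>, whence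
  the factor.
\<close>

definition Sym_coev :: "complex \<Rightarrow> nat \<Rightarrow> bmor" where
  "Sym_coev t d = bscale (1 / fact d) (btens d d (symz d) (symz d) \<odot>\<^bsub>t\<^esub> bcups d)"

text \<open>The element of \<open>A\<^sub>t\<close> corresponding to an endomorphism of \<open>P\<^sup>d\<close>.\<close>

definition elt_of_endo :: "complex \<Rightarrow> nat \<Rightarrow> bmor \<Rightarrow> nat \<Rightarrow> bmor" where
  "elt_of_endo t d F p = (if p = d then btens d d F (symz d) \<odot>\<^bsub>t\<^esub> Sym_coev t d else 0)"

definition capelli :: "complex \<Rightarrow> nat \<Rightarrow> nat \<times> nat \<Rightarrow> nat \<Rightarrow> bmor" where
  "capelli t k lam =
     elt_of_endo t (psize lam) (casimir_shift t lam \<odot>\<^bsub>t\<^esub> V_idem t k (dagger k lam))"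

text \<open>
  Polynomials in \<open>x, y\<close> are polynomials in \<open>y\<close> whose coefficients are polynomials in \<open>x\<close>.
\<close>

abbreviation Xv :: "complex poly poly" where "Xv \<equiv> [:[:0, 1:]:]"
abbreviation Yv :: "complex poly poly" where "Yv \<equiv> [:0, 1:]"

definition eval2 :: "complex poly poly \<Rightarrow> complex \<Rightarrow> complex \<Rightarrow> complex" where
  "eval2 f x y = poly (poly f [:y:]) x"

definition symmetric2 :: "complex poly poly \<Rightarrow> bool" where
  "symmetric2 f \<longleftrightarrow> (\<forall>i j. coeff (coeff f i) j = coeff (coeff f j) i)"

definition is_eigenvalue_poly ::
  "complex \<Rightarrow> nat \<Rightarrow> (nat \<Rightarrow> bmor) \<Rightarrow> complex poly poly \<Rightarrow> bool" where
  "is_eigenvalue_poly t k D f \<longleftrightarrow>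
     symmetric2 f \<and>
     (\<forall>mu \<in> I' k. \<exists>\<eta> \<in> khom t (V_obj t k mu) (V_obj t k mu).
        \<eta> \<odot>\<^bsub>t\<^esub> \<eta> = 0 \<and>
        act t D (psize mu) \<odot>\<^bsub>t\<^esub> V_idem t k mu =
          bscale (eval2 f (of_nat (fst mu) - of_nat k - 1) (of_nat (snd mu))) (kid (V_obj t k mu)) + \<eta>)"

definition eigenvalue_poly :: "complex \<Rightarrow> nat \<Rightarrow> (nat \<Rightarrow> bmor) \<Rightarrow> complex poly poly" where
  "eigenvalue_poly t k D = (THE f. is_eigenvalue_poly t k D f)"


section \<open>Knop--Sahi polynomials\<close>

definition ffact :: "'a::comm_ring_1 \<Rightarrow> nat \<Rightarrow> 'a" where
  "ffact a r = (\<Prod>i<r. a - of_nat i)"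

text \<open>
  The specialization of the coefficients at a complex number \<open>\<kappa>\<close>, meant for \<open>\<kappa>\<close> that is not a zero of
  the denominator; in particular for all nonintegral \<open>\<kappa>\<close>.
\<close>

definition knop_sahi :: "complex \<Rightarrow> nat \<times> nat \<Rightarrow> complex poly poly" where
  "knop_sahi \<kappa> lam =
     (let n = fst lam - snd lam in
      \<Sum>i\<le>n. \<Sum>j\<le>n - i.
        smult [:fact n * ffact (\<kappa> + 1) (n - i) * ffact (\<kappa> + 1) (n - j) /
                (fact i * fact j * fact (n - i - j) * ffact (\<kappa> + 1) n):]
          (ffact Xv (snd lam + i) * ffact Yv (snd lam + j)))"

definition H_norm :: "nat \<times> nat \<Rightarrow> complex \<Rightarrow> complex" where
  "H_norm lam \<kappa> =
     fact (fst lam - snd lam) * fact (snd lam) * ffact (of_nat (fst lam) - 1 - \<kappa>) (snd lam)"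

definition coeffwise_tendsto ::
  "(complex \<Rightarrow> complex poly poly) \<Rightarrow> complex poly poly \<Rightarrow> complex filter \<Rightarrow> bool" where
  "coeffwise_tendsto F f Fl \<longleftrightarrow>
     (\<forall>i j. ((\<lambda>s. coeff (coeff (F s) i) j) \<longlongrightarrow> coeff (coeff f i) j) Fl)"

end

theory Submission
  imports Defs "HOL-Computational_Algebra.Formal_Power_Series"
begin

text \<open>
  Identities between Brauer morphisms depend polynomially on \<open>t\<close>, so they may be checked at \<open>t = N\<close>, where
  diagrams act on tensors over an \<open>N\<close>-dimensional space; between symmetric powers it suffices to pair
  with pure powers \<open>v\<^sup>\<otimes>\<^sup>d\<close> and \<open>w\<^sup>\<otimes>\<^sup>d\<close>. In this way \<open>4\<^sup>r \<Theta>\<^sup>r \<Delta>\<^sup>r\<close> is, on \<open>P\<^sup>d\<close>, the product of the \<open>z\<^sub>i - C\<close> over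
  \<open>i < r\<close>, where \<open>z\<^sub>i = (d - 2i)(d - 2i + t - 2)\<close>. These products are independent for \<open>2r \<le> d\<close>, which
  gives the minimal polynomial of \<open>C\<close>, and then the projections onto the \<open>V\<^sub>\<mu>\<close> are polynomials in \<open>C\<close>. The
  element of \<open>A\<^sub>t\<close> given by the endomorphism \<open>\<Theta>\<^sup>r \<Delta>\<^sup>r\<close> of \<open>P\<^sup>d\<close> acts on \<open>P\<^sup>q\<close> as \<open>binom (q - 2r) (d - 2r) \<Theta>\<^sup>r \<Delta>\<^sup>r\<close>, with
  eigenvalue \<open>binom (q - 2r) (d - 2r) x\<^sup>(\<^sup>r\<^sup>) y\<^sup>(\<^sup>r\<^sup>)\<close> on \<open>V\<^sub>\<mu>\<close> for \<open>x = \<mu>\<^sub>1 - k - 1\<close>, \<open>y = \<mu>\<^sub>2\<close> and falling powers \<open>x\<^sup>(\<^sup>r\<^sup>)\<close>,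
  \<open>y\<^sup>(\<^sup>r\<^sup>)\<close>. The endomorphism defining the Capelli operator is a multiple of a Lagrange interpolation polynomial
  in \<open>C\<close> for the nodes \<open>z\<^sub>i\<close>; its Newton form is explicit, and the resulting sum of terms
  \<open>binom (x + y + k + 1 - 2r) (d - 2r) x\<^sup>(\<^sup>r\<^sup>) y\<^sup>(\<^sup>r\<^sup>)\<close> becomes the Knop--Sahi polynomial by the Vandermonde identities.
\<close>


section \<open>Brauer diagrams\<close>

text \<open>Linear independence, unlike an identity, does not pass from \<open>t = N\<close> to all
  \<open>t\<close>. Here it does, because the elements 4^r Theta^r Delta^r are symmetrized diagrams:
  composing with permutations creates no loops, so as combinations of diagrams they do not depend on
  \<open>t\<close>.

  The operator C is not semisimple in general. For indices up to \<open>d div 2\<close>, nodes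
  coincide in pairs j' < j with j + j' + k + 1 = d, where j' is the second part of a singular
  partition and j that of its \<open>dagger\<close>. With c the common value, the minimal polynomial
  is (x - c)^2 h, and (x - c) h is the product of all x - z_i except the one for i = j. This is why
  the nilpotent part of C is an interpolation polynomial with a single omitted node, divided by
  h(c), and no derivative of h enters.

  In the limit the coefficients of the Knop-Sahi polynomial stay regular. In the scalar factor the
  difference of the eigenvalues, -4 (j - j') (k + s/2), vanishes at s = t, and so does exactly one
  factor of H, the one of index j'.\<close>

lemma even_card_Field_matching:
  assumes "finite r" "sym r" "irrefl r" "single_valued r"
  shows "even (card (Field r))"
proof -
  define C where "C = (\<lambda>(x, y). {x, y}) ` r"
  have U: "\<Union> C = Field r"
    by (auto simp: C_def Field_def)
  have "2 * card C = card (\<Union> C)"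
  proof (rule card_partition)
    show "finite C" using assms by (auto simp: C_def)
    show "finite (\<Union> C)" unfolding U using assms by (simp add: finite_Field)
    show "card c = 2" if "c \<in> C" for c
      using that assms(3) by (auto simp: C_def irrefl_def card_insert_if)
    show "c1 \<inter> c2 = {}" if "c1 \<in> C" "c2 \<in> C" "c1 \<noteq> c2" for c1 c2
    proof (rule ccontr)
      assume "c1 \<inter> c2 \<noteq> {}"
      then obtain p where p: "p \<in> c1" "p \<in> c2" by blast
      have "\<exists>q. (p, q) \<in> r \<and> c = {p, q}" if "c \<in> C" "p \<in> c" for c
        using that assms(2) unfolding C_def sym_def by auto
      then show False
        using that p assms(4) unfolding single_valued_def by metis
    qed
  qed
  then show ?thesis using U by (metis dvd_triv_left)
qed

text \<open>The union of two matchings splits into alternating paths and cycles, and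
  \<open>x\<close> is an end of a path. The alternating walk from \<open>x\<close> is deterministic,
  so there is at most one other end. There is at least one, because otherwise the component of
  \<open>x\<close> would meet the two fields in sets whose sizes differ by one, while both sizes are
  even.\<close>

lemma matching_union_unique_end:
  fixes \<alpha> \<beta> :: "'v rel"
  assumes fin: "finite \<alpha>" "finite \<beta>" and sy: "sym \<alpha>" "sym \<beta>" and irr: "irrefl \<alpha>" "irrefl \<beta>"
    and sv: "single_valued \<alpha>" "single_valued \<beta>"
    and x: "x \<in> Field \<alpha>" "x \<notin> Field \<beta>"
  shows "\<exists>!y. y \<noteq> x \<and> (x, y) \<in> (\<alpha> \<union> \<beta>)\<^sup>* \<and> (y \<in> Field \<alpha> \<longleftrightarrow> y \<notin> Field \<beta>)"
proof -
  \<comment> \<open>In state \<open>(p, True)\<close> the walk stands at \<open>p\<close> and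
    continues along \<open>\<alpha>\<close>, in state \<open>(p, False)\<close> it continues along
    \<open>\<beta>\<close>.\<close>
  define R where "R = {((p, True), (q, False)) |p q. (p, q) \<in> \<alpha>} \<union>
                      {((p, False), (q, True)) |p q. (p, q) \<in> \<beta>}"
  have svR: "single_valued R"
    using sv by (auto simp: single_valued_def R_def)
  have flip: "(z, y) \<in> \<alpha> \<Longrightarrow> (y, z) \<in> \<alpha>" "(z, y) \<in> \<beta> \<Longrightarrow> (y, z) \<in> \<beta>" for y z
    using sy by (auto simp: sym_def)
  have pred: "(\<exists>p. (p, y) \<in> (if b then \<beta> else \<alpha>) \<and> ((x, True), (p, \<not> b)) \<in> R\<^sup>*) \<or> (y, b) = (x, True)"
    if "((x, True), (y, b)) \<in> R\<^sup>*" for y b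
    using that by (cases rule: rtranclE) (auto simp: R_def)
  \<comment> \<open>An edge at a visited point is either the next edge of the walk or the one by
    which the point was entered, and the latter leads back to an earlier state. So the walk visits
    the whole component.\<close>
  have reached: "\<exists>b. ((x, True), (y, b)) \<in> R\<^sup>*" if "(x, y) \<in> (\<alpha> \<union> \<beta>)\<^sup>*" for y
    using that
  proof (induction rule: rtrancl_induct)
    case base
    then show ?case by blast
  next
    case (step y z)
    then obtain b where b: "((x, True), (y, b)) \<in> R\<^sup>*" by blast
    from step.hyps(2) consider "(y, z) \<in> \<alpha>" | "(y, z) \<in> \<beta>" by blast
    then show ?case
    proof cases
      case 1
      show ?thesis
      proof (cases b)
        case True
        have "((y, True), (z, False)) \<in> R" using 1 by (auto simp: R_def)
        then have "((x, True), (z, False)) \<in> R\<^sup>*"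
          using b True by (metis (full_types) rtrancl.rtrancl_into_rtrancl)
        then show ?thesis by blast
      next
        case False
        then obtain p where "(p, y) \<in> \<alpha>" "((x, True), (p, True)) \<in> R\<^sup>*" using pred[OF b] by auto
        moreover from this 1 have "p = z" using flip sv(1) unfolding single_valued_def by blast
        ultimately show ?thesis by blast
      qed
    next
      case 2
      show ?thesis
      proof (cases b)
        case False
        have "((y, False), (z, True)) \<in> R" using 2 by (auto simp: R_def)
        then have "((x, True), (z, True)) \<in> R\<^sup>*"
          using b False by (metis (full_types) rtrancl.rtrancl_into_rtrancl)
        then show ?thesis by blast
      next
        case True
        have "y \<noteq> x" using 2 x(2) by (auto simp: Field_def)
        with True obtain p where "(p, y) \<in> \<beta>" "((x, True), (p, False)) \<in> R\<^sup>*" using pred[OF b] by auto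
        moreover from this 2 have "p = z" using flip sv(2) unfolding single_valued_def by blast
        ultimately show ?thesis by blast
      qed
    qed
  qed
  \<comment> \<open>The matching by which an end was entered is the only one that covers it, so the
    walk stops there.\<close>
  have terminal: "s = (y, b)"
    if yb: "((x, True), (y, b)) \<in> R\<^sup>*" "y \<noteq> x" "y \<in> Field \<alpha> \<longleftrightarrow> y \<notin> Field \<beta>"
      and s: "((y, b), s) \<in> R\<^sup>*" for y b s
    using s
  proof (cases rule: converse_rtranclE)
    case (step s')
    obtain p where p: "(p, y) \<in> (if b then \<beta> else \<alpha>)"
      using pred[OF yb(1)] yb(2) by auto
    show ?thesis
      using step(1) p yb(3) by (cases b) (auto simp: R_def Field_def)
  qed auto
  have uniq: "y = z"
    if "y \<noteq> x" "(x, y) \<in> (\<alpha> \<union> \<beta>)\<^sup>*" "y \<in> Field \<alpha> \<longleftrightarrow> y \<notin> Field \<beta>"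
       "z \<noteq> x" "(x, z) \<in> (\<alpha> \<union> \<beta>)\<^sup>*" "z \<in> Field \<alpha> \<longleftrightarrow> z \<notin> Field \<beta>" for y z
  proof -
    from reached[OF that(2)] reached[OF that(5)]
    obtain b c where bc: "((x, True), (y, b)) \<in> R\<^sup>*" "((x, True), (z, c)) \<in> R\<^sup>*"
      by blast
    from single_valued_confluent[OF svR this] show ?thesis
      using terminal[OF bc(1) that(1,3)] terminal[OF bc(2) that(4,6)] by blast
  qed
  have ex: "\<exists>y. y \<noteq> x \<and> (x, y) \<in> (\<alpha> \<union> \<beta>)\<^sup>* \<and> (y \<in> Field \<alpha> \<longleftrightarrow> y \<notin> Field \<beta>)"
  proof (rule ccontr)
    assume none: "\<not> ?thesis"
    define S where "S = (\<alpha> \<union> \<beta>)\<^sup>* `` {x}"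
    have clos: "p \<in> S \<longleftrightarrow> q \<in> S" if "(p, q) \<in> \<alpha> \<union> \<beta>" for p q
    proof -
      have "(q, p) \<in> \<alpha> \<union> \<beta>" using that flip by blast
      with that show ?thesis unfolding S_def
        by (meson Image_singleton_iff rtrancl.rtrancl_into_rtrancl)
    qed
    have ev: "even (card (Field \<gamma> \<inter> S))"
      if \<gamma>: "finite \<gamma>" "sym \<gamma>" "irrefl \<gamma>" "single_valued \<gamma>" "\<gamma> \<subseteq> \<alpha> \<union> \<beta>" for \<gamma>
    proof -
      have "Field (\<gamma> \<inter> S \<times> S) = Field \<gamma> \<inter> S"
        using clos \<gamma>(5) unfolding Field_def by blast
      moreover have "even (card (Field (\<gamma> \<inter> S \<times> S)))"
        using \<gamma> by (intro even_card_Field_matching)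
          (auto simp: sym_def irrefl_def single_valued_def)
      ultimately show ?thesis by simp
    qed
    have "x \<in> S" by (auto simp: S_def)
    have "Field \<alpha> \<inter> S = insert x (Field \<beta> \<inter> S)"
      using none x \<open>x \<in> S\<close> by (auto simp: S_def)
    moreover have "finite (Field \<beta> \<inter> S)" using fin by (simp add: finite_Field)
    ultimately have "card (Field \<alpha> \<inter> S) = Suc (card (Field \<beta> \<inter> S))"
      using x by simp
    moreover have "even (card (Field \<alpha> \<inter> S))" "even (card (Field \<beta> \<inter> S))"
      using ev fin sy irr sv by auto
    ultimately show False by simp
  qed
  from ex uniq show ?thesis by (intro ex_ex1I) blast+
qed


section \<open>Composites of diagrams\<close>

lemma matching_map_prod:
  assumes "inj f"
  shows "sym r \<Longrightarrow> sym (map_prod f f ` r)" "irrefl r \<Longrightarrow> irrefl (map_prod f f ` r)"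
    "single_valued r \<Longrightarrow> single_valued (map_prod f f ` r)" "Field (map_prod f f ` r) = f ` Field r"
  using injD[OF assms] by (auto simp: sym_def irrefl_def single_valued_def Field_def)

lemma inj_levels: "inj (case_sum Bot Mid)" "inj (case_sum Mid Top)" "inj (case_sum Bot Top)"
  by (auto simp: inj_def split: sum.splits)

lemma finite_diagram: "a \<in> diagrams m n \<Longrightarrow> finite a"
  by (rule finite_subset[of a "Field a \<times> Field a"]) (auto simp: diagrams_def intro: FieldI1 FieldI2)

lemma finite_diagrams [simp]: "finite (diagrams m n)"
proof (rule finite_subset)
  let ?S = "Inl ` {..<m} \<union> Inr ` {..<n} :: (nat + nat) set"
  show "diagrams m n \<subseteq> Pow (?S \<times> ?S)"
  proof
    fix a assume "a \<in> diagrams m n"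
    then have "Field a = ?S" by (simp add: diagrams_def)
    moreover have "a \<subseteq> Field a \<times> Field a" by (auto intro: FieldI1 FieldI2)
    ultimately show "a \<in> Pow (?S \<times> ?S)" by simp
  qed
qed auto

lemma sym_glue:
  assumes "sym a" "sym b" shows "sym (glue b a)"
  using assms unfolding glue_def by (intro sym_Un matching_map_prod inj_levels)

lemma Field_glue:
  assumes "a \<in> diagrams m n" "b \<in> diagrams n p"
  shows "Field (glue b a) = Bot ` {..<m} \<union> Mid ` {..<n} \<union> Top ` {..<p}"
  using assms unfolding glue_def diagrams_def
  by (auto simp: Field_Un matching_map_prod inj_levels image_Un image_image)

lemma rtrancl_in_Field: "(x, y) \<in> r\<^sup>* \<Longrightarrow> x \<noteq> y \<Longrightarrow> x \<in> Field r \<and> y \<in> Field r"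
  by (metis FieldI1 FieldI2 converse_rtranclE rtranclE)

text \<open>In the glued diagram the points covered by only one of the two matchings are exactly the
  outer points, so each of them is joined by a path to exactly one other outer point.\<close>

lemma dcomp_in_diagrams:
  assumes a: "a \<in> diagrams m n" and b: "b \<in> diagrams n p"
  shows "dcomp b a \<in> diagrams m p"
proof -
  define \<alpha> where "\<alpha> = map_prod (case_sum Bot Mid) (case_sum Bot Mid) ` a"
  define \<beta> where "\<beta> = map_prod (case_sum Mid Top) (case_sum Mid Top) ` b"
  let ?g = "case_sum Bot Top :: nat + nat \<Rightarrow> level"
  let ?O = "Inl ` {..<m} \<union> Inr ` {..<p} :: (nat + nat) set"
  have G: "glue b a = \<alpha> \<union> \<beta>" by (simp add: glue_def \<alpha>_def \<beta>_def)
  have F: "Field \<alpha> = Bot ` {..<m} \<union> Mid ` {..<n}" "Field \<beta> = Mid ` {..<n} \<union> Top ` {..<p}"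
    using a b unfolding \<alpha>_def \<beta>_def diagrams_def
    by (auto simp: matching_map_prod inj_levels image_Un image_image)
  have pr: "finite \<alpha>" "finite \<beta>" "sym \<alpha>" "sym \<beta>" "irrefl \<alpha>" "irrefl \<beta>" "single_valued \<alpha>" "single_valued \<beta>"
    using a b finite_diagram[OF a] finite_diagram[OF b]
    by (auto simp: \<alpha>_def \<beta>_def diagrams_def matching_map_prod inj_levels)
  have ends: "(y \<in> Field \<alpha> \<longleftrightarrow> y \<notin> Field \<beta>) \<longleftrightarrow> y \<in> ?g ` ?O" if "y \<in> Field (\<alpha> \<union> \<beta>)" for y
    using that unfolding image_Un image_image by (auto simp: F)
  have uniq: "\<exists>!y. y \<noteq> x \<and> (x, y) \<in> (\<alpha> \<union> \<beta>)\<^sup>* \<and> y \<in> ?g ` ?O" if "x \<in> ?g ` ?O" for x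
  proof -
    have "x \<in> Field \<alpha> \<and> x \<notin> Field \<beta> \<or> x \<in> Field \<beta> \<and> x \<notin> Field \<alpha>"
      using that unfolding image_Un image_image by (auto simp: F)
    then have "\<exists>!y. y \<noteq> x \<and> (x, y) \<in> (\<alpha> \<union> \<beta>)\<^sup>* \<and> (y \<in> Field \<alpha> \<longleftrightarrow> y \<notin> Field \<beta>)"
    proof
      assume "x \<in> Field \<alpha> \<and> x \<notin> Field \<beta>"
      then show ?thesis using matching_union_unique_end[of \<alpha> \<beta> x] pr by blast
    next
      assume "x \<in> Field \<beta> \<and> x \<notin> Field \<alpha>"
      then have "\<exists>!y. y \<noteq> x \<and> (x, y) \<in> (\<beta> \<union> \<alpha>)\<^sup>* \<and> (y \<in> Field \<beta> \<longleftrightarrow> y \<notin> Field \<alpha>)"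
        using matching_union_unique_end[of \<beta> \<alpha> x] pr by blast
      then show ?thesis by (metis Un_commute)
    qed
    moreover have "(y \<noteq> x \<and> (x, y) \<in> (\<alpha> \<union> \<beta>)\<^sup>* \<and> (y \<in> Field \<alpha> \<longleftrightarrow> y \<notin> Field \<beta>)) \<longleftrightarrow>
                   (y \<noteq> x \<and> (x, y) \<in> (\<alpha> \<union> \<beta>)\<^sup>* \<and> y \<in> ?g ` ?O)" for y
      using ends[of y] rtrancl_in_Field[of x y "\<alpha> \<union> \<beta>"] by blast
    ultimately show ?thesis by simp
  qed
  have inj: "?g s = ?g s' \<longleftrightarrow> s = s'" for s s'
    using inj_levels(3) by (auto simp: inj_def)
  have outer: "s \<in> ?O" if "?g s \<in> Field (\<alpha> \<union> \<beta>)" for s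
    using that by (cases s) (auto simp: F Field_Un)
  have mem: "(s, s') \<in> dcomp b a \<longleftrightarrow> s \<noteq> s' \<and> (?g s, ?g s') \<in> (\<alpha> \<union> \<beta>)\<^sup>*" for s s'
    by (simp add: dcomp_def G)
  have mem_O: "s \<in> ?O \<and> s' \<in> ?O" if "(s, s') \<in> dcomp b a" for s s'
    using that rtrancl_in_Field[of "?g s" "?g s'"] outer inj unfolding mem by blast
  have "sym ((\<alpha> \<union> \<beta>)\<^sup>*)" using pr by (intro sym_rtrancl sym_Un)
  then have 1: "sym (dcomp b a)" by (auto simp: sym_def mem)
  have 2: "irrefl (dcomp b a)" by (auto simp: irrefl_def mem)
  have 3: "single_valued (dcomp b a)"
  proof (rule single_valuedI)
    fix s s1 s2 assume *: "(s, s1) \<in> dcomp b a" "(s, s2) \<in> dcomp b a"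
    then have "s \<in> ?O" "s1 \<in> ?O" "s2 \<in> ?O" using mem_O by blast+
    with uniq[of "?g s"] * have "?g s1 = ?g s2" unfolding mem by (metis imageI inj)
    then show "s1 = s2" by (simp add: inj)
  qed
  have "s \<in> Field (dcomp b a)" if s: "s \<in> ?O" for s
  proof -
    obtain y where y: "y \<noteq> ?g s" "(?g s, y) \<in> (\<alpha> \<union> \<beta>)\<^sup>*" "y \<in> ?g ` ?O"
      using uniq[of "?g s"] s by blast
    then obtain s' where s': "y = ?g s'" by blast
    with y have "(s, s') \<in> dcomp b a" by (auto simp: mem)
    then show ?thesis by (auto simp: Field_def)
  qed
  then have "Field (dcomp b a) = ?O"
    using mem_O unfolding Field_def by blast
  with 1 2 3 show ?thesis by (simp add: diagrams_def)
qed


section \<open>Colourings\<close>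

definition colourings :: "nat \<Rightarrow> nat \<Rightarrow> nat list set" where
  "colourings N n = {xs. set xs \<subseteq> {..<N} \<and> length xs = n}"

text \<open>As a number 0 or 1 this is an entry of the matrix by which the diagram acts on tensors
  over an \<open>N\<close>-dimensional space: the product of the Kronecker deltas over the matched
  pairs.\<close>

definition compat :: "diag \<Rightarrow> nat list \<Rightarrow> nat list \<Rightarrow> bool" where
  "compat a xs ys \<longleftrightarrow>
     (\<forall>(p, q) \<in> a. case_sum ((!) xs) ((!) ys) p = case_sum ((!) xs) ((!) ys) q)"

lemma finite_colourings [simp]: "finite (colourings N n)"
  unfolding colourings_def by (rule finite_lists_length_eq) simp

lemma colourings_nth: "xs \<in> colourings N n \<Longrightarrow> i < n \<Longrightarrow> xs ! i < N"
  unfolding colourings_def by (auto simp: subset_iff)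

text \<open>Compatible colourings of the glued diagram are constant on its components, so only the colours
  of the closed loops are free once the outer points are coloured.\<close>

lemma card_middle_colourings:
  assumes a: "a \<in> diagrams m n" and b: "b \<in> diagrams n p"
    and x: "x \<in> colourings N m" and z: "z \<in> colourings N p"
  shows "card {y \<in> colourings N n. compat a x y \<and> compat b y z} =
         (if compat (dcomp b a) x z then N ^ loops b a else 0)"
proof -
  define G where "G = glue b a"
  define E where "E = G\<^sup>*"
  define Lp where "Lp = {C. \<exists>j. Mid j \<in> Field G \<and> C = E `` {Mid j} \<and> C \<subseteq> range Mid}"
  define \<kappa> where "\<kappa> = (\<lambda>y u. case u of Bot i \<Rightarrow> x ! i | Mid j \<Rightarrow> y ! j | Top i \<Rightarrow> z ! i)"
  have G_Field: "Field G = Bot ` {..<m} \<union> Mid ` {..<n} \<union> Top ` {..<p}"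
    unfolding G_def using a b by (rule Field_glue)
  have "sym G" unfolding G_def using a b by (intro sym_glue) (auto simp: diagrams_def)
  then have "sym E" unfolding E_def by (rule sym_rtrancl)
  have E_class: "E `` {u} = E `` {w}" if "(u, w) \<in> E" for u w
    using that \<open>sym E\<close> unfolding E_def by (auto simp: sym_def intro: rtrancl_trans)
  have E_Field: "w \<in> Field G" if "(u, w) \<in> E" "u \<in> Field G" for u w
    using rtrancl_in_Field[of u w G] that unfolding E_def by blast
  have compat_iff: "compat a x y \<and> compat b y z \<longleftrightarrow> (\<forall>(u, w) \<in> G. \<kappa> y u = \<kappa> y w)" for y
  proof -
    have 1: "case_sum ((!) x) ((!) y) s = \<kappa> y (case_sum Bot Mid s)" for s
      by (cases s) (auto simp: \<kappa>_def)
    have 2: "case_sum ((!) y) ((!) z) s = \<kappa> y (case_sum Mid Top s)" for s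
      by (cases s) (auto simp: \<kappa>_def)
    show ?thesis
      unfolding compat_def G_def glue_def 1 2 by fastforce
  qed
  have const: "\<kappa> y u = \<kappa> y w" if "compat a x y \<and> compat b y z" "(u, w) \<in> E" for y u w
    using that(2) unfolding E_def
    by (induction rule: rtrancl_induct) (use that(1) in \<open>auto simp: compat_iff\<close>)
  have outer: "\<kappa> y u = \<kappa> y' u" if "u \<notin> range Mid" for y y' u
    using that by (cases u) (auto simp: \<kappa>_def)
  show ?thesis
  proof (cases "compat (dcomp b a) x z")
    case False
    then obtain s s' where s: "(s, s') \<in> dcomp b a" "case_sum ((!) x) ((!) z) s \<noteq> case_sum ((!) x) ((!) z) s'"
      unfolding compat_def by blast
    have *: "case_sum ((!) x) ((!) z) s = \<kappa> y (case_sum Bot Top s)" for s y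
      by (cases s) (auto simp: \<kappa>_def)
    have "\<not> (compat a x y \<and> compat b y z)" for y
      using const[of y "case_sum Bot Top s" "case_sum Bot Top s'"] s
      unfolding *[of _ y] dcomp_def E_def G_def by blast
    then show ?thesis using False by simp
  next
    case True
    have outer_eq: "\<kappa> y u = \<kappa> y w" if uw: "(u, w) \<in> E" "u \<notin> range Mid" "w \<notin> range Mid" for u w y
    proof (cases "u = w")
      case False
      obtain s s' where s: "u = case_sum Bot Top s" "w = case_sum Bot Top s'"
      proof -
        have "\<exists>s. u = case_sum Bot Top s" if "u \<notin> range Mid" for u
        proof (cases u)
          case (Bot i) then show ?thesis by (intro exI[of _ "Inl i"]) simp
        next
          case (Top i) then show ?thesis by (intro exI[of _ "Inr i"]) simp
        qed (use that in auto)
        with uw that show thesis by blast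
      qed
      with False uw have "(s, s') \<in> dcomp b a" by (auto simp: dcomp_def E_def G_def)
      with True have "case_sum ((!) x) ((!) z) s = case_sum ((!) x) ((!) z) s'"
        unfolding compat_def by blast
      then show ?thesis unfolding s by (cases s; cases s') (auto simp: \<kappa>_def)
    qed simp
    \<comment> \<open>The colour of a point of the glued diagram: the free colour of its loop, or
      else the colour of some outer point of its component. The list \<open>[]\<close> stands for
      the middle colours, which are not read at an outer point.\<close>
    define \<phi> where "\<phi> = (\<lambda>h u. if E `` {u} \<in> Lp then h (E `` {u})
                          else \<kappa> [] (SOME w. (u, w) \<in> E \<and> w \<notin> range Mid))"
    define to_h where "to_h = (\<lambda>y::nat list. restrict (\<lambda>C. y ! (SOME j. Mid j \<in> C)) Lp)"
    define to_y where "to_y = (\<lambda>h. map (\<lambda>j. \<phi> h (Mid j)) [0..<n])"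
    let ?Y = "{y \<in> colourings N n. compat a x y \<and> compat b y z}"
    let ?H = "PiE Lp (\<lambda>_. {..<N})"
    have some_outer: "(u, SOME w. (u, w) \<in> E \<and> w \<notin> range Mid) \<in> E \<and> (SOME w. (u, w) \<in> E \<and> w \<notin> range Mid) \<notin> range Mid"
      if "u \<in> Field G" "E `` {u} \<notin> Lp" for u
    proof (rule someI_ex)
      show "\<exists>w. (u, w) \<in> E \<and> w \<notin> range Mid"
      proof (cases "u \<in> range Mid")
        case True
        then show ?thesis using that unfolding Lp_def by blast
      next
        case False
        then show ?thesis by (auto simp: E_def)
      qed
    qed
    have \<phi>_const: "\<phi> h u = \<phi> h w" if "(u, w) \<in> E" for h u w
    proof -
      have "(\<lambda>v. (u, v) \<in> E \<and> v \<notin> range Mid) = (\<lambda>v. (w, v) \<in> E \<and> v \<notin> range Mid)"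
        using E_class[OF that] by blast
      then show ?thesis unfolding \<phi>_def E_class[OF that] by simp
    qed
    have \<phi>_outer: "\<phi> h u = \<kappa> y u" if "u \<in> Field G" "u \<notin> range Mid" for h u y
    proof -
      have "E `` {u} \<notin> Lp" using that by (auto simp: Lp_def E_def)
      let ?w = "SOME w. (u, w) \<in> E \<and> w \<notin> range Mid"
      have "(u, ?w) \<in> E" "?w \<notin> range Mid"
        using some_outer[OF that(1) \<open>E `` {u} \<notin> Lp\<close>] by auto
      then have "\<kappa> [] ?w = \<kappa> y u"
        using outer_eq[of u ?w "[]"] that(2) outer[OF that(2), of y "[]"] by metis
      then show ?thesis
        using \<open>E `` {u} \<notin> Lp\<close> by (simp add: \<phi>_def)
    qed
    have loop_rep: "Mid (SOME j. Mid j \<in> C) \<in> C" if "C \<in> Lp" for C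
      by (rule someI_ex[of "\<lambda>j. Mid j \<in> C"]) (use that in \<open>auto simp: Lp_def E_def\<close>)
    have loop_class: "E `` {u} = C" if "C \<in> Lp" "u \<in> C" for C u
      using that E_class by (auto simp: Lp_def)
    have loop_Field: "C \<subseteq> Field G" if "C \<in> Lp" for C
      using that E_Field by (auto simp: Lp_def)
    have "bij_betw to_h ?Y ?H"
    proof (rule bij_betw_byWitness[where f' = to_y])
      show "\<forall>y\<in>?Y. to_y (to_h y) = y"
      proof (intro ballI nth_equalityI)
        fix y assume y: "y \<in> ?Y"
        then show "length (to_y (to_h y)) = length y" by (simp add: to_y_def colourings_def)
        fix j assume "j < length (to_y (to_h y))"
        then have j: "j < n" by (simp add: to_y_def)
        then have jF: "Mid j \<in> Field G" by (auto simp: G_Field)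
        show "to_y (to_h y) ! j = y ! j"
        proof (cases "E `` {Mid j} \<in> Lp")
          case True
          have "(Mid j, Mid (SOME i. Mid i \<in> E `` {Mid j})) \<in> E"
            using loop_rep[OF True] by simp
          with const[of y] y have "y ! (SOME i. Mid i \<in> E `` {Mid j}) = y ! j"
            by (fastforce simp: \<kappa>_def)
          then show ?thesis using j True by (simp add: to_y_def \<phi>_def to_h_def)
        next
          case False
          with some_outer[OF jF False] const[of y] y outer
          have "\<phi> (to_h y) (Mid j) = \<kappa> y (Mid j)"
            unfolding \<phi>_def by (metis (mono_tags, lifting) mem_Collect_eq)
          then show ?thesis using j by (simp add: to_y_def \<kappa>_def)
        qed
      qed
      have \<phi>_to_y: "\<phi> h u = \<kappa> (to_y h) u" if "u \<in> Field G" for h u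
      proof (cases "u \<in> range Mid")
        case True
        with that show ?thesis by (auto simp: \<kappa>_def to_y_def G_Field)
      qed (use \<phi>_outer that in blast)
      show "\<forall>h\<in>?H. to_h (to_y h) = h"
      proof (intro ballI ext)
        fix h C assume h: "h \<in> ?H"
        show "to_h (to_y h) C = h C"
        proof (cases "C \<in> Lp")
          case True
          let ?j = "SOME j. Mid j \<in> C"
          have "Mid ?j \<in> Field G" using loop_rep[OF True] loop_Field[OF True] by blast
          from \<phi>_to_y[OF this, of h] have "to_y h ! ?j = \<phi> h (Mid ?j)" by (simp add: \<kappa>_def)
          also have "\<dots> = h C"
            using loop_class[OF True loop_rep[OF True]] True by (simp add: \<phi>_def)
          finally show ?thesis using True by (simp add: to_h_def)
        next
          case False
          then show ?thesis using h by (auto simp: to_h_def PiE_def extensional_def)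
        qed
      qed
      show "to_h ` ?Y \<subseteq> ?H"
      proof (rule image_subsetI)
        fix y assume y: "y \<in> ?Y"
        have "y ! (SOME j. Mid j \<in> C) < N" if "C \<in> Lp" for C
        proof -
          have "Mid (SOME j. Mid j \<in> C) \<in> Field G" using loop_rep[OF that] loop_Field[OF that] by blast
          then show ?thesis using y colourings_nth by (auto simp: G_Field)
        qed
        then show "to_h y \<in> ?H" by (auto simp: to_h_def)
      qed
      show "to_y ` ?H \<subseteq> ?Y"
      proof (rule image_subsetI)
        fix h assume h: "h \<in> ?H"
        have "\<phi> h (Mid j) < N" if j: "j < n" for j
        proof (cases "E `` {Mid j} \<in> Lp")
          case True
          then show ?thesis using h by (auto simp: \<phi>_def)
        next
          case False
          have jF: "Mid j \<in> Field G" using j by (auto simp: G_Field)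
          let ?w = "SOME w. (Mid j, w) \<in> E \<and> w \<notin> range Mid"
          have w: "(Mid j, ?w) \<in> E" "?w \<notin> range Mid" using some_outer[OF jF False] by auto
          from E_Field[OF w(1) jF] w(2) have "\<kappa> [] ?w < N"
            using colourings_nth[OF x] colourings_nth[OF z] by (auto simp: G_Field \<kappa>_def)
          then show ?thesis using False by (simp add: \<phi>_def)
        qed
        moreover have "compat a x (to_y h) \<and> compat b (to_y h) z"
          unfolding compat_iff
        proof (clarify)
          fix u w assume uw: "(u, w) \<in> G"
          then have "(u, w) \<in> E" by (auto simp: E_def)
          from \<phi>_const[OF this] show "\<kappa> (to_y h) u = \<kappa> (to_y h) w"
            using \<phi>_to_y uw by (metis FieldI1 FieldI2)
        qed
        ultimately show "to_y h \<in> ?Y" by (auto simp: to_y_def colourings_def)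
      qed
    qed
    then have "card ?Y = card ?H" by (rule bij_betw_same_card)
    also have "\<dots> = N ^ card Lp"
    proof -
      have "finite Lp"
        by (rule finite_subset[of _ "(\<lambda>u. E `` {u}) ` Field G"]) (auto simp: Lp_def G_Field)
      then show ?thesis by (simp add: card_PiE)
    qed
    also have "card Lp = loops b a"
      by (simp add: loops_def Lp_def E_def G_def)
    finally show ?thesis using True by simp
  qed
qed


section \<open>Linear combinations of diagrams and their matrices\<close>

lemma lookup_bscale [simp]: "Poly_Mapping.lookup (bscale c F) a = c * Poly_Mapping.lookup F a"
  by (simp add: bscale_def Poly_Mapping.map.rep_eq when_def)

lemma bscale_simps [simp]:
  "bscale 0 F = 0" "bscale 1 F = F" "bscale c 0 = 0" "bscale c (bscale c' F) = bscale (c * c') F"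
  by (auto intro!: poly_mapping_eqI)

lemma bscale_add_left: "bscale (c + c') F = bscale c F + bscale c' F"
  by (rule poly_mapping_eqI) (simp add: lookup_add algebra_simps)

lemma bscale_diff_left: "bscale (c - c') F = bscale c F - bscale c' F"
  by (rule poly_mapping_eqI) (simp add: lookup_minus algebra_simps)

lemma bscale_sum: "bscale c (\<Sum>i\<in>S. F i) = (\<Sum>i\<in>S. bscale c (F i))"
  by (rule poly_mapping_eqI) (simp add: lookup_sum sum_distrib_left)

lemma bscale_single [simp]: "bscale c (Poly_Mapping.single a d) = Poly_Mapping.single a (c * d)"
  by (rule poly_mapping_eqI) (simp add: lookup_single when_def)

lemma bhom_iff: "F \<in> bhom m n \<longleftrightarrow> (\<forall>a. a \<notin> diagrams m n \<longrightarrow> Poly_Mapping.lookup F a = 0)"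
  by (auto simp: bhom_def in_keys_iff)

lemma bhom_simps [simp]:
  "0 \<in> bhom m n"
  "F \<in> bhom m n \<Longrightarrow> G \<in> bhom m n \<Longrightarrow> F + G \<in> bhom m n"
  "F \<in> bhom m n \<Longrightarrow> G \<in> bhom m n \<Longrightarrow> F - G \<in> bhom m n"
  "F \<in> bhom m n \<Longrightarrow> bscale c F \<in> bhom m n"
  "a \<in> diagrams m n \<Longrightarrow> Poly_Mapping.single a c \<in> bhom m n"
  by (auto simp: bhom_iff lookup_add lookup_minus lookup_single when_def)

lemma bhom_sum: "(\<And>i. i \<in> S \<Longrightarrow> F i \<in> bhom m n) \<Longrightarrow> (\<Sum>i\<in>S. F i) \<in> bhom m n"
  by (auto simp: bhom_iff lookup_sum)

text \<open>The support of a sum of morphisms may shrink by cancellation; with freely chosen ranges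
  of summation, bilinearity is a termwise computation.\<close>

lemma bcomp_eq_sum:
  assumes "finite S" "Poly_Mapping.keys F \<subseteq> S" "finite S'" "Poly_Mapping.keys G \<subseteq> S'"
  shows "G \<odot>\<^bsub>t\<^esub> F = (\<Sum>a\<in>S. \<Sum>b\<in>S'. Poly_Mapping.single (dcomp b a)
           (t ^ loops b a * Poly_Mapping.lookup G b * Poly_Mapping.lookup F a))"
  unfolding bcomp_def
  using assms by (intro sum.mono_neutral_cong_left sum.neutral) (auto simp: in_keys_iff)

lemma btens_eq_sum:
  assumes "finite S" "Poly_Mapping.keys F \<subseteq> S" "finite S'" "Poly_Mapping.keys G \<subseteq> S'"
  shows "btens m n F G = (\<Sum>a\<in>S. \<Sum>b\<in>S'. Poly_Mapping.single (dtens m n a b)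
           (Poly_Mapping.lookup F a * Poly_Mapping.lookup G b))"
  unfolding btens_def
  using assms by (intro sum.mono_neutral_cong_left sum.neutral) (auto simp: in_keys_iff)

lemma keys_add_subset: "Poly_Mapping.keys (F + G) \<subseteq> Poly_Mapping.keys F \<union> Poly_Mapping.keys G"
  by (auto simp: in_keys_iff lookup_add)

lemma keys_bscale_subset: "Poly_Mapping.keys (bscale c F) \<subseteq> Poly_Mapping.keys F"
  by (auto simp: in_keys_iff)

lemma bcomp_add_left: "(G + G') \<odot>\<^bsub>t\<^esub> F = G \<odot>\<^bsub>t\<^esub> F + G' \<odot>\<^bsub>t\<^esub> F"
  by (simp add: bcomp_eq_sum[of "Poly_Mapping.keys F" _ "Poly_Mapping.keys G \<union> Poly_Mapping.keys G'"]
      keys_add_subset lookup_add single_add sum.distrib algebra_simps)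

lemma bcomp_add_right: "G \<odot>\<^bsub>t\<^esub> (F + F') = G \<odot>\<^bsub>t\<^esub> F + G \<odot>\<^bsub>t\<^esub> F'"
  by (simp add: bcomp_eq_sum[of "Poly_Mapping.keys F \<union> Poly_Mapping.keys F'" _ "Poly_Mapping.keys G"]
      keys_add_subset lookup_add single_add sum.distrib algebra_simps)

lemma bcomp_bscale_left: "bscale c G \<odot>\<^bsub>t\<^esub> F = bscale c (G \<odot>\<^bsub>t\<^esub> F)"
  by (simp add: bcomp_eq_sum[of "Poly_Mapping.keys F" _ "Poly_Mapping.keys G"]
      keys_bscale_subset bscale_sum algebra_simps)

lemma bcomp_bscale_right: "G \<odot>\<^bsub>t\<^esub> bscale c F = bscale c (G \<odot>\<^bsub>t\<^esub> F)"
  by (simp add: bcomp_eq_sum[of "Poly_Mapping.keys F" _ "Poly_Mapping.keys G"]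
      keys_bscale_subset bscale_sum algebra_simps)

lemma bcomp_zero [simp]: "0 \<odot>\<^bsub>t\<^esub> F = 0" "G \<odot>\<^bsub>t\<^esub> 0 = 0"
  by (simp_all add: bcomp_def)

lemma bcomp_diff_left: "(G - G') \<odot>\<^bsub>t\<^esub> F = G \<odot>\<^bsub>t\<^esub> F - G' \<odot>\<^bsub>t\<^esub> F"
  using bcomp_add_left[of "G - G'" G' t F] by (simp add: algebra_simps)

lemma bcomp_diff_right: "G \<odot>\<^bsub>t\<^esub> (F - F') = G \<odot>\<^bsub>t\<^esub> F - G \<odot>\<^bsub>t\<^esub> F'"
  using bcomp_add_right[of G t "F - F'" F'] by (simp add: algebra_simps)

lemma bcomp_sum_left: "(\<Sum>i\<in>S. G i) \<odot>\<^bsub>t\<^esub> F = (\<Sum>i\<in>S. G i \<odot>\<^bsub>t\<^esub> F)"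
  by (induction S rule: infinite_finite_induct) (auto simp: bcomp_add_left)

lemma bcomp_sum_right: "G \<odot>\<^bsub>t\<^esub> (\<Sum>i\<in>S. F i) = (\<Sum>i\<in>S. G \<odot>\<^bsub>t\<^esub> F i)"
  by (induction S rule: infinite_finite_induct) (auto simp: bcomp_add_right)

lemma btens_add_left: "btens m n (F + F') G = btens m n F G + btens m n F' G"
  by (simp add: btens_eq_sum[of "Poly_Mapping.keys F \<union> Poly_Mapping.keys F'" _ "Poly_Mapping.keys G"]
      keys_add_subset lookup_add single_add sum.distrib algebra_simps)

lemma btens_bscale_left: "btens m n (bscale c F) G = bscale c (btens m n F G)"
  by (simp add: btens_eq_sum[of "Poly_Mapping.keys F" _ "Poly_Mapping.keys G"]
      keys_bscale_subset bscale_sum algebra_simps)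

lemma btens_zero [simp]: "btens m n 0 G = 0" "btens m n F 0 = 0"
  by (simp_all add: btens_def)

lemma btens_sum_left: "btens m n (\<Sum>i\<in>S. F i) G = (\<Sum>i\<in>S. btens m n (F i) G)"
  by (induction S rule: infinite_finite_induct) (auto simp: btens_add_left)

lemma bcomp_in_bhom:
  assumes "F \<in> bhom m n" "G \<in> bhom n p"
  shows "G \<odot>\<^bsub>t\<^esub> F \<in> bhom m p"
  using assms unfolding bcomp_def bhom_def[of m n] bhom_def[of n p]
  by (intro bhom_sum bhom_simps dcomp_in_diagrams) auto

lemma lessThan_Un_shift: "{..<k} \<union> (+) k ` {..<l} = {..<k + l :: nat}"
proof -
  have "i \<in> (+) k ` {..<l}" if "\<not> i < k" "i < k + l" for i
    using that by (intro image_eqI[of _ _ "i - k"]) auto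
  then show ?thesis by auto
qed

lemma dtens_in_diagrams:
  assumes "a \<in> diagrams m n" "b \<in> diagrams m' n'"
  shows "dtens m n a b \<in> diagrams (m + m') (n + n')"
proof -
  let ?f = "map_sum ((+) m) ((+) n)"
  have "inj ?f"
  proof (rule injI)
    fix s s' assume "?f s = ?f s'" then show "s = s'" by (cases s; cases s') auto
  qed
  note mp = matching_map_prod[OF this]
  let ?b = "map_prod ?f ?f ` b"
  have Fb: "Field ?b = ?f ` (Inl ` {..<m'} \<union> Inr ` {..<n'})"
    using assms(2) by (simp add: mp diagrams_def)
  have disj: "Field a \<inter> Field ?b = {}"
  proof -
    have "Field a = Inl ` {..<m} \<union> Inr ` {..<n}" using assms(1) by (simp add: diagrams_def)
    show ?thesis unfolding Fb \<open>Field a = _\<close> by auto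
  qed
  have "Field (dtens m n a b) = Inl ` {..<m + m'} \<union> Inr ` {..<n + n'}"
  proof -
    have "Field (dtens m n a b) = Field a \<union> Field ?b" by (simp add: dtens_def Field_Un)
    also have "\<dots> = Inl ` ({..<m} \<union> (+) m ` {..<m'}) \<union> Inr ` ({..<n} \<union> (+) n ` {..<n'})"
      using assms(1) unfolding Fb image_Un image_image diagrams_def by (simp add: Un_ac)
    finally show ?thesis by (simp only: lessThan_Un_shift)
  qed
  moreover have "single_valued (dtens m n a b)"
  proof (rule single_valuedI)
    have sv: "single_valued a" "single_valued ?b" using assms mp(3)[of b] by (auto simp: diagrams_def)
    fix s u v assume "(s, u) \<in> dtens m n a b" "(s, v) \<in> dtens m n a b"
    then consider "(s, u) \<in> a" "(s, v) \<in> a" | "(s, u) \<in> ?b" "(s, v) \<in> ?b"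
      using disj FieldI1[of s _ a] FieldI1[of s _ ?b] unfolding dtens_def by blast
    then show "u = v" by cases (rule single_valuedD[OF sv(1)] single_valuedD[OF sv(2)]; assumption)+
  qed
  moreover have "sym (dtens m n a b)" "irrefl (dtens m n a b)"
    using assms mp(1,2)[of b] unfolding dtens_def diagrams_def by (auto simp: sym_def irrefl_def)
  ultimately show ?thesis by (simp add: diagrams_def)
qed

lemma btens_in_bhom:
  assumes "F \<in> bhom m n" "G \<in> bhom m' n'"
  shows "btens m n F G \<in> bhom (m + m') (n + n')"
  using assms unfolding btens_def bhom_def[of m n] bhom_def[of m' n']
  by (intro bhom_sum bhom_simps dtens_in_diagrams) auto

lemma bperm_in_bhom [simp]: "\<pi> permutes {..<n} \<Longrightarrow> bperm n \<pi> \<in> bhom n n"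
  unfolding bperm_def
proof (rule bhom_simps)
  assume \<pi>: "\<pi> permutes {..<n}"
  let ?a = "{(Inl i, Inr (\<pi> i)) |i. i < n} \<union> {(Inr (\<pi> i), Inl i) |i. i < n}"
  have "Field ?a = Inl ` {..<n} \<union> Inr ` (\<pi> ` {..<n})" by (auto simp: Field_def)
  then have "Field ?a = Inl ` {..<n} \<union> Inr ` {..<n}" using permutes_image[OF \<pi>] by simp
  then show "?a \<in> diagrams n n"
    using permutes_inj[OF \<pi>]
    unfolding diagrams_def by (auto simp: sym_def irrefl_def single_valued_def inj_def)
qed

lemma bid_in_bhom [simp]: "bid n \<in> bhom n n"
  unfolding bid_def by (simp add: permutes_id)

lemma bcap_in_bhom [simp]: "bcap \<in> bhom 2 0"
  unfolding bcap_def
  by (rule bhom_simps) (auto simp: diagrams_def sym_def irrefl_def single_valued_def Field_def less_2_cases_iff)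

lemma bcups_in_bhom [simp]: "bcups d \<in> bhom 0 (d + d)"
  unfolding bcups_def
proof (rule bhom_simps)
  let ?a = "{(Inr i, Inr (d + i)) |i. i < d} \<union> {(Inr (d + i), Inr i) |i. i < d} :: diag"
  have "Field ?a = Inr ` ({..<d} \<union> (+) d ` {..<d})" by (auto simp: Field_def)
  also have "{..<d} \<union> (+) d ` {..<d} = {..<d + d}" by (simp add: lessThan_Un_shift)
  finally show "?a \<in> diagrams 0 (d + d)"
    unfolding diagrams_def by (auto simp: sym_def irrefl_def single_valued_def)
qed

lemma symz_in_bhom [simp]: "symz d \<in> bhom d d"
  unfolding symz_def by (intro bhom_simps bhom_sum) auto

section \<open>Matrices of morphisms\<close>

definition mat :: "bmor \<Rightarrow> nat list \<Rightarrow> nat list \<Rightarrow> complex" where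
  "mat F x y = (\<Sum>a \<in> Poly_Mapping.keys F. Poly_Mapping.lookup F a * of_bool (compat a x y))"

lemma mat_eq_sum:
  assumes "finite S" "Poly_Mapping.keys F \<subseteq> S"
  shows "mat F x y = (\<Sum>a\<in>S. Poly_Mapping.lookup F a * of_bool (compat a x y))"
  unfolding mat_def using assms by (intro sum.mono_neutral_left) (auto simp: in_keys_iff)

lemma mat_simps [simp]:
  "mat 0 x y = 0"
  "mat (F + G) x y = mat F x y + mat G x y"
  "mat (bscale c F) x y = c * mat F x y"
  "mat (Poly_Mapping.single a c) x y = c * of_bool (compat a x y)"
proof -
  let ?S = "Poly_Mapping.keys F \<union> Poly_Mapping.keys G"
  show "mat (F + G) x y = mat F x y + mat G x y"
    unfolding mat_eq_sum[OF _ keys_add_subset, simplified] mat_eq_sum[of ?S F, simplified] mat_eq_sum[of ?S G, simplified]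
      lookup_add distrib_right sum.distrib by (simp add: mat_eq_sum[of ?S])
  show "mat (bscale c F) x y = c * mat F x y"
    by (simp add: mat_eq_sum[OF _ keys_bscale_subset] mat_eq_sum[of "Poly_Mapping.keys F" F] sum_distrib_left mult_ac del: sum_mult_of_bool_eq)
qed (auto simp: mat_def)

lemma mat_diff [simp]: "mat (F - G) x y = mat F x y - mat G x y"
  using mat_simps(2)[of "F - G" G x y] by simp

lemma mat_sum [simp]: "mat (\<Sum>i\<in>S. F i) x y = (\<Sum>i\<in>S. mat (F i) x y)"
  by (induction S rule: infinite_finite_induct) auto

text \<open>A closed loop contributes the factor \<open>N\<close> to the composite and can be
  coloured in \<open>N\<close> ways, so at \<open>t = N\<close> the power of \<open>t\<close>
  attached to a composite diagram counts the compatible colourings of the middle points.\<close>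

lemma mat_bcomp:
  assumes F: "F \<in> bhom m n" and G: "G \<in> bhom n p"
    and x: "x \<in> colourings N m" and z: "z \<in> colourings N p"
  shows "mat (G \<odot>\<^bsub>of_nat N\<^esub> F) x z = (\<Sum>y\<in>colourings N n. mat F x y * mat G y z)"
proof -
  let ?c = "\<lambda>b a. Poly_Mapping.lookup G b * Poly_Mapping.lookup F a"
  have loops: "of_nat N ^ loops b a * of_bool (compat (dcomp b a) x z) =
        (\<Sum>y\<in>colourings N n. of_bool (compat a x y) * of_bool (compat b y z) :: complex)"
    if "a \<in> Poly_Mapping.keys F" "b \<in> Poly_Mapping.keys G" for a b
  proof -
    have ab: "a \<in> diagrams m n" "b \<in> diagrams n p" using that F G by (auto simp: bhom_def)
    have "(\<Sum>y\<in>colourings N n. of_bool (compat a x y) * of_bool (compat b y z) :: complex) =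
          of_nat (card {y \<in> colourings N n. compat a x y \<and> compat b y z})"
      by (simp flip: of_bool_conj add: Int_def conj_commute)
    then show ?thesis by (simp add: card_middle_colourings[OF ab x z])
  qed
  have "mat (G \<odot>\<^bsub>of_nat N\<^esub> F) x z =
    (\<Sum>a\<in>Poly_Mapping.keys F. \<Sum>b\<in>Poly_Mapping.keys G. ?c b a *
      (\<Sum>y\<in>colourings N n. of_bool (compat a x y) * of_bool (compat b y z)))"
    unfolding bcomp_def mat_sum mat_simps
    by (intro sum.cong refl) (simp only: loops[symmetric] mult_ac)
  also have "\<dots> = (\<Sum>a\<in>Poly_Mapping.keys F. \<Sum>b\<in>Poly_Mapping.keys G. \<Sum>y\<in>colourings N n.
      (Poly_Mapping.lookup F a * of_bool (compat a x y)) * (Poly_Mapping.lookup G b * of_bool (compat b y z)))"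
    unfolding sum_distrib_left by (intro sum.cong refl) (simp only: mult_ac)
  also have "\<dots> = (\<Sum>a\<in>Poly_Mapping.keys F. \<Sum>y\<in>colourings N n. \<Sum>b\<in>Poly_Mapping.keys G.
      (Poly_Mapping.lookup F a * of_bool (compat a x y)) * (Poly_Mapping.lookup G b * of_bool (compat b y z)))"
    by (intro sum.cong refl sum.swap)
  also have "\<dots> = (\<Sum>y\<in>colourings N n. mat F x y * mat G y z)"
    unfolding mat_def sum_product by (rule sum.swap)
  finally show ?thesis .
qed

lemma compat_dtens:
  assumes a: "a \<in> diagrams m n" and "length x = m" "length y = n"
  shows "compat (dtens m n a b) (x @ x') (y @ y') \<longleftrightarrow> compat a x y \<and> compat b x' y'"
proof -
  let ?c = "case_sum ((!) (x @ x')) ((!) (y @ y'))"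
  have 1: "?c s = case_sum ((!) x) ((!) y) s" if "s \<in> Field a" for s
  proof -
    have "s \<in> Inl ` {..<m} \<union> Inr ` {..<n}" using that a by (simp add: diagrams_def)
    then show ?thesis using assms by (auto simp: nth_append)
  qed
  have 2: "?c (map_sum ((+) m) ((+) n) s) = case_sum ((!) x') ((!) y') s" for s
    using assms by (cases s) auto
  have "(\<forall>(p, q) \<in> a. ?c p = ?c q) \<longleftrightarrow> compat a x y"
    unfolding compat_def using 1 FieldI1[of _ _ a] FieldI2[of _ _ a]
    by (intro ball_cong refl) (metis (no_types, lifting) case_prod_conv surj_pair)
  moreover have "(\<forall>(p, q) \<in> map_prod (map_sum ((+) m) ((+) n)) (map_sum ((+) m) ((+) n)) ` b. ?c p = ?c q)
      \<longleftrightarrow> compat b x' y'"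
    unfolding compat_def by (auto simp: 2 split: prod.splits)
  ultimately show ?thesis unfolding dtens_def compat_def[of "_ \<union> _"] by blast
qed

lemma mat_btens:
  assumes F: "F \<in> bhom m n" and "x \<in> colourings N m" "y \<in> colourings N n"
  shows "mat (btens m n F G) (x @ x') (y @ y') = mat F x y * mat G x' y'"
proof -
  have "compat (dtens m n a b) (x @ x') (y @ y') \<longleftrightarrow> compat a x y \<and> compat b x' y'"
    if "a \<in> Poly_Mapping.keys F" for a b
    using that assms by (intro compat_dtens) (auto simp: bhom_def colourings_def)
  then show ?thesis
    unfolding btens_def mat_sum mat_simps(4) mat_def[of F] mat_def[of G] sum_product
    by (intro sum.cong refl) (simp add: of_bool_conj)
qed


section \<open>Polynomial dependence on the parameter\<close>

text \<open>Colouring each pair of matched points with its own colour separates a diagram from all others.\<close>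

lemma separating_colouring:
  assumes a: "a \<in> diagrams m n" and N: "m + n \<le> N"
  obtains x y where "x \<in> colourings N m" "y \<in> colourings N n"
    "\<And>b. b \<in> diagrams m n \<Longrightarrow> compat b x y \<longleftrightarrow> b = a"
proof -
  have Fa: "Field a = Inl ` {..<m} \<union> Inr ` {..<n}" and "sym a" "irrefl a" and sv: "single_valued a"
    using a by (auto simp: diagrams_def)
  define code where "code = case_sum (\<lambda>i. i) ((+) m)"
  define pr where "pr = (\<lambda>s. THE q. (s, q) \<in> a)"
  \<comment> \<open>A matched pair is coloured by the smaller of the numbers of its two points, so
    different pairs have different colours.\<close>
  define col where "col = (\<lambda>s. min (code s) (code (pr s)))"
  have pr_eq: "pr s = q" if "(s, q) \<in> a" for s q
    unfolding pr_def using that sv by (blast dest: single_valuedD)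
  have pr: "(s, pr s) \<in> a" if "s \<in> Field a" for s
  proof -
    have "\<exists>q. (s, q) \<in> a" using that \<open>sym a\<close> unfolding Field_def sym_def by blast
    with pr_eq show ?thesis by auto
  qed
  have code_inj: "s = s'" if "s \<in> Field a" "s' \<in> Field a" "code s = code s'" for s s'
  proof -
    have "s \<in> Inl ` {..<m} \<union> Inr ` {..<n}" "s' \<in> Inl ` {..<m} \<union> Inr ` {..<n}"
      using that Fa by simp_all
    with that(3) show ?thesis by (auto simp: code_def)
  qed
  have code_less: "code s < N" if "s \<in> Field a" for s
  proof -
    have "s \<in> Inl ` {..<m} \<union> Inr ` {..<n}" using that Fa by simp
    with N show ?thesis by (auto simp: code_def)
  qed
  have col_iff: "col s = col s' \<longleftrightarrow> (s, s') \<in> a" if "s \<in> Field a" "s' \<in> Field a" "s \<noteq> s'" for s s'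
  proof
    assume "(s, s') \<in> a"
    moreover from this \<open>sym a\<close> have "(s', s) \<in> a" by (auto simp: sym_def)
    ultimately show "col s = col s'" by (simp add: col_def pr_eq min.commute)
  next
    assume "col s = col s'"
    moreover have "pr s \<in> Field a" "pr s' \<in> Field a" using pr that by (blast intro: FieldI2)+
    ultimately have "s = s' \<or> s = pr s' \<or> pr s = s' \<or> pr s = pr s'"
      using that code_inj unfolding col_def by (metis min_def)
    moreover have "s = s'" if "pr s = pr s'"
      using pr[OF \<open>s \<in> Field a\<close>] pr[OF \<open>s' \<in> Field a\<close>] \<open>sym a\<close> sv that
      unfolding sym_def single_valued_def by metis
    ultimately show "(s, s') \<in> a"
      using that pr \<open>sym a\<close> unfolding sym_def by metis
  qed
  define x where "x = map (\<lambda>i. col (Inl i)) [0..<m]"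
  define y where "y = map (\<lambda>j. col (Inr j)) [0..<n]"
  have xy: "case_sum ((!) x) ((!) y) s = col s" if "s \<in> Field a" for s
  proof -
    have "s \<in> Inl ` {..<m} \<union> Inr ` {..<n}" using that Fa by simp
    then show ?thesis by (auto simp: x_def y_def)
  qed
  have col_less: "col s < N" if "s \<in> Field a" for s
    using code_less[OF that] by (simp add: col_def)
  have "i < m \<Longrightarrow> Inl i \<in> Field a" "j < n \<Longrightarrow> Inr j \<in> Field a" for i j
    unfolding Fa by auto
  then have "x \<in> colourings N m" "y \<in> colourings N n"
    using col_less by (auto simp: x_def y_def colourings_def)
  moreover have "compat b x y \<longleftrightarrow> b = a" if b: "b \<in> diagrams m n" for b
  proof
    have Fb: "Field b = Field a" using b Fa by (simp add: diagrams_def)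
    assume "compat b x y"
    have "b \<subseteq> a"
    proof (rule subrelI)
      fix s s' assume ss: "(s, s') \<in> b"
      then have "s \<in> Field a" "s' \<in> Field a" unfolding Fb[symmetric] by (auto intro: FieldI1 FieldI2)
      moreover have "s \<noteq> s'" using ss b by (auto simp: diagrams_def irrefl_def)
      moreover have "col s = col s'"
        using \<open>compat b x y\<close> ss xy \<open>s \<in> Field a\<close> \<open>s' \<in> Field a\<close> unfolding compat_def by fastforce
      ultimately show "(s, s') \<in> a" using col_iff by blast
    qed
    moreover have "(s, s') \<in> b" if ss: "(s, s') \<in> a" for s s'
    proof -
      have "s \<in> Field b" using ss Fb by (auto intro: FieldI1)
      moreover have "sym b" using b by (simp add: diagrams_def)
      ultimately obtain q where "(s, q) \<in> b" unfolding Field_def sym_def by blast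
      with \<open>b \<subseteq> a\<close> ss sv show ?thesis by (blast dest: single_valuedD)
    qed
    ultimately show "b = a" by auto
  next
    assume "b = a"
    have "case_sum ((!) x) ((!) y) s = case_sum ((!) x) ((!) y) s'" if "(s, s') \<in> a" for s s'
      using that xy col_iff[of s s'] \<open>irrefl a\<close> by (auto simp: FieldI1 FieldI2 irrefl_def)
    then show "compat b x y" unfolding \<open>b = a\<close> compat_def by blast
  qed
  ultimately show thesis by (rule that)
qed

text \<open>At a colouring that separates \<open>a\<close> from the other diagrams the matrix entry
  of \<open>F\<close> is its coefficient at \<open>a\<close>. The bound on \<open>N\<close> leaves
  room for such colourings.\<close>

lemma mat_faithful:
  assumes F: "F \<in> bhom m n" and N: "m + n \<le> N"
    and zero: "\<And>x y. x \<in> colourings N m \<Longrightarrow> y \<in> colourings N n \<Longrightarrow> mat F x y = 0"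
  shows "F = 0"
proof (rule poly_mapping_eqI)
  fix a
  show "Poly_Mapping.lookup F a = Poly_Mapping.lookup 0 a"
  proof (cases "a \<in> diagrams m n")
    case True
    obtain x y where xy: "x \<in> colourings N m" "y \<in> colourings N n"
        "\<And>b. b \<in> diagrams m n \<Longrightarrow> compat b x y \<longleftrightarrow> b = a"
      using separating_colouring[OF True N] by metis
    have "mat F x y = (\<Sum>b\<in>diagrams m n. Poly_Mapping.lookup F b * of_bool (compat b x y))"
      using F by (intro mat_eq_sum) (auto simp: bhom_def)
    also have "\<dots> = (\<Sum>b\<in>diagrams m n. if b = a then Poly_Mapping.lookup F b else 0)"
      by (intro sum.cong) (auto simp: xy(3))
    finally show ?thesis using zero[OF xy(1,2)] True by simp
  next
    case False
    then show ?thesis using F by (simp add: bhom_iff)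
  qed
qed

definition polyfun :: "(complex \<Rightarrow> complex) \<Rightarrow> bool" where
  "polyfun f \<longleftrightarrow> (\<exists>p. \<forall>t. f t = poly p t)"

lemma polyfun_simps [simp]:
  "polyfun (\<lambda>_. c)" "polyfun (\<lambda>t. t)"
  "polyfun f \<Longrightarrow> polyfun g \<Longrightarrow> polyfun (\<lambda>t. f t + g t)"
  "polyfun f \<Longrightarrow> polyfun g \<Longrightarrow> polyfun (\<lambda>t. f t - g t)"
  "polyfun f \<Longrightarrow> polyfun g \<Longrightarrow> polyfun (\<lambda>t. f t * g t)"
  "polyfun f \<Longrightarrow> polyfun (\<lambda>t. f t ^ n)"
proof -
  show "polyfun (\<lambda>_. c)" unfolding polyfun_def by (intro exI[of _ "[:c:]"]) simp
  show "polyfun (\<lambda>t. t)" unfolding polyfun_def by (intro exI[of _ "[:0, 1:]"]) simp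
  fix f g assume "polyfun f"
  then obtain p where p: "\<And>t. f t = poly p t" by (auto simp: polyfun_def)
  show "polyfun (\<lambda>t. f t ^ n)" unfolding polyfun_def by (intro exI[of _ "p ^ n"]) (simp add: p)
  assume "polyfun g"
  then obtain q where q: "\<And>t. g t = poly q t" by (auto simp: polyfun_def)
  show "polyfun (\<lambda>t. f t + g t)" unfolding polyfun_def by (intro exI[of _ "p + q"]) (simp add: p q)
  show "polyfun (\<lambda>t. f t - g t)" unfolding polyfun_def by (intro exI[of _ "p - q"]) (simp add: p q)
  show "polyfun (\<lambda>t. f t * g t)" unfolding polyfun_def by (intro exI[of _ "p * q"]) (simp add: p q)
qed

lemma polyfun_sum: "(\<And>i. i \<in> S \<Longrightarrow> polyfun (f i)) \<Longrightarrow> polyfun (\<lambda>t. \<Sum>i\<in>S. f i t)"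
  by (induction S rule: infinite_finite_induct) auto

definition bfam :: "nat \<Rightarrow> nat \<Rightarrow> (complex \<Rightarrow> bmor) \<Rightarrow> bool" where
  "bfam m n F \<longleftrightarrow> (\<forall>t. F t \<in> bhom m n) \<and> (\<forall>a. polyfun (\<lambda>t. Poly_Mapping.lookup (F t) a))"

lemma bfam_in_bhom: "bfam m n F \<Longrightarrow> F t \<in> bhom m n"
  by (simp add: bfam_def)

lemma bfam_const: "F \<in> bhom m n \<Longrightarrow> bfam m n (\<lambda>_. F)"
  by (simp add: bfam_def)

lemma bfam_add: "bfam m n F \<Longrightarrow> bfam m n G \<Longrightarrow> bfam m n (\<lambda>t. F t + G t)"
  by (simp add: bfam_def lookup_add)

lemma bfam_bscale: "polyfun c \<Longrightarrow> bfam m n F \<Longrightarrow> bfam m n (\<lambda>t. bscale (c t) (F t))"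
  by (simp add: bfam_def)

lemma bfam_sum: "(\<And>i. i \<in> S \<Longrightarrow> bfam m n (F i)) \<Longrightarrow> bfam m n (\<lambda>t. \<Sum>i\<in>S. F i t)"
  by (auto simp: bfam_def lookup_sum intro!: polyfun_sum bhom_sum)

lemma polyfun_lookup_single:
  "polyfun c \<Longrightarrow> polyfun (\<lambda>t. Poly_Mapping.lookup (Poly_Mapping.single d (c t)) a)"
  by (cases "d = a") (simp_all add: lookup_single)

lemma bfam_bcomp:
  assumes F: "bfam m n F" and G: "bfam n p G"
  shows "bfam m p (\<lambda>t. G t \<odot>\<^bsub>t\<^esub> F t)"
proof -
  have eq: "G t \<odot>\<^bsub>t\<^esub> F t = (\<Sum>a\<in>diagrams m n. \<Sum>b\<in>diagrams n p. Poly_Mapping.single (dcomp b a)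
           (t ^ loops b a * Poly_Mapping.lookup (G t) b * Poly_Mapping.lookup (F t) a))" for t
    using F G by (intro bcomp_eq_sum) (auto simp: bfam_def bhom_def)
  have "polyfun (\<lambda>t. Poly_Mapping.lookup (G t \<odot>\<^bsub>t\<^esub> F t) a)" for a
    unfolding eq lookup_sum
    using F G by (intro polyfun_sum polyfun_lookup_single) (simp add: bfam_def)
  then show ?thesis using F G by (auto simp: bfam_def intro!: bcomp_in_bhom)
qed

lemma bfam_btens:
  assumes F: "bfam m n F" and G: "bfam m' n' G"
  shows "bfam (m + m') (n + n') (\<lambda>t. btens m n (F t) (G t))"
proof -
  have eq: "btens m n (F t) (G t) = (\<Sum>a\<in>diagrams m n. \<Sum>b\<in>diagrams m' n'. Poly_Mapping.single (dtens m n a b)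
           (Poly_Mapping.lookup (F t) a * Poly_Mapping.lookup (G t) b))" for t
    using F G by (intro btens_eq_sum) (auto simp: bfam_def bhom_def)
  have "polyfun (\<lambda>t. Poly_Mapping.lookup (btens m n (F t) (G t)) a)" for a
    unfolding eq lookup_sum
    using F G by (intro polyfun_sum polyfun_lookup_single) (simp add: bfam_def)
  then show ?thesis using F G by (auto simp: bfam_def intro!: btens_in_bhom)
qed

text \<open>At \<open>t = N\<close> a morphism acts on tensors over an \<open>N\<close>-dimensional space. Identities between
  families depending polynomially on \<open>t\<close> may be verified there.\<close>

lemma bfam_eqI:
  assumes F: "bfam m n F" and G: "bfam m n G"
    and eq: "\<And>N x y. x \<in> colourings N m \<Longrightarrow> y \<in> colourings N n \<Longrightarrow>
               mat (F (of_nat N)) x y = mat (G (of_nat N)) x y"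
  shows "F t = G t"
proof (rule poly_mapping_eqI)
  fix a
  obtain p q where p: "\<And>t. Poly_Mapping.lookup (F t) a = poly p t"
      and q: "\<And>t. Poly_Mapping.lookup (G t) a = poly q t"
    using F G unfolding bfam_def polyfun_def by metis
  have *: "poly (p - q) (of_nat N) = 0" if "N \<ge> m + n" for N
  proof -
    have "F (of_nat N) - G (of_nat N) = 0"
      using F G eq that by (intro mat_faithful[of _ m n N]) (auto simp: bfam_def)
    then show ?thesis by (simp flip: p q)
  qed
  have "infinite ((of_nat :: nat \<Rightarrow> complex) ` {m + n..})"
    by (subst finite_image_iff) (auto simp: inj_on_def infinite_Ici)
  moreover have "(of_nat :: nat \<Rightarrow> complex) ` {m + n..} \<subseteq> {z. poly (p - q) z = 0}"
    using * by auto
  ultimately have "p - q = 0"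
    using poly_roots_finite[of "p - q"] finite_subset by blast
  then show "Poly_Mapping.lookup (F t) a = Poly_Mapping.lookup (G t) a" by (simp add: p q)
qed

text \<open>For fixed \<open>F\<close>, \<open>G\<close>, \<open>H\<close> both sides are polynomial
  in \<open>t\<close>, so associativity reduces to that of matrix products instead of a count of the
  loops in threefold composites.\<close>

lemma bcomp_assoc:
  assumes F: "F \<in> bhom m n" and G: "G \<in> bhom n p" and H: "H \<in> bhom p q"
  shows "(H \<odot>\<^bsub>t\<^esub> G) \<odot>\<^bsub>t\<^esub> F = H \<odot>\<^bsub>t\<^esub> G \<odot>\<^bsub>t\<^esub> F"
proof (rule bfam_eqI[where m = m and n = q])
  show "bfam m q (\<lambda>t. (H \<odot>\<^bsub>t\<^esub> G) \<odot>\<^bsub>t\<^esub> F)" "bfam m q (\<lambda>t. H \<odot>\<^bsub>t\<^esub> G \<odot>\<^bsub>t\<^esub> F)"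
    using bfam_const[OF F] bfam_const[OF G] bfam_const[OF H]
    by (rule bfam_bcomp[OF _ bfam_bcomp], rule bfam_bcomp[OF bfam_bcomp])
  fix N x y assume xy: "x \<in> colourings N m" "y \<in> colourings N q"
  have 1: "mat ((H \<odot>\<^bsub>of_nat N\<^esub> G) \<odot>\<^bsub>of_nat N\<^esub> F) x y =
    (\<Sum>u\<in>colourings N n. mat F x u * (\<Sum>w\<in>colourings N p. mat G u w * mat H w y))"
    unfolding mat_bcomp[OF F bcomp_in_bhom[OF G H] xy]
    by (intro sum.cong refl) (simp add: mat_bcomp[OF G H _ xy(2)])
  have 2: "mat (H \<odot>\<^bsub>of_nat N\<^esub> G \<odot>\<^bsub>of_nat N\<^esub> F) x y =
    (\<Sum>w\<in>colourings N p. (\<Sum>u\<in>colourings N n. mat F x u * mat G u w) * mat H w y)"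
    unfolding mat_bcomp[OF bcomp_in_bhom[OF F G] H xy]
    by (intro sum.cong refl) (simp add: mat_bcomp[OF F G xy(1)])
  show "mat ((H \<odot>\<^bsub>of_nat N\<^esub> G) \<odot>\<^bsub>of_nat N\<^esub> F) x y = mat (H \<odot>\<^bsub>of_nat N\<^esub> G \<odot>\<^bsub>of_nat N\<^esub> F) x y"
    unfolding 1 2 sum_distrib_left sum_distrib_right
    by (subst sum.swap) (simp add: mult_ac)
qed


section \<open>Symmetric tensors\<close>

text \<open>The coordinate of a pure power of the vector \<open>v\<close> at the word
  \<open>x\<close> of basis vectors.\<close>

definition vpow :: "(nat \<Rightarrow> complex) \<Rightarrow> nat list \<Rightarrow> complex" where
  "vpow v x = prod_list (map v x)"

lemma vpow_simps [simp]:
  "vpow v [] = 1" "vpow v (c # x) = v c * vpow v x" "vpow v (x @ y) = vpow v x * vpow v y"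
  by (simp_all add: vpow_def)

lemma vpow_mset: "mset x = mset y \<Longrightarrow> vpow v x = vpow v y"
  unfolding vpow_def by (metis mset_map prod_mset_prod_list)

lemma colourings_0 [simp]: "colourings N 0 = {[]}"
  by (auto simp: colourings_def)

lemma Nil_in_colourings [simp]: "[] \<in> colourings N n \<longleftrightarrow> n = 0"
  by (auto simp: colourings_def)

lemma Cons_in_colourings [simp]: "c # x \<in> colourings N (Suc n) \<longleftrightarrow> c < N \<and> x \<in> colourings N n"
  by (auto simp: colourings_def)

lemma append_in_colourings:
  "x \<in> colourings N m \<Longrightarrow> y \<in> colourings N n \<Longrightarrow> x @ y \<in> colourings N (m + n)"
  by (auto simp: colourings_def)

lemma sum_colourings_append:
  "(\<Sum>x\<in>colourings N (m + n). f x) = (\<Sum>x\<in>colourings N m. \<Sum>y\<in>colourings N n. f (x @ y))"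
proof -
  have "(\<Sum>x\<in>colourings N (m + n). f x) = (\<Sum>(x, y)\<in>colourings N m \<times> colourings N n. f (x @ y))"
    by (rule sum.reindex_bij_witness[of _ "\<lambda>(x, y). x @ y" "\<lambda>z. (take m z, drop m z)"])
      (auto simp: colourings_def dest: in_set_takeD in_set_dropD)
  then show ?thesis by (simp add: sum.cartesian_product)
qed

lemma sum_colourings_Suc:
  "(\<Sum>x\<in>colourings N (Suc n). f x) = (\<Sum>c<N. \<Sum>x\<in>colourings N n. f (c # x))"
proof -
  have "(\<Sum>x\<in>colourings N (Suc n). f x) = (\<Sum>(c, x)\<in>{..<N} \<times> colourings N n. f (c # x))"
    by (rule sum.reindex_bij_witness[of _ "\<lambda>(c, x). c # x" "\<lambda>z. (hd z, tl z)"])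
      (auto simp: colourings_def length_Suc_conv)
  then show ?thesis by (simp add: sum.cartesian_product)
qed

lemma permute_list_in_colourings [simp]:
  assumes "\<pi> permutes {..<n}" "x \<in> colourings N n"
  shows "permute_list \<pi> x \<in> colourings N n"
  using assms by (auto simp: colourings_def)

lemma mset_eq_colourings: "x \<in> colourings N n \<Longrightarrow> mset x = mset y \<Longrightarrow> y \<in> colourings N n"
  unfolding colourings_def by (auto dest: mset_eq_setD mset_eq_length)

lemma mat_bperm:
  assumes "\<pi> permutes {..<n}" "x \<in> colourings N n" "y \<in> colourings N n"
  shows "mat (bperm n \<pi>) x y = of_bool (x = permute_list \<pi> y)"
proof -
  have "compat ({(Inl i, Inr (\<pi> i)) |i. i < n} \<union> {(Inr (\<pi> i), Inl i) |i. i < n}) x y \<longleftrightarrow>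
        (\<forall>i<n. x ! i = y ! \<pi> i)"
    unfolding compat_def ball_Un by (auto simp: setcompr_eq_image)
  also have "\<dots> \<longleftrightarrow> x = permute_list \<pi> y"
    using assms by (auto simp: list_eq_iff_nth_eq permute_list_nth colourings_def)
  finally show ?thesis by (simp add: bperm_def)
qed

lemma mat_bid:
  assumes "x \<in> colourings N n" "y \<in> colourings N n"
  shows "mat (bid n) x y = of_bool (x = y)"
  using mat_bperm[OF permutes_id assms] by (simp add: bid_def)

lemma mat_symz:
  assumes "x \<in> colourings N n" "y \<in> colourings N n"
  shows "mat (symz n) x y = (\<Sum>\<pi> | \<pi> permutes {..<n}. of_bool (x = permute_list \<pi> y)) / fact n"
  using assms by (simp add: symz_def mat_bperm)

text \<open>Passing to the inverse permutation exchanges \<open>x\<close> and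
  \<open>y\<close>.\<close>

lemma mat_symz_commute:
  assumes "x \<in> colourings N n" "y \<in> colourings N n"
  shows "mat (symz n) x y = mat (symz n) y x"
proof -
  have "x = permute_list (inv \<pi>) y \<longleftrightarrow> y = permute_list \<pi> x" if \<pi>: "\<pi> permutes {..<n}" for \<pi>
  proof -
    have "permute_list \<pi> (permute_list (inv \<pi>) y) = permute_list (inv \<pi> \<circ> \<pi>) y"
         "permute_list (inv \<pi>) (permute_list \<pi> x) = permute_list (\<pi> \<circ> inv \<pi>) x"
      using assms \<pi> permutes_inv[OF \<pi>] by (auto simp: permute_list_compose colourings_def)
    then show ?thesis using permutes_inv_o[OF \<pi>] by auto
  qed
  then have "(\<Sum>\<pi> | \<pi> permutes {..<n}. of_bool (x = permute_list \<pi> y)) =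
             (\<Sum>\<pi> | \<pi> permutes {..<n}. of_bool (y = permute_list \<pi> x) :: complex)"
    by (subst sum_permutations_inverse) (auto intro!: sum.cong)
  then show ?thesis using assms by (simp add: mat_symz)
qed

definition symfun :: "nat \<Rightarrow> nat \<Rightarrow> (nat list \<Rightarrow> complex) \<Rightarrow> bool" where
  "symfun N n f \<longleftrightarrow> (\<forall>x\<in>colourings N n. \<forall>y. mset x = mset y \<longrightarrow> f x = f y)"

lemma symfunD: "symfun N n f \<Longrightarrow> x \<in> colourings N n \<Longrightarrow> mset x = mset y \<Longrightarrow> f x = f y"
  by (auto simp: symfun_def)

lemma symfun_vpow [simp]: "symfun N n (vpow v)"
  by (auto simp: symfun_def intro: vpow_mset)

lemma symfun_mat_symz:
  assumes "x \<in> colourings N n"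
  shows "symfun N n (\<lambda>y. mat (symz n) x y)"
  unfolding symfun_def
proof (intro ballI allI impI)
  fix y y' assume y: "y \<in> colourings N n" and "mset y = mset y'"
  then obtain \<rho> where \<rho>: "\<rho> permutes {..<length y'}" "permute_list \<rho> y' = y"
    by (metis mset_eq_permutation)
  have y': "y' \<in> colourings N n" using y \<open>mset y = mset y'\<close> by (rule mset_eq_colourings)
  then have len: "length y' = n" by (simp add: colourings_def)
  have "permute_list \<pi> y = permute_list (\<rho> \<circ> \<pi>) y'" if "\<pi> permutes {..<n}" for \<pi>
    using that \<rho>(2) len by (auto simp: permute_list_compose)
  then have "(\<Sum>\<pi> | \<pi> permutes {..<n}. of_bool (x = permute_list \<pi> y)) =
        (\<Sum>\<pi> | \<pi> permutes {..<n}. of_bool (x = permute_list (\<rho> \<circ> \<pi>) y') :: complex)"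
    by (intro sum.cong) auto
  also have "\<dots> = (\<Sum>\<pi> | \<pi> permutes {..<n}. of_bool (x = permute_list \<pi> y'))"
    using \<rho>(1) len by (subst (2) setum_permutations_compose_left[of \<rho>]) auto
  finally show "mat (symz n) x y = mat (symz n) x y'"
    using assms y y' by (simp add: mat_symz)
qed

lemma symfun_mat_symz':
  assumes "y \<in> colourings N n"
  shows "symfun N n (\<lambda>x. mat (symz n) x y)"
  unfolding symfun_def
proof (intro ballI allI impI)
  fix x x' assume x: "x \<in> colourings N n" "mset x = mset x'"
  with symfunD[OF symfun_mat_symz[OF assms] x] mset_eq_colourings[OF x] assms
  show "mat (symz n) x y = mat (symz n) x' y" by (simp add: mat_symz_commute)
qed

text \<open>The symmetrizer averages over all permutations and so fixes symmetric tensors.\<close>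

lemma sum_symz:
  assumes f: "symfun N n f" and y: "y \<in> colourings N n"
  shows "(\<Sum>x\<in>colourings N n. mat (symz n) x y * f x) = f y"
proof -
  have "(\<Sum>x\<in>colourings N n. mat (symz n) x y * f x) =
        (\<Sum>\<pi> | \<pi> permutes {..<n}. \<Sum>x\<in>colourings N n. of_bool (x = permute_list \<pi> y) * f x) / fact n"
    using y by (subst sum.swap) (simp add: mat_symz sum_divide_distrib sum_distrib_right)
  also have "(\<Sum>\<pi> | \<pi> permutes {..<n}. \<Sum>x\<in>colourings N n. of_bool (x = permute_list \<pi> y) * f x) =
     (\<Sum>\<pi> | \<pi> permutes {..<n}. f y)"
  proof (intro sum.cong refl)
    fix \<pi> assume "\<pi> \<in> {\<pi>. \<pi> permutes {..<n}}"
    then have \<pi>: "\<pi> permutes {..<n}" by simp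
    have "(\<Sum>x\<in>colourings N n. of_bool (x = permute_list \<pi> y) * f x) =
          (\<Sum>x\<in>colourings N n. if x = permute_list \<pi> y then f x else 0)"
      by (intro sum.cong) auto
    also have "\<dots> = f (permute_list \<pi> y)" using \<pi> y by simp
    also have "\<dots> = f y"
      using symfunD[OF f y, of "permute_list \<pi> y"] \<pi> y by (simp add: colourings_def)
    finally show "(\<Sum>x\<in>colourings N n. of_bool (x = permute_list \<pi> y) * f x) = f y" .
  qed
  also have "\<dots> = fact n * f y" by (simp add: card_permutations[of "{..<n}" n])
  finally show ?thesis by simp
qed

lemma sum_symz':
  assumes f: "symfun N n f" and x: "x \<in> colourings N n"
  shows "(\<Sum>y\<in>colourings N n. mat (symz n) x y * f y) = f x"
proof -
  have "(\<Sum>y\<in>colourings N n. mat (symz n) x y * f y) = (\<Sum>y\<in>colourings N n. mat (symz n) y x * f y)"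
    using x by (intro sum.cong) (simp_all add: mat_symz_commute)
  then show ?thesis using sum_symz[OF f x] by simp
qed

text \<open>Polarization: differentiating the diagonal values of a symmetric multilinear form in the direction
  of a basis vector fixes one of its arguments.\<close>

lemma vpow_has_field_derivative:
  "((\<lambda>\<epsilon>. vpow (\<lambda>i. v i + \<epsilon> * e i) x) has_field_derivative
     (\<Sum>j<length x. e (x ! j) * vpow (\<lambda>i. v i + \<epsilon> * e i) (take j x @ drop (Suc j) x))) (at \<epsilon>)"
proof (induction x)
  case (Cons c x)
  show ?case
    unfolding vpow_simps
    by (rule derivative_eq_intros Cons.IH refl)+
      (simp add: sum.lessThan_Suc_shift sum_distrib_left mult_ac del: sum.lessThan_Suc)
qed simp

text \<open>By symmetry the \<open>j\<close>-th argument of \<open>A\<close> may be moved to the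
  front, so the sum does not depend on \<open>j\<close>. All terms of the product rule then
  agree.\<close>

lemma sum_colourings_remove_nth:
  assumes A: "symfun N (Suc n) A" and j: "j < Suc n"
  shows "(\<Sum>x\<in>colourings N (Suc n). A x * (e (x ! j) * vpow w (take j x @ drop (Suc j) x))) =
         (\<Sum>c<N. e c * (\<Sum>x\<in>colourings N n. A (c # x) * vpow w x))"
proof -
  have "(\<Sum>x\<in>colourings N (Suc n). A x * (e (x ! j) * vpow w (take j x @ drop (Suc j) x))) =
        (\<Sum>(c, x)\<in>{..<N} \<times> colourings N n. A (c # x) * (e c * vpow w x))"
  proof (rule sum.reindex_bij_witness[of _ "\<lambda>(c, x). take j x @ c # drop j x" "\<lambda>x. (x ! j, take j x @ drop (Suc j) x)"])
    fix x assume x: "x \<in> colourings N (Suc n)"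
    then have len: "length x = Suc n" by (simp add: colourings_def)
    show "(case (x ! j, take j x @ drop (Suc j) x) of (c, x) \<Rightarrow> take j x @ c # drop j x) = x"
      using len j by (simp add: id_take_nth_drop[symmetric])
    show "(x ! j, take j x @ drop (Suc j) x) \<in> {..<N} \<times> colourings N n"
      using x j colourings_nth[OF x j] by (auto simp: colourings_def dest!: in_set_takeD in_set_dropD)
    have "mset x = mset (take j x @ x ! j # drop (Suc j) x)"
      using len j id_take_nth_drop[of j x] by simp
    then have "A x = A (x ! j # take j x @ drop (Suc j) x)"
      using symfunD[OF A x] by simp
    then show "(case (x ! j, take j x @ drop (Suc j) x) of (c, x) \<Rightarrow> A (c # x) * (e c * vpow w x)) =
          A x * (e (x ! j) * vpow w (take j x @ drop (Suc j) x))" by simp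
  next
    fix p assume p: "p \<in> {..<N} \<times> colourings N n"
    then obtain c x where [simp]: "p = (c, x)" and cx: "c < N" "x \<in> colourings N n" by auto
    then have len: "length x = n" by (simp add: colourings_def)
    show "((case p of (c, x) \<Rightarrow> take j x @ c # drop j x) ! j,
       take j (case p of (c, x) \<Rightarrow> take j x @ c # drop j x) @
         drop (Suc j) (case p of (c, x) \<Rightarrow> take j x @ c # drop j x)) = p"
      using len j by (simp add: nth_append)
    show "(case p of (c, x) \<Rightarrow> take j x @ c # drop j x) \<in> colourings N (Suc n)"
      using cx j by (auto simp: colourings_def dest!: in_set_takeD in_set_dropD)
  qed
  then show ?thesis by (simp add: sum.cartesian_product[symmetric] sum_distrib_left mult_ac)
qed

lemma symmetric_form_has_field_derivative:
  assumes A: "symfun N (Suc n) A"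
  shows "((\<lambda>\<epsilon>. \<Sum>x\<in>colourings N (Suc n). A x * vpow (\<lambda>i. v i + \<epsilon> * e i) x) has_field_derivative
    of_nat (Suc n) * (\<Sum>c<N. e c * (\<Sum>x\<in>colourings N n. A (c # x) * vpow (\<lambda>i. v i + \<epsilon> * e i) x))) (at \<epsilon>)"
proof -
  let ?w = "\<lambda>i. v i + \<epsilon> * e i"
  have "((\<lambda>\<epsilon>. \<Sum>x\<in>colourings N (Suc n). A x * vpow (\<lambda>i. v i + \<epsilon> * e i) x) has_field_derivative
    (\<Sum>x\<in>colourings N (Suc n). A x * (\<Sum>j<length x. e (x ! j) * vpow ?w (take j x @ drop (Suc j) x)))) (at \<epsilon>)"
    by (intro DERIV_sum DERIV_cmult vpow_has_field_derivative)
  also have "(\<Sum>x\<in>colourings N (Suc n). A x * (\<Sum>j<length x. e (x ! j) * vpow ?w (take j x @ drop (Suc j) x))) =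
     (\<Sum>x\<in>colourings N (Suc n). \<Sum>j<Suc n. A x * (e (x ! j) * vpow ?w (take j x @ drop (Suc j) x)))"
    by (intro sum.cong refl) (simp add: colourings_def sum_distrib_left del: sum.lessThan_Suc)
  also have "\<dots> = (\<Sum>j<Suc n. \<Sum>x\<in>colourings N (Suc n). A x * (e (x ! j) * vpow ?w (take j x @ drop (Suc j) x)))"
    by (rule sum.swap)
  also have "\<dots> = (\<Sum>j<Suc n. \<Sum>c<N. e c * (\<Sum>x\<in>colourings N n. A (c # x) * vpow ?w x))"
    using sum_colourings_remove_nth[OF A] by (intro sum.cong refl) auto
  finally show ?thesis by simp
qed

lemma symfun_Cons: "symfun N (Suc n) A \<Longrightarrow> c < N \<Longrightarrow> symfun N n (\<lambda>x. A (c # x))"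
  by (auto simp: symfun_def)

text \<open>Induction on \<open>n\<close>: the diagonal values vanish identically, hence so does
  their derivative at 0 in the direction of the basis vector \<open>c\<close>, which is
  \<open>Suc n\<close> times the diagonal value at \<open>v\<close> of the form with first argument
  fixed to \<open>c\<close>.\<close>

lemma polarization:
  assumes "symfun N n A" "\<And>v. (\<Sum>x\<in>colourings N n. A x * vpow v x) = 0" "x \<in> colourings N n"
  shows "A x = 0"
  using assms
proof (induction n arbitrary: A x)
  case 0
  then show ?case by simp
next
  case (Suc n)
  from Suc.prems(3) obtain c y where x: "x = c # y" "c < N" "y \<in> colourings N n"
    by (cases x) auto
  show ?case unfolding x(1)
  proof (rule Suc.IH[of "\<lambda>x. A (c # x)"])
    show "symfun N n (\<lambda>x. A (c # x))" using Suc.prems(1) x(2) by (rule symfun_Cons)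
    show "(\<Sum>x\<in>colourings N n. A (c # x) * vpow v x) = 0" for v
    proof -
      let ?D = "of_nat (Suc n) * (\<Sum>d<N. of_bool (d = c) * (\<Sum>x\<in>colourings N n. A (d # x) * vpow v x))"
      have "((\<lambda>\<epsilon>. 0 :: complex) has_field_derivative ?D) (at 0)"
        using symmetric_form_has_field_derivative[OF Suc.prems(1), of v "\<lambda>d. of_bool (d = c)" 0] Suc.prems(2) by simp
      then have "?D = 0" using DERIV_unique DERIV_const by blast
      moreover have "(\<Sum>d<N. of_bool (d = c) * (\<Sum>x\<in>colourings N n. A (d # x) * vpow v x)) =
          (\<Sum>d<N. if d = c then (\<Sum>x\<in>colourings N n. A (d # x) * vpow v x) else 0)"
        by (intro sum.cong) auto
      ultimately show ?thesis using x(2) by (simp del: of_nat_Suc)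
    qed
    show "y \<in> colourings N n" by (rule x(3))
  qed
qed

text \<open>\<open>push\<close> applies a morphism to a tensor over the source, \<open>pull\<close>
  is the adjoint acting on tensors over the target, and \<open>pairing\<close> pairs the image of a
  pure power of \<open>v\<close> with a pure power of \<open>w\<close>. Adjointness
  (\<open>sum_push_pull\<close>) allows each factor of a composite to be evaluated on the side where
  it is simpler.\<close>

definition push :: "nat \<Rightarrow> nat \<Rightarrow> bmor \<Rightarrow> (nat list \<Rightarrow> complex) \<Rightarrow> nat list \<Rightarrow> complex" where
  "push N m F f y = (\<Sum>x\<in>colourings N m. f x * mat F x y)"

definition pull :: "nat \<Rightarrow> nat \<Rightarrow> bmor \<Rightarrow> (nat list \<Rightarrow> complex) \<Rightarrow> nat list \<Rightarrow> complex" where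
  "pull N n F f x = (\<Sum>y\<in>colourings N n. mat F x y * f y)"

definition pairing :: "nat \<Rightarrow> nat \<Rightarrow> nat \<Rightarrow> bmor \<Rightarrow> (nat \<Rightarrow> complex) \<Rightarrow> (nat \<Rightarrow> complex) \<Rightarrow> complex" where
  "pairing N m n F v w = (\<Sum>x\<in>colourings N m. vpow v x * pull N n F (vpow w) x)"

lemma push_cong: "(\<And>x. x \<in> colourings N m \<Longrightarrow> f x = g x) \<Longrightarrow> push N m F f y = push N m F g y"
  by (simp add: push_def)

lemma pull_cong: "(\<And>y. y \<in> colourings N n \<Longrightarrow> f y = g y) \<Longrightarrow> pull N n F f x = pull N n F g x"
  by (simp add: pull_def)

lemma push_mult: "push N m F (\<lambda>x. c * f x) y = c * push N m F f y"
  by (simp add: push_def sum_distrib_left mult_ac)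

lemma sum_push_pull:
  "(\<Sum>y\<in>colourings N n. push N m F f y * g y) = (\<Sum>x\<in>colourings N m. f x * pull N n F g x)"
  unfolding push_def pull_def sum_distrib_left sum_distrib_right
  by (subst sum.swap) (simp add: mult_ac)

lemma pairing_push: "pairing N m n F v w = (\<Sum>y\<in>colourings N n. push N m F (vpow v) y * vpow w y)"
  by (simp add: pairing_def sum_push_pull)

lemma pull_bcomp:
  assumes "F \<in> bhom m n" "G \<in> bhom n p" "x \<in> colourings N m"
  shows "pull N p (G \<odot>\<^bsub>of_nat N\<^esub> F) f x = pull N n F (pull N p G f) x"
  unfolding pull_def sum_distrib_left using mat_bcomp[OF assms(1,2,3)]
  by (simp add: sum_distrib_right) (subst sum.swap, simp add: mult_ac)

lemma push_bcomp:
  assumes "F \<in> bhom m n" "G \<in> bhom n p" "z \<in> colourings N p"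
  shows "push N m (G \<odot>\<^bsub>of_nat N\<^esub> F) f z = push N n G (push N m F f) z"
  unfolding push_def sum_distrib_right using mat_bcomp[OF assms(1,2) _ assms(3)]
  by (simp add: sum_distrib_left) (subst sum.swap, simp add: mult_ac)

lemma push_btens:
  assumes "F \<in> bhom m n" "z \<in> colourings N n"
  shows "push N (m + m') (btens m n F G) f (z @ z') =
    (\<Sum>y\<in>colourings N m. mat F y z * push N m' G (\<lambda>u. f (y @ u)) z')"
  unfolding push_def sum_colourings_append sum_distrib_left
  using assms by (intro sum.cong refl) (simp add: mat_btens mult_ac)

lemma push_btens_mult:
  assumes "F \<in> bhom m n" "z \<in> colourings N n"
    and "\<And>x x'. x \<in> colourings N m \<Longrightarrow> x' \<in> colourings N m' \<Longrightarrow> f (x @ x') = g x * h x'"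
  shows "push N (m + m') (btens m n F G) f (z @ z') = push N m F g z * push N m' G h z'"
proof -
  have "push N m' G (\<lambda>u. f (y @ u)) z' = g y * push N m' G h z'" if "y \<in> colourings N m" for y
    using that assms(3) by (simp add: push_mult[symmetric] cong: push_cong)
  then show ?thesis
    unfolding push_btens[OF assms(1,2)] push_def[of N m F g] sum_distrib_right
    by (intro sum.cong refl) (simp add: mult_ac)
qed

lemma pull_btens_mult:
  assumes "F \<in> bhom m n" "x \<in> colourings N m"
    and "\<And>y y'. y \<in> colourings N n \<Longrightarrow> y' \<in> colourings N n' \<Longrightarrow> f (y @ y') = g y * h y'"
  shows "pull N (n + n') (btens m n F G) f (x @ x') = pull N n F g x * pull N n' G h x'"
proof -
  have "pull N (n + n') (btens m n F G) f (x @ x') =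
      (\<Sum>y\<in>colourings N n. \<Sum>y'\<in>colourings N n'. (mat F x y * g y) * (mat G x' y' * h y'))"
    unfolding pull_def sum_colourings_append
    using assms by (intro sum.cong refl) (simp add: mat_btens mult_ac)
  then show ?thesis by (simp add: pull_def sum_product)
qed

lemma pull_symz: "symfun N d f \<Longrightarrow> x \<in> colourings N d \<Longrightarrow> pull N d (symz d) f x = f x"
  by (simp add: pull_def sum_symz')

lemma push_symz: "symfun N d f \<Longrightarrow> x \<in> colourings N d \<Longrightarrow> push N d (symz d) f x = f x"
  by (simp only: push_def sum_symz mult.commute[of "f _"])

lemma push_bperm_vpow:
  assumes "\<pi> permutes {..<n}" "y \<in> colourings N n"
  shows "push N n (bperm n \<pi>) (vpow v) y = vpow v y"
proof -
  have mem: "permute_list \<pi> y \<in> colourings N n" "mset (permute_list \<pi> y) = mset y"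
    using assms by (simp_all add: colourings_def)
  have "push N n (bperm n \<pi>) (vpow v) y = (\<Sum>x\<in>colourings N n. if x = permute_list \<pi> y then vpow v x else 0)"
    unfolding push_def using assms by (intro sum.cong) (auto simp: mat_bperm)
  also have "\<dots> = vpow v y"
    using mem(1) vpow_mset[OF mem(2)] by simp
  finally show ?thesis .
qed

lemma push_bid:
  assumes "y \<in> colourings N n"
  shows "push N n (bid n) f y = f y"
proof -
  have "push N n (bid n) f y = (\<Sum>x\<in>colourings N n. if x = y then f x else 0)"
    unfolding push_def using assms by (intro sum.cong) (auto simp: mat_bid)
  then show ?thesis using assms by simp
qed

lemma push_bid_btens:
  assumes "z \<in> colourings N n"
  shows "push N (n + m') (btens n n (bid n) G) f (z @ z') = push N m' G (\<lambda>u. f (z @ u)) z'"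
  unfolding push_btens[OF bid_in_bhom assms]
  using push_bid[OF assms, of "\<lambda>z. push N m' G (\<lambda>u. f (z @ u)) z'"] by (simp add: push_def[of N n] mult.commute)

lemma sum_vpow_mult: "(\<Sum>x\<in>colourings N n. vpow v x * vpow w x) = (\<Sum>c<N. v c * w c) ^ n"
proof (induction n)
  case (Suc n)
  have "(\<Sum>x\<in>colourings N (Suc n). vpow v x * vpow w x) =
        (\<Sum>c<N. \<Sum>x\<in>colourings N n. (v c * w c) * (vpow v x * vpow w x))"
    by (simp add: sum_colourings_Suc mult_ac)
  also have "\<dots> = (\<Sum>c<N. v c * w c) * (\<Sum>x\<in>colourings N n. vpow v x * vpow w x)"
    by (simp add: sum_distrib_left[symmetric] sum_distrib_right[symmetric])
  finally show ?case by (simp add: Suc.IH)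
qed simp

section \<open>Multiplication, derivations and contractions as polynomial families\<close>

lemma bfam_cong: "bfam m n F \<Longrightarrow> m = m' \<Longrightarrow> n = n' \<Longrightarrow> bfam m' n' F"
  by simp

lemmas bfam_consts = bfam_const[OF symz_in_bhom] bfam_const[OF bid_in_bhom] bfam_const[OF bcap_in_bhom]
  bfam_const[OF bcups_in_bhom]

lemma bfam_mult: "bfam (a + b) (a + b) (\<lambda>t. mult t a b)"
  unfolding mult_def by (rule bfam_bcomp[OF bfam_btens]) (rule bfam_consts)+

lemma bfam_derivation: "bfam (Suc q) (q - 1) (\<lambda>t. derivation t q)"
proof (cases q)
  case 0
  \<comment> \<open>The Leibniz sum is empty, so the truncated degree \<open>q - 1\<close> does no
    harm.\<close>
  then show ?thesis by (simp add: derivation_def bfam_const)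
next
  case (Suc r)
  have "bfam (Suc q) r (\<lambda>t. symz r \<odot>\<^bsub>t\<^esub> btens 2 0 bcap (bid r) \<odot>\<^bsub>t\<^esub>
             btens 1 1 (bid 1) (bperm q (Transposition.transpose 0 i) \<odot>\<^bsub>t\<^esub> symz q))" if "i < q" for i
  proof -
    have "bperm q (Transposition.transpose 0 i) \<in> bhom q q"
      using that by (intro bperm_in_bhom permutes_swap_id) auto
    then have 1: "bfam (1 + q) (1 + q) (\<lambda>t. btens 1 1 (bid 1) (bperm q (Transposition.transpose 0 i) \<odot>\<^bsub>t\<^esub> symz q))"
      by (intro bfam_btens[OF bfam_consts(2)] bfam_bcomp[OF bfam_consts(1)] bfam_const)
    have 2: "bfam (2 + r) (0 + r) (\<lambda>t. btens 2 0 bcap (bid r))"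
      by (intro bfam_btens bfam_consts)
    have 3: "bfam (1 + q) (0 + r) (\<lambda>t. btens 2 0 bcap (bid r))" using 2 Suc by simp
    show ?thesis
      using bfam_bcomp[OF bfam_bcomp[OF 1 3], of r "\<lambda>_. symz r"] bfam_consts(1)[of r] by simp
  qed
  then show ?thesis unfolding derivation_def using Suc by (intro bfam_sum) auto
qed

lemma bfam_contr_tensor: "bfam (p + q) (q - p) (\<lambda>t. contr_tensor t p q)"
proof (induction p)
  case 0
  then show ?case by (simp add: bfam_const)
next
  case (Suc p)
  have 1: "bfam (1 + (p + q)) (1 + (q - p)) (\<lambda>t. btens 1 1 (bid 1) (contr_tensor t p q))"
    by (intro bfam_btens bfam_consts Suc.IH)
  have 2: "bfam (1 + (q - p)) (q - Suc p) (\<lambda>t. derivation t (q - p))"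
    by (rule bfam_cong[OF bfam_derivation]) auto
  show ?case using bfam_bcomp[OF 1 2] by simp
qed

lemma bfam_contr: "bfam (p + q) (q - p) (\<lambda>t. contr t p q)"
  unfolding contr_def by (intro bfam_bcomp[OF bfam_btens bfam_contr_tensor] bfam_consts)

text \<open>The adjoint of multiplication is a coproduct, and it splits a pure power of
  \<open>w\<close> into two pure powers.\<close>

lemma pull_mult_vpow:
  assumes "y \<in> colourings N (a + b)"
  shows "pull N (a + b) (mult (of_nat N) a b) (vpow w) y = vpow w y"
proof -
  obtain y1 y2 where y: "y = y1 @ y2" "y1 \<in> colourings N a" "y2 \<in> colourings N b"
  proof
    show "y = take a y @ drop a y" by simp
    show "take a y \<in> colourings N a" "drop a y \<in> colourings N b"
      using assms by (auto simp: colourings_def dest: in_set_takeD in_set_dropD)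
  qed
  have "pull N (a + b) (mult (of_nat N) a b) (vpow w) y =
        pull N (a + b) (btens a a (symz a) (symz b)) (pull N (a + b) (symz (a + b)) (vpow w)) y"
    unfolding mult_def by (rule pull_bcomp[OF btens_in_bhom[OF symz_in_bhom symz_in_bhom] symz_in_bhom assms])
  also have "\<dots> = pull N (a + b) (btens a a (symz a) (symz b)) (vpow w) y"
    by (intro pull_cong pull_symz) auto
  also have "\<dots> = vpow w y1 * vpow w y2"
    unfolding y(1) using y by (subst pull_btens_mult[of _ a a _ N b _ "vpow w" "vpow w"]) (auto simp: pull_symz)
  finally show ?thesis by (simp add: y)
qed

lemma mat_bcap: "mat bcap [a, b] [] = of_bool (a = b)"
  by (auto simp: bcap_def compat_def)

lemma mat_bcups:
  assumes "x \<in> colourings N d" "y \<in> colourings N d"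
  shows "mat (bcups d) [] (x @ y) = of_bool (x = y)"
proof -
  have "compat ({(Inr i, Inr (d + i)) |i. i < d} \<union> {(Inr (d + i), Inr i) |i. i < d}) [] (x @ y) \<longleftrightarrow>
        (\<forall>i<d. x ! i = y ! i)"
    using assms unfolding compat_def ball_Un by (auto simp: setcompr_eq_image nth_append colourings_def)
  also have "\<dots> \<longleftrightarrow> x = y"
    using assms by (auto simp: list_eq_iff_nth_eq colourings_def)
  finally show ?thesis by (simp add: bcups_def)
qed


section \<open>The action on symmetric powers\<close>

lemma sum_colourings_1: "(\<Sum>x\<in>colourings N 1. f x) = (\<Sum>c<N. f [c])"
  using sum_colourings_Suc[of f N 0] by simp

lemma push_sum: "push N m (\<Sum>i\<in>S. F i) f z = (\<Sum>i\<in>S. push N m (F i) f z)"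
  unfolding push_def mat_sum sum_distrib_left by (rule sum.swap)

text \<open>A pure power is fixed by the transpositions, so the \<open>q\<close> Leibniz terms
  agree, and each of them contracts one factor \<open>v\<close> with \<open>e\<close>.\<close>

lemma push_derivation:
  assumes f: "\<And>c x. c < N \<Longrightarrow> x \<in> colourings N q \<Longrightarrow> f (c # x) = e c * vpow v x"
    and z: "z \<in> colourings N (q - 1)"
  shows "push N (Suc q) (derivation (of_nat N) q) f z = of_nat q * (\<Sum>c<N. e c * v c) * vpow v z"
proof (cases q)
  case 0
  then show ?thesis by (simp add: derivation_def push_def)
next
  case (Suc r)
  have z: "z \<in> colourings N r" using z Suc by simp
  have step: "push N (Suc q) (symz r \<odot>\<^bsub>of_nat N\<^esub> btens 2 0 bcap (bid r) \<odot>\<^bsub>of_nat N\<^esub>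
          btens 1 1 (bid 1) (bperm q (Transposition.transpose 0 i) \<odot>\<^bsub>of_nat N\<^esub> symz q)) f z =
        (\<Sum>c<N. e c * v c) * vpow v z" if i: "i < q" for i
  proof -
    let ?\<tau> = "Transposition.transpose 0 i"
    have \<tau>: "?\<tau> permutes {..<q}" using i by (intro permutes_swap_id) auto
    let ?B = "bperm q ?\<tau> \<odot>\<^bsub>of_nat N\<^esub> symz q"
    have B: "?B \<in> bhom q q" using \<tau> by (intro bcomp_in_bhom[of _ q q]) auto
    have 1: "btens 1 1 (bid 1) ?B \<in> bhom (Suc q) (Suc q)"
      using btens_in_bhom[OF bid_in_bhom[of 1] B] by simp
    have 2: "btens 2 0 bcap (bid r) \<in> bhom (Suc q) r"
      using btens_in_bhom[OF bcap_in_bhom bid_in_bhom[of r]] Suc by simp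
    define g where "g = push N (Suc q) (btens 1 1 (bid 1) ?B) f"
    define h where "h = push N (Suc q) (btens 2 0 bcap (bid r)) g"
    have g: "g (c # x) = e c * vpow v x" if cx: "c < N" "x \<in> colourings N q" for c x
    proof -
      have "g ([c] @ x) = push N q ?B (\<lambda>u. f ([c] @ u)) x"
        using push_bid_btens[of "[c]" N 1 q ?B f x] cx by (simp add: g_def)
      also have "\<dots> = push N q ?B (\<lambda>u. e c * vpow v u) x"
        using f cx by (intro push_cong) simp
      also have "\<dots> = e c * push N q (bperm q ?\<tau>) (push N q (symz q) (vpow v)) x"
        by (simp only: push_mult push_bcomp[OF symz_in_bhom bperm_in_bhom[OF \<tau>] cx(2)])
      also have "push N q (bperm q ?\<tau>) (push N q (symz q) (vpow v)) x = vpow v x"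
        using push_bperm_vpow[OF \<tau> cx(2)] by (simp add: push_symz cong: push_cong)
      finally show ?thesis by simp
    qed
    have h: "h x = (\<Sum>c<N. e c * v c) * vpow v x" if x: "x \<in> colourings N r" for x
    proof -
      have "h ([] @ x) = push N 2 bcap (\<lambda>u. e (u ! 0) * v (u ! 1)) [] * push N r (bid r) (vpow v) x"
        unfolding h_def Suc using g
        by (subst push_btens_mult[OF bcap_in_bhom, of _ N r g "\<lambda>u. e (u ! 0) * v (u ! 1)" "vpow v" "bid r" x, simplified])
           (auto simp: Suc numeral_2_eq_2 colourings_def length_Suc_conv)
      also have "push N 2 bcap (\<lambda>u. e (u ! 0) * v (u ! 1)) [] = (\<Sum>c<N. e c * v c)"
      proof -
        have "push N 2 bcap (\<lambda>u. e (u ! 0) * v (u ! 1)) [] = (\<Sum>c<N. \<Sum>d<N. if c = d then e c * v d else 0)"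
          unfolding push_def numeral_2_eq_2 sum_colourings_Suc
          by (intro sum.cong refl) (auto simp: mat_bcap)
        then show ?thesis by simp
      qed
      finally show ?thesis using x by (simp add: push_bid)
    qed
    have "push N (Suc q) (symz r \<odot>\<^bsub>of_nat N\<^esub> btens 2 0 bcap (bid r) \<odot>\<^bsub>of_nat N\<^esub> btens 1 1 (bid 1) ?B) f z
       = push N r (symz r) h z"
      unfolding h_def g_def
      using z by (simp add: push_bcomp[OF bcomp_in_bhom[OF 1 2] symz_in_bhom] push_bcomp[OF 1 2] cong: push_cong)
    also have "\<dots> = push N r (symz r) (\<lambda>x. (\<Sum>c<N. e c * v c) * vpow v x) z"
      by (intro push_cong h)
    finally show ?thesis using z by (simp add: push_mult push_symz)
  qed
  have r: "q - 1 = r" using Suc by simp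
  have "push N (Suc q) (derivation (of_nat N) q) f z = (\<Sum>i<q. (\<Sum>c<N. e c * v c) * vpow v z)"
    unfolding derivation_def push_sum r by (intro sum.cong refl step) simp
  then show ?thesis by simp
qed

lemma ffact_Suc: "ffact a (Suc r) = ffact a r * (a - of_nat r)"
  by (simp add: ffact_def)

lemma ffact_0 [simp]: "ffact a 0 = 1"
  by (simp add: ffact_def)

lemma ffact_of_nat_eq_0: "n < r \<Longrightarrow> ffact (of_nat n) r = 0"
  unfolding ffact_def by (rule prod_zero) (auto intro: bexI[of _ n])

text \<open>A derivation applied to a pure power of degree m yields a factor m, and the degrees run
  through \<open>q\<close>, \<open>q - 1\<close> and so on; this is the origin of the falling
  factorial.\<close>

lemma push_contr_tensor:
  assumes f: "\<And>y x. y \<in> colourings N p \<Longrightarrow> x \<in> colourings N q \<Longrightarrow> f (y @ x) = e y * vpow v x"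
    and z: "z \<in> colourings N (q - p)"
  shows "push N (p + q) (contr_tensor (of_nat N) p q) f z =
    ffact (of_nat q) p * (\<Sum>y\<in>colourings N p. e y * vpow v y) * vpow v z"
  using assms
proof (induction p arbitrary: f e z)
  case 0
  then have "push N q (symz q) f z = push N q (symz q) (\<lambda>x. e [] * vpow v x) z"
    by (intro push_cong) auto
  then show ?case using 0 by (simp add: push_mult push_symz)
next
  case (Suc p)
  let ?K = "contr_tensor (of_nat N) p q"
  have K: "?K \<in> bhom (p + q) (q - p)" using bfam_in_bhom[OF bfam_contr_tensor] .
  have 1: "btens 1 1 (bid 1) ?K \<in> bhom (Suc p + q) (Suc (q - p))"
    using btens_in_bhom[OF bid_in_bhom[of 1] K] by simp
  have 2: "derivation (of_nat N) (q - p) \<in> bhom (Suc (q - p)) (q - Suc p)"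
    using bfam_in_bhom[OF bfam_cong[OF bfam_derivation refl, of "q - p" "q - Suc p"]] by simp
  define g where "g = push N (Suc p + q) (btens 1 1 (bid 1) ?K) f"
  define e' where "e' = (\<lambda>c. ffact (of_nat q) p * (\<Sum>y\<in>colourings N p. e (c # y) * vpow v y))"
  have g: "g (c # x) = e' c * vpow v x" if cx: "c < N" "x \<in> colourings N (q - p)" for c x
  proof -
    have "g ([c] @ x) = push N (p + q) ?K (\<lambda>u. f ([c] @ u)) x"
      using push_bid_btens[of "[c]" N 1 "p + q" ?K f x] cx by (simp add: g_def)
    also have "\<dots> = e' c * vpow v x"
      unfolding e'_def using Suc.prems(1)[of "c # _"] cx by (intro Suc.IH) auto
    finally show ?thesis by simp
  qed
  have "push N (Suc p + q) (contr_tensor (of_nat N) (Suc p) q) f z =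
        push N (Suc (q - p)) (derivation (of_nat N) (q - p)) g z"
    unfolding g_def contr_tensor.simps by (rule push_bcomp[OF 1 2 Suc.prems(2)])
  also have "\<dots> = of_nat (q - p) * (\<Sum>c<N. e' c * v c) * vpow v z"
    using g Suc.prems(2) by (intro push_derivation) auto
  also have "(\<Sum>c<N. e' c * v c) = ffact (of_nat q) p * (\<Sum>y\<in>colourings N (Suc p). e y * vpow v y)"
    by (simp add: e'_def sum_colourings_Suc sum_distrib_left sum_distrib_right mult_ac)
  \<comment> \<open>For \<open>p > q\<close> both sides vanish, since the falling factorial of
    \<open>q\<close> then contains the factor \<open>q - q\<close>; so the truncation in
    \<open>q - p\<close> is harmless.\<close>
  also have "of_nat (q - p) * (ffact (of_nat q) p * (\<Sum>y\<in>colourings N (Suc p). e y * vpow v y)) =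
     ffact (of_nat q) (Suc p) * (\<Sum>y\<in>colourings N (Suc p). e y * vpow v y)"
    by (cases "p \<le> q") (simp_all add: ffact_Suc of_nat_diff ffact_of_nat_eq_0)
  finally show ?case .
qed

lemma push_contr:
  assumes f: "\<And>y x. y \<in> colourings N p \<Longrightarrow> x \<in> colourings N q \<Longrightarrow> f (y @ x) = e y * vpow v x"
    and z: "z \<in> colourings N (q - p)"
  shows "push N (p + q) (contr (of_nat N) p q) f z =
    ffact (of_nat q) p * (\<Sum>y\<in>colourings N p. e y * vpow v y) * vpow v z"
proof -
  have K: "contr_tensor (of_nat N) p q \<in> bhom (p + q) (q - p)" using bfam_in_bhom[OF bfam_contr_tensor] .
  have "push N (p + q) (contr (of_nat N) p q) f z =
    push N (p + q) (contr_tensor (of_nat N) p q) (push N (p + q) (btens p p (symz p) (symz q)) f) z"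
    unfolding contr_def by (rule push_bcomp[OF btens_in_bhom[OF symz_in_bhom symz_in_bhom] K z])
  also have "\<dots> = ffact (of_nat q) p * (\<Sum>y\<in>colourings N p. push N p (symz p) e y * vpow v y) * vpow v z"
  proof (rule push_contr_tensor[OF _ z])
    fix y x assume yx: "y \<in> colourings N p" "x \<in> colourings N q"
    show "push N (p + q) (btens p p (symz p) (symz q)) f (y @ x) = push N p (symz p) e y * vpow v x"
      using yx f by (subst push_btens_mult[of _ p p _ N q f e "vpow v"]) (auto simp: push_symz)
  qed
  also have "(\<Sum>y\<in>colourings N p. push N p (symz p) e y * vpow v y) = (\<Sum>y\<in>colourings N p. e y * vpow v y)"
    unfolding sum_push_pull by (intro sum.cong refl) (simp add: pull_symz)
  finally show ?thesis .
qed

definition act_term :: "complex \<Rightarrow> nat \<Rightarrow> bmor \<Rightarrow> nat \<Rightarrow> bmor" where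
  "act_term t d D q = mult t d (q - d) \<odot>\<^bsub>t\<^esub> btens d d (symz d) (contr t d q) \<odot>\<^bsub>t\<^esub>
              btens 0 (d + d) D (symz q)"

lemma act_single_degree:
  assumes "\<And>p. p \<noteq> d \<Longrightarrow> D p = 0"
  shows "act t D q = (if d \<le> q then act_term t d (D d) q else 0)"
proof -
  have "act t D q = (\<Sum>p\<le>q. if p = d then act_term t d (D d) q else 0)"
    unfolding act_def using assms by (intro sum.cong refl) (auto simp: act_term_def)
  then show ?thesis by simp
qed

lemma bfam_act_term:
  assumes D: "bfam 0 (d + d) D" and "d \<le> q"
  shows "bfam q q (\<lambda>t. act_term t d (D t) q)"
proof -
  have 1: "bfam (0 + q) (d + d + q) (\<lambda>t. btens 0 (d + d) (D t) (symz q))"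
    by (intro bfam_btens D bfam_consts)
  have 2: "bfam (d + (d + q)) (d + (q - d)) (\<lambda>t. btens d d (symz d) (contr t d q))"
    by (intro bfam_btens bfam_contr bfam_consts)
  show ?thesis
    unfolding act_term_def
    using bfam_bcomp[OF bfam_bcomp[OF 1 bfam_cong[OF 2 _ refl]] bfam_mult] assms(2) by simp
qed

text \<open>The second leg of \<open>D\<close> differentiates the pure power of \<open>v\<close>,
  which gives the falling factorial and leaves degree \<open>q - d\<close>; the first leg multiplies
  the result and is paired with \<open>w\<close>. What is left of the pure power of \<open>v\<close>
  meets \<open>w\<close> in the scalar product to the power \<open>q - d\<close>.\<close>

lemma pairing_act_term:
  assumes D: "D \<in> bhom 0 (d + d)" and "d \<le> q"
  shows "pairing N q q (act_term (of_nat N) d D q) v w =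
    ffact (of_nat q) d * (\<Sum>c<N. v c * w c) ^ (q - d) *
    (\<Sum>x\<in>colourings N d. \<Sum>y\<in>colourings N d. mat D [] (x @ y) * vpow w x * vpow v y)"
proof -
  let ?t = "of_nat N :: complex"
  let ?R = "btens 0 (d + d) D (symz q)"
  let ?Q = "btens d d (symz d) (contr ?t d q)"
  have R: "?R \<in> bhom q (d + (d + q))"
    using btens_in_bhom[OF D symz_in_bhom[of q]] by (simp add: add.assoc)
  have Q: "?Q \<in> bhom (d + (d + q)) (d + (q - d))"
    by (intro btens_in_bhom symz_in_bhom bfam_in_bhom[OF bfam_contr])
  have M: "mult ?t d (q - d) \<in> bhom (d + (q - d)) (d + (q - d))"
    by (rule bfam_in_bhom[OF bfam_mult])
  define g where "g = push N q ?R (vpow v)"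
  have g: "g (y1 @ (y2 @ x)) = mat D [] (y1 @ y2) * vpow v x"
    if "y1 \<in> colourings N d" "y2 \<in> colourings N d" "x \<in> colourings N q" for y1 y2 x
  proof -
    have "g ((y1 @ y2) @ x) = push N 0 D (\<lambda>_. 1) (y1 @ y2) * push N q (symz q) (vpow v) x"
      unfolding g_def
      using push_btens_mult[OF D append_in_colourings[OF that(1,2)],
          where m' = q and f = "vpow v" and g = "\<lambda>_. 1" and h = "vpow v" and G = "symz q" and z' = x] by simp
    then show ?thesis using that by (simp add: push_symz) (simp add: push_def)
  qed
  define B where "B = (\<lambda>y1. \<Sum>y2\<in>colourings N d. mat D [] (y1 @ y2) * vpow v y2)"
  have h: "push N (d + (d + q)) ?Q g (z1 @ z2) = ffact (of_nat q) d * push N d (symz d) B z1 * vpow v z2"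
    if z: "z1 \<in> colourings N d" "z2 \<in> colourings N (q - d)" for z1 z2
  proof -
    have "push N (d + q) (contr ?t d q) (\<lambda>u. g (y1 @ u)) z2 = ffact (of_nat q) d * B y1 * vpow v z2"
      if "y1 \<in> colourings N d" for y1
      unfolding B_def using g that z by (intro push_contr) auto
    then show ?thesis
      unfolding push_btens[OF symz_in_bhom z(1)]
      by (simp add: push_def[of N d "symz d" B] sum_distrib_left sum_distrib_right mult_ac)
  qed
  have "pairing N q q (act_term ?t d D q) v w =
        (\<Sum>z\<in>colourings N q. push N q (act_term ?t d D q) (vpow v) z * vpow w z)"
    by (rule pairing_push)
  also have "\<dots> = (\<Sum>z\<in>colourings N (d + (q - d)).
      push N (d + (q - d)) (mult ?t d (q - d)) (push N (d + (d + q)) ?Q g) z * vpow w z)"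
  proof (rule sum.cong)
    show "colourings N q = colourings N (d + (q - d))" using assms(2) by simp
    fix z assume z: "z \<in> colourings N (d + (q - d))"
    have "push N q (act_term ?t d D q) (vpow v) z =
          push N (d + (q - d)) (mult ?t d (q - d)) (push N q (?Q \<odot>\<^bsub>?t\<^esub> ?R) (vpow v)) z"
      unfolding act_term_def by (rule push_bcomp[OF bcomp_in_bhom[OF R Q] M z])
    also have "\<dots> = push N (d + (q - d)) (mult ?t d (q - d)) (push N (d + (d + q)) ?Q g) z"
      unfolding g_def by (intro push_cong push_bcomp[OF R Q])
    finally show "push N q (act_term ?t d D q) (vpow v) z * vpow w z =
      push N (d + (q - d)) (mult ?t d (q - d)) (push N (d + (d + q)) ?Q g) z * vpow w z" by simp
  qed
  also have "\<dots> = (\<Sum>z\<in>colourings N (d + (q - d)). push N (d + (d + q)) ?Q g z * vpow w z)"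
    by (subst sum_push_pull) (intro sum.cong refl, simp only: pull_mult_vpow)
  also have "\<dots> = (\<Sum>z1\<in>colourings N d. \<Sum>z2\<in>colourings N (q - d).
      (ffact (of_nat q) d * push N d (symz d) B z1 * vpow w z1) * (vpow v z2 * vpow w z2))"
    unfolding sum_colourings_append by (intro sum.cong refl) (simp add: h mult_ac)
  also have "\<dots> = ffact (of_nat q) d * (\<Sum>z1\<in>colourings N d. push N d (symz d) B z1 * vpow w z1) *
      (\<Sum>z2\<in>colourings N (q - d). vpow v z2 * vpow w z2)"
    by (simp add: sum_product sum_distrib_left sum_distrib_right mult_ac)
  also have "(\<Sum>z1\<in>colourings N d. push N d (symz d) B z1 * vpow w z1) =
     (\<Sum>x\<in>colourings N d. B x * vpow w x)"
    unfolding sum_push_pull by (intro sum.cong refl) (simp add: pull_symz)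
  also have "\<dots> = (\<Sum>x\<in>colourings N d. \<Sum>y\<in>colourings N d. mat D [] (x @ y) * vpow w x * vpow v y)"
    unfolding B_def sum_distrib_right by (intro sum.cong refl) (simp add: mult_ac)
  finally show ?thesis by (simp add: sum_vpow_mult mult_ac)
qed

lemma bfam_Sym_coev: "bfam 0 (d + d) (\<lambda>t. Sym_coev t d)"
  unfolding Sym_coev_def
  by (intro bfam_bscale bfam_bcomp[OF bfam_consts(4) bfam_btens[OF bfam_consts(1) bfam_consts(1)]]) simp

lemma bfam_elt_of_endo:
  assumes "bfam d d F"
  shows "bfam 0 (d + d) (\<lambda>t. elt_of_endo t d (F t) d)"
  using bfam_bcomp[OF bfam_Sym_coev bfam_btens[OF assms bfam_consts(1)[of d]]] by (simp add: elt_of_endo_def)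

text \<open>The coevaluation turns the pairing with the two legs back into the pairing of
  \<open>F\<close>. The factorial is the one in \<open>Sym_coev\<close>, which makes up for the
  \<open>d\<close> successive derivations in the contraction.\<close>

lemma pairing_elt_of_endo:
  assumes F: "F \<in> bhom d d"
  shows "(\<Sum>x\<in>colourings N d. \<Sum>y\<in>colourings N d.
      mat (elt_of_endo (of_nat N) d F d) [] (x @ y) * vpow w x * vpow v y) = pairing N d d F v w / fact d"
proof -
  let ?t = "of_nat N :: complex"
  define h where "h = (\<lambda>u. vpow w (take d u) * vpow v (drop d u))"
  have h: "h (x @ y) = vpow w x * vpow v y" if "x \<in> colourings N d" for x y
    using that by (simp add: h_def colourings_def)
  let ?SS = "btens d d (symz d) (symz d)"
  have SS: "?SS \<in> bhom (d + d) (d + d)" by (intro btens_in_bhom symz_in_bhom)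
  have FS: "btens d d F (symz d) \<in> bhom (d + d) (d + d)" by (intro btens_in_bhom symz_in_bhom F)
  have coev: "Sym_coev ?t d \<in> bhom 0 (d + d)" by (rule bfam_in_bhom[OF bfam_Sym_coev])
  let ?f = "pull N d F (vpow w)"
  have 1: "pull N (d + d) (btens d d F (symz d)) h (x @ y) = ?f x * vpow v y"
    if "x \<in> colourings N d" "y \<in> colourings N d" for x y
    using pull_btens_mult[OF F that(1), of d h "vpow w" "vpow v" "symz d" y] h that by (simp add: pull_symz)
  let ?k = "pull N (d + d) (btens d d F (symz d)) h"
  have 2: "pull N (d + d) ?SS ?k (x @ y) = pull N d (symz d) ?f x * vpow v y"
    if "x \<in> colourings N d" "y \<in> colourings N d" for x y
    using pull_btens_mult[OF symz_in_bhom that(1), of d ?k ?f "vpow v" "symz d" y] 1 that by (simp add: pull_symz)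
  have "(\<Sum>x\<in>colourings N d. \<Sum>y\<in>colourings N d.
      mat (elt_of_endo ?t d F d) [] (x @ y) * vpow w x * vpow v y) = pull N (d + d) (elt_of_endo ?t d F d) h []"
    unfolding pull_def sum_colourings_append by (intro sum.cong refl) (simp add: h mult_ac)
  also have "\<dots> = pull N (d + d) (Sym_coev ?t d) ?k []"
    unfolding elt_of_endo_def by (simp add: pull_bcomp[OF coev FS])
  also have "\<dots> = pull N (d + d) (?SS \<odot>\<^bsub>?t\<^esub> bcups d) ?k [] / fact d"
    unfolding Sym_coev_def by (simp add: pull_def[of N "d + d" "bscale _ _"] pull_def[of N "d + d" "_ \<odot>\<^bsub>_\<^esub> _"] sum_divide_distrib)
  also have "pull N (d + d) (?SS \<odot>\<^bsub>?t\<^esub> bcups d) ?k [] = pull N (d + d) (bcups d) (pull N (d + d) ?SS ?k) []"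
    by (simp add: pull_bcomp[OF bcups_in_bhom SS])
  also have "\<dots> = (\<Sum>x\<in>colourings N d. \<Sum>y\<in>colourings N d.
      if x = y then pull N d (symz d) ?f x * vpow v y else 0)"
    unfolding pull_def[of N "d + d" "bcups d"] sum_colourings_append
    by (intro sum.cong refl) (auto simp: mat_bcups 2)
  also have "\<dots> = (\<Sum>x\<in>colourings N d. vpow v x * pull N d (symz d) ?f x)"
    by (simp add: mult.commute)
  also have "\<dots> = pairing N d d F v w"
  proof -
    have "(\<Sum>x\<in>colourings N d. vpow v x * pull N d (symz d) ?f x) =
          (\<Sum>x\<in>colourings N d. push N d (symz d) (vpow v) x * ?f x)"
      by (rule sum_push_pull[symmetric])
    then show ?thesis by (simp add: push_symz pairing_def)
  qed
  finally show ?thesis .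
qed

text \<open>The falling factorial from the differentiation, divided by the factorial in
  \<open>Sym_coev\<close>, is the binomial coefficient.\<close>

lemma pairing_act_endo:
  assumes F: "F \<in> bhom d d" and "d \<le> q"
  shows "pairing N q q (act (of_nat N) (elt_of_endo (of_nat N) d F) q) v w =
    of_nat (q choose d) * (\<Sum>c<N. v c * w c) ^ (q - d) * pairing N d d F v w"
proof -
  have D: "elt_of_endo (of_nat N) d F d \<in> bhom 0 (d + d)"
    by (rule bfam_in_bhom[OF bfam_elt_of_endo[OF bfam_const[OF F]]])
  have "fact d * of_nat (q choose d) = (ffact (of_nat q) d :: complex)"
    by (simp add: binomial_gbinomial gbinomial_prod_rev ffact_def atLeast0LessThan)
  then have "ffact (of_nat q) d / fact d = (of_nat (q choose d) :: complex)"
    by (simp add: field_simps)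
  moreover have "act (of_nat N) (elt_of_endo (of_nat N) d F) q = act_term (of_nat N) d (elt_of_endo (of_nat N) d F d) q"
    using assms(2) by (subst act_single_degree[of d]) (auto simp: elt_of_endo_def)
  ultimately show ?thesis
    by (simp add: pairing_act_term[OF D assms(2)] pairing_elt_of_endo[OF F] flip: times_divide_eq_left)
qed

text \<open>Symmetry in the source (\<open>lsym\<close>) and in the target (\<open>rsym\<close>)
  together ensure that a matrix is determined by its pairings with pure powers.\<close>

definition lsym :: "nat \<Rightarrow> nat \<Rightarrow> nat \<Rightarrow> bmor \<Rightarrow> bool" where
  "lsym N m n F \<longleftrightarrow> (\<forall>y\<in>colourings N n. symfun N m (\<lambda>x. mat F x y))"

definition rsym :: "nat \<Rightarrow> nat \<Rightarrow> nat \<Rightarrow> bmor \<Rightarrow> bool" where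
  "rsym N m n F \<longleftrightarrow> (\<forall>x\<in>colourings N m. symfun N n (\<lambda>y. mat F x y))"

lemma symfun_cong: "(\<And>x. x \<in> colourings N n \<Longrightarrow> f x = g x) \<Longrightarrow> symfun N n f \<longleftrightarrow> symfun N n g"
  using mset_eq_colourings[of _ N n] unfolding symfun_def by metis

lemma symfun_simps:
  "symfun N n (\<lambda>_. 0)"
  "symfun N n f \<Longrightarrow> symfun N n g \<Longrightarrow> symfun N n (\<lambda>x. f x + g x)"
  "symfun N n f \<Longrightarrow> symfun N n g \<Longrightarrow> symfun N n (\<lambda>x. f x - g x)"
  "symfun N n f \<Longrightarrow> symfun N n (\<lambda>x. c * f x)"
  "symfun N n f \<Longrightarrow> symfun N n (\<lambda>x. f x * c)"
  "(\<And>i. i \<in> S \<Longrightarrow> symfun N n (h i)) \<Longrightarrow> symfun N n (\<lambda>x. \<Sum>i\<in>S. h i x)"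
  by (auto simp: symfun_def intro!: sum.cong arg_cong2[of _ _ _ _ "(+)"] arg_cong2[of _ _ _ _ "(-)"])

lemma lsym_simps:
  "lsym N m n 0" "lsym N m m (symz m)"
  "lsym N m n F \<Longrightarrow> lsym N m n G \<Longrightarrow> lsym N m n (F + G)"
  "lsym N m n F \<Longrightarrow> lsym N m n G \<Longrightarrow> lsym N m n (F - G)"
  "lsym N m n F \<Longrightarrow> lsym N m n (bscale c F)"
  by (auto simp: lsym_def intro!: symfun_simps symfun_mat_symz')

lemma rsym_simps:
  "rsym N m n 0" "rsym N m m (symz m)"
  "rsym N m n F \<Longrightarrow> rsym N m n G \<Longrightarrow> rsym N m n (F + G)"
  "rsym N m n F \<Longrightarrow> rsym N m n G \<Longrightarrow> rsym N m n (F - G)"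
  "rsym N m n F \<Longrightarrow> rsym N m n (bscale c F)"
  by (auto simp: rsym_def intro!: symfun_simps symfun_mat_symz)

lemma lsym_bcomp:
  assumes "F \<in> bhom m n" "G \<in> bhom n p" "lsym N m n F"
  shows "lsym N m p (G \<odot>\<^bsub>of_nat N\<^esub> F)"
  unfolding lsym_def
proof
  fix z assume z: "z \<in> colourings N p"
  have "symfun N m (\<lambda>x. \<Sum>y\<in>colourings N n. mat F x y * mat G y z)"
    using assms(3) by (intro symfun_simps) (simp add: lsym_def)
  moreover have "mat (G \<odot>\<^bsub>of_nat N\<^esub> F) x z = (\<Sum>y\<in>colourings N n. mat F x y * mat G y z)"
    if "x \<in> colourings N m" for x
    by (rule mat_bcomp[OF assms(1,2) that z])
  ultimately show "symfun N m (\<lambda>x. mat (G \<odot>\<^bsub>of_nat N\<^esub> F) x z)"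
    by (simp cong: symfun_cong)
qed

lemma rsym_bcomp:
  assumes "F \<in> bhom m n" "G \<in> bhom n p" "rsym N n p G"
  shows "rsym N m p (G \<odot>\<^bsub>of_nat N\<^esub> F)"
  unfolding rsym_def
proof
  fix x assume x: "x \<in> colourings N m"
  have "symfun N p (\<lambda>z. \<Sum>y\<in>colourings N n. mat F x y * mat G y z)"
    using assms(3) by (intro symfun_simps) (simp add: rsym_def)
  moreover have "mat (G \<odot>\<^bsub>of_nat N\<^esub> F) x z = (\<Sum>y\<in>colourings N n. mat F x y * mat G y z)"
    if "z \<in> colourings N p" for z
    by (rule mat_bcomp[OF assms(1,2) x that])
  ultimately show "symfun N p (\<lambda>z. mat (G \<odot>\<^bsub>of_nat N\<^esub> F) x z)"
    by (simp cong: symfun_cong)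
qed

lemma colourings_appendE:
  assumes "y \<in> colourings N (a + b)"
  obtains y1 y2 where "y = y1 @ y2" "y1 \<in> colourings N a" "y2 \<in> colourings N b"
proof
  show "y = take a y @ drop a y" by simp
  show "take a y \<in> colourings N a" "drop a y \<in> colourings N b"
    using assms by (auto simp: colourings_def dest: in_set_takeD in_set_dropD)
qed

lemma lsym_btens_0:
  assumes D: "D \<in> bhom 0 k" and F: "lsym N m n F"
  shows "lsym N m (k + n) (btens 0 k D F)"
  unfolding lsym_def
proof
  fix y assume "y \<in> colourings N (k + n)"
  then obtain y1 y2 where y: "y = y1 @ y2" "y1 \<in> colourings N k" "y2 \<in> colourings N n"
    by (rule colourings_appendE)
  have "mat (btens 0 k D F) x y = mat D [] y1 * mat F x y2" for x
    using mat_btens[OF D, of "[]" N y1 F x y2] y by simp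
  then show "symfun N m (\<lambda>x. mat (btens 0 k D F) x y)"
    using F y(3) by (simp add: lsym_def symfun_simps)
qed

lemma rsym_mult: "rsym N (a + b) (a + b) (mult (of_nat N) a b)"
  unfolding mult_def by (rule rsym_bcomp[OF btens_in_bhom[OF symz_in_bhom symz_in_bhom] symz_in_bhom rsym_simps(2)])

text \<open>Polarization is used twice: in the target for fixed \<open>v\<close>, then in the source
  for a fixed word of the target.\<close>

lemma symmetric_bfam_eqI:
  assumes "bfam m n F" "bfam m n G"
    and "\<And>N. lsym N m n (F (of_nat N))" "\<And>N. lsym N m n (G (of_nat N))"
    and "\<And>N. rsym N m n (F (of_nat N))" "\<And>N. rsym N m n (G (of_nat N))"
    and eq: "\<And>N v w. pairing N m n (F (of_nat N)) v w = pairing N m n (G (of_nat N)) v w"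
  shows "F t = G t"
proof (rule bfam_eqI[OF assms(1,2)])
  fix N x y assume xy: "x \<in> colourings N m" "y \<in> colourings N n"
  define H where "H = F (of_nat N) - G (of_nat N)"
  have l: "lsym N m n H" and r: "rsym N m n H" unfolding H_def by (intro lsym_simps rsym_simps assms)+
  have "pairing N m n H v w = 0" for v w
    using eq[of N v w] by (simp add: H_def pairing_def pull_def left_diff_distrib right_diff_distrib sum_subtractf)
  moreover have "symfun N n (push N m H (vpow v))" for v
    using r unfolding push_def[abs_def] rsym_def by (intro symfun_simps) blast
  ultimately have "push N m H (vpow v) y = 0" if "y \<in> colourings N n" for v y
    using that unfolding pairing_push by (intro polarization[of N n "push N m H (vpow v)"]) auto
  then have "mat H x y = 0"
    using l xy by (intro polarization[of N m "\<lambda>x. mat H x y"]) (auto simp: push_def lsym_def mult.commute)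
  then show "mat (F (of_nat N)) x y = mat (G (of_nat N)) x y" by (simp add: H_def)
qed


section \<open>The algebra of radial operators\<close>

lemma pairing_btens:
  assumes F: "F \<in> bhom m n" and "G \<in> bhom m' n'"
  shows "pairing N (m + m') (n + n') (btens m n F G) v w = pairing N m n F v w * pairing N m' n' G v w"
proof -
  have "pull N (n + n') (btens m n F G) (vpow w) (x @ x') = pull N n F (vpow w) x * pull N n' G (vpow w) x'"
    if "x \<in> colourings N m" for x x'
    by (rule pull_btens_mult[OF F that]) simp
  then show ?thesis
    unfolding pairing_def sum_colourings_append sum_product
    by (intro sum.cong refl) (simp add: mult_ac)
qed

lemma pairing_simps:
  "pairing N m n (bscale c F) v w = c * pairing N m n F v w"
  "pairing N m n (F + G) v w = pairing N m n F v w + pairing N m n G v w"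
  "pairing N m n (F - G) v w = pairing N m n F v w - pairing N m n G v w"
  "pairing N m n 0 v w = 0"
  by (simp_all add: pairing_def pull_def sum_distrib_left algebra_simps sum.distrib sum_subtractf)

lemma pairing_bid: "pairing N n n (bid n) v w = (\<Sum>c<N. v c * w c) ^ n"
  unfolding pairing_push by (simp add: push_bid sum_vpow_mult)

lemma pairing_symz: "pairing N n n (symz n) v w = (\<Sum>c<N. v c * w c) ^ n"
  unfolding pairing_push by (simp add: push_symz sum_vpow_mult)

lemma sum_colourings_2: "(\<Sum>x\<in>colourings N 2. f x) = (\<Sum>c<N. \<Sum>d<N. f [c, d])"
  by (simp add: numeral_2_eq_2 sum_colourings_Suc)

lemma mat_bcup: "a < N \<Longrightarrow> b < N \<Longrightarrow> mat bcup [] [a, b] = of_bool (a = b)"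
  using mat_bcups[of "[a]" N 1 "[b]"] by simp

lemma bcup_in_bhom [simp]: "bcup \<in> bhom 0 2"
  using bcups_in_bhom[of 1] by (simp add: numeral_2_eq_2)

lemma pairing_bcap: "pairing N 2 0 bcap v w = (\<Sum>c<N. v c ^ 2)"
proof -
  have "pairing N 2 0 bcap v w = (\<Sum>c<N. \<Sum>d<N. if c = d then v c * v d else 0)"
    unfolding pairing_def sum_colourings_2 pull_def by (intro sum.cong refl) (simp add: mat_bcap)
  then show ?thesis by (simp add: power2_eq_square)
qed

lemma pull_bcup: "pull N 2 bcup (vpow w) [] = (\<Sum>c<N. w c ^ 2)"
proof -
  have "pull N 2 bcup (vpow w) [] = (\<Sum>c<N. \<Sum>d<N. if c = d then w c * w d else 0)"
    unfolding pull_def sum_colourings_2 by (intro sum.cong refl) (simp add: mat_bcup del: One_nat_def)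
  then show ?thesis by (simp add: power2_eq_square)
qed

lemma pairing_bcup: "pairing N 0 2 bcup v w = (\<Sum>c<N. w c ^ 2)"
  by (simp add: pairing_def pull_bcup del: One_nat_def)

text \<open>In a pairing the caps yield squares of \<open>v\<close>, the cups squares of
  \<open>w\<close>, and the \<open>e\<close> through strands the scalar product of \<open>v\<close>
  and \<open>w\<close>. That \<open>radial\<close> is the symmetrization of a single diagram is what
  makes it independent of \<open>t\<close>.\<close>

primrec cupcaps :: "nat \<Rightarrow> nat \<Rightarrow> bmor" where
  "cupcaps 0 e = bid e"
| "cupcaps (Suc r) e = btens 2 2 (btens 2 0 bcap bcup) (cupcaps r e)"

lemma cupcap_in_bhom: "btens 2 0 bcap bcup \<in> bhom 2 2"
  using btens_in_bhom[OF bcap_in_bhom bcup_in_bhom] by (simp only: add_0 add_0_right)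

lemma cupcaps_in_bhom: "cupcaps r e \<in> bhom (2 * r + e) (2 * r + e)"
proof (induction r)
  case (Suc r)
  show ?case using btens_in_bhom[OF cupcap_in_bhom Suc.IH] by (simp add: add.assoc)
qed simp

lemma pairing_cupcaps:
  "pairing N (2 * r + e) (2 * r + e) (cupcaps r e) v w =
     (\<Sum>c<N. v c ^ 2) ^ r * (\<Sum>c<N. w c ^ 2) ^ r * (\<Sum>c<N. v c * w c) ^ e"
proof (induction r)
  case 0
  then show ?case by (simp add: pairing_bid)
next
  case (Suc r)
  have "pairing N (2 * Suc r + e) (2 * Suc r + e) (cupcaps (Suc r) e) v w =
        pairing N 2 2 (btens 2 0 bcap bcup) v w * pairing N (2 * r + e) (2 * r + e) (cupcaps r e) v w"
    using pairing_btens[OF cupcap_in_bhom cupcaps_in_bhom, of N r e v w] by (simp add: add.assoc)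
  also have "pairing N 2 2 (btens 2 0 bcap bcup) v w = (\<Sum>c<N. v c ^ 2) * (\<Sum>c<N. w c ^ 2)"
    using pairing_btens[OF bcap_in_bhom bcup_in_bhom, of N v w]
    by (simp only: pairing_bcap pairing_bcup add_0 add_0_right)
  finally show ?case using Suc.IH by simp
qed

text \<open>\<open>radial t d r\<close> is \<open>4\<^sup>r \<Theta>\<^sup>r \<Delta>\<^sup>r\<close> on \<open>P\<^sup>d\<close>.\<close>

definition radial :: "complex \<Rightarrow> nat \<Rightarrow> nat \<Rightarrow> bmor" where
  "radial t d r = (if 2 * r \<le> d
     then bscale (ffact (of_nat d) (2 * r)) (symz d \<odot>\<^bsub>t\<^esub> (cupcaps r (d - 2 * r) \<odot>\<^bsub>t\<^esub> symz d)) else 0)"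

lemma cupcaps_in_bhom': "2 * r \<le> d \<Longrightarrow> cupcaps r (d - 2 * r) \<in> bhom d d"
  using cupcaps_in_bhom[of r "d - 2 * r"] by simp

lemma bfam_radial: "bfam d d (\<lambda>t. radial t d r)"
proof (cases "2 * r \<le> d")
  case True
  have "bfam d d (\<lambda>t. symz d \<odot>\<^bsub>t\<^esub> (cupcaps r (d - 2 * r) \<odot>\<^bsub>t\<^esub> symz d))"
    by (rule bfam_bcomp[OF bfam_bcomp]) (rule bfam_consts bfam_const[OF cupcaps_in_bhom'[OF True]])+
  with True show ?thesis by (simp add: radial_def bfam_bscale)
qed (simp add: radial_def bfam_const)

lemmas radial_in_bhom [simp] = bfam_in_bhom[OF bfam_radial]

lemma lsym_radial: "lsym N d d (radial (of_nat N) d r)"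
proof (cases "2 * r \<le> d")
  case True
  note X = cupcaps_in_bhom'[OF True]
  have "lsym N d d (symz d \<odot>\<^bsub>of_nat N\<^esub> (cupcaps r (d - 2 * r) \<odot>\<^bsub>of_nat N\<^esub> symz d))"
    by (intro lsym_bcomp[OF bcomp_in_bhom[OF symz_in_bhom X] symz_in_bhom] lsym_bcomp[OF symz_in_bhom X] lsym_simps)
  with True show ?thesis by (simp add: radial_def lsym_simps)
qed (simp add: radial_def lsym_simps)

lemma rsym_radial: "rsym N d d (radial (of_nat N) d r)"
proof (cases "2 * r \<le> d")
  case True
  note X = cupcaps_in_bhom'[OF True]
  have "rsym N d d (symz d \<odot>\<^bsub>of_nat N\<^esub> (cupcaps r (d - 2 * r) \<odot>\<^bsub>of_nat N\<^esub> symz d))"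
    by (intro rsym_bcomp[OF bcomp_in_bhom[OF symz_in_bhom X] symz_in_bhom] rsym_simps)
  with True show ?thesis by (simp add: radial_def rsym_simps)
qed (simp add: radial_def rsym_simps)

lemma pull_symmetrized:
  assumes X: "X \<in> bhom d d" and y: "y \<in> colourings N d"
  shows "pull N d (symz d \<odot>\<^bsub>of_nat N\<^esub> (X \<odot>\<^bsub>of_nat N\<^esub> symz d)) (vpow w) y = pull N d (symz d) (pull N d X (vpow w)) y"
proof -
  have "pull N d (symz d \<odot>\<^bsub>of_nat N\<^esub> (X \<odot>\<^bsub>of_nat N\<^esub> symz d)) (vpow w) y =
        pull N d (X \<odot>\<^bsub>of_nat N\<^esub> symz d) (pull N d (symz d) (vpow w)) y"
    by (rule pull_bcomp[OF bcomp_in_bhom[OF symz_in_bhom X] symz_in_bhom y])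
  also have "\<dots> = pull N d (X \<odot>\<^bsub>of_nat N\<^esub> symz d) (vpow w) y"
    by (intro pull_cong pull_symz) auto
  also have "\<dots> = pull N d (symz d) (pull N d X (vpow w)) y"
    by (rule pull_bcomp[OF symz_in_bhom X y])
  finally show ?thesis .
qed

lemma pairing_symmetrized:
  assumes X: "X \<in> bhom d d"
  shows "pairing N d d (symz d \<odot>\<^bsub>of_nat N\<^esub> (X \<odot>\<^bsub>of_nat N\<^esub> symz d)) v w = pairing N d d X v w"
proof -
  have "pairing N d d (symz d \<odot>\<^bsub>of_nat N\<^esub> (X \<odot>\<^bsub>of_nat N\<^esub> symz d)) v w =
        (\<Sum>x\<in>colourings N d. vpow v x * pull N d (symz d) (pull N d X (vpow w)) x)"
    unfolding pairing_def by (intro sum.cong refl) (simp add: pull_symmetrized[OF X])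
  also have "\<dots> = (\<Sum>x\<in>colourings N d. push N d (symz d) (vpow v) x * pull N d X (vpow w) x)"
    by (rule sum_push_pull[symmetric])
  finally show ?thesis by (simp add: pairing_def push_symz)
qed

lemma pairing_radial:
  "pairing N d d (radial (of_nat N) d r) v w = ffact (of_nat d) (2 * r) *
     ((\<Sum>c<N. v c ^ 2) ^ r * (\<Sum>c<N. w c ^ 2) ^ r * (\<Sum>c<N. v c * w c) ^ (d - 2 * r))"
proof (cases "2 * r \<le> d")
  case True
  then show ?thesis
    using pairing_cupcaps[of N r "d - 2 * r" v w]
    by (simp add: radial_def pairing_simps pairing_symmetrized[OF cupcaps_in_bhom'[OF True]])
next
  case False
  then show ?thesis by (simp add: radial_def pairing_simps ffact_of_nat_eq_0)
qed

text \<open>The symmetrizer fixes pure powers, so composing with it on either side leaves all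
  pairings unchanged.\<close>

lemma symz_bcomp_eqI:
  assumes F: "bfam d d F" and l: "\<And>N. lsym N d d (F (of_nat N))" and r: "\<And>N. rsym N d d (F (of_nat N))"
  shows "symz d \<odot>\<^bsub>t\<^esub> F t = F t" "F t \<odot>\<^bsub>t\<^esub> symz d = F t"
proof -
  have h: "F t \<in> bhom d d" for t by (rule bfam_in_bhom[OF F])
  show "symz d \<odot>\<^bsub>t\<^esub> F t = F t"
  proof (rule symmetric_bfam_eqI[OF bfam_bcomp[OF F bfam_consts(1)] F])
    fix N v w
    show "lsym N d d (symz d \<odot>\<^bsub>of_nat N\<^esub> F (of_nat N))" by (rule lsym_bcomp[OF h symz_in_bhom l])
    show "rsym N d d (symz d \<odot>\<^bsub>of_nat N\<^esub> F (of_nat N))" by (rule rsym_bcomp[OF h symz_in_bhom rsym_simps(2)])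
    have "pull N d (symz d \<odot>\<^bsub>of_nat N\<^esub> F (of_nat N)) (vpow w) x = pull N d (F (of_nat N)) (vpow w) x"
      if "x \<in> colourings N d" for x
      unfolding pull_bcomp[OF h symz_in_bhom that] by (intro pull_cong pull_symz) auto
    then show "pairing N d d (symz d \<odot>\<^bsub>of_nat N\<^esub> F (of_nat N)) v w = pairing N d d (F (of_nat N)) v w"
      by (simp add: pairing_def)
  qed (rule l r)+
  show "F t \<odot>\<^bsub>t\<^esub> symz d = F t"
  proof (rule symmetric_bfam_eqI[OF bfam_bcomp[OF bfam_consts(1) F] F])
    fix N v w
    show "lsym N d d (F (of_nat N) \<odot>\<^bsub>of_nat N\<^esub> symz d)" by (rule lsym_bcomp[OF symz_in_bhom h lsym_simps(2)])
    show "rsym N d d (F (of_nat N) \<odot>\<^bsub>of_nat N\<^esub> symz d)" by (rule rsym_bcomp[OF symz_in_bhom h r])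
    have "push N d (F (of_nat N) \<odot>\<^bsub>of_nat N\<^esub> symz d) (vpow v) x = push N d (F (of_nat N)) (vpow v) x"
      if "x \<in> colourings N d" for x
      unfolding push_bcomp[OF symz_in_bhom h that] by (intro push_cong push_symz) auto
    then show "pairing N d d (F (of_nat N) \<odot>\<^bsub>of_nat N\<^esub> symz d) v w = pairing N d d (F (of_nat N)) v w"
      by (simp add: pairing_push)
  qed (rule l r)+
qed

lemma symz_idem: "symz d \<odot>\<^bsub>t\<^esub> symz d = symz d"
  by (rule symz_bcomp_eqI(1)[OF bfam_consts(1)]) (rule lsym_simps rsym_simps)+

lemma radial_symz: "symz d \<odot>\<^bsub>t\<^esub> radial t d r = radial t d r" "radial t d r \<odot>\<^bsub>t\<^esub> symz d = radial t d r"
  by (rule symz_bcomp_eqI[where F = "\<lambda>t. radial t d r", OF bfam_radial lsym_radial rsym_radial])+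

lemma radial_0: "radial t d 0 = symz d"
  by (rule symmetric_bfam_eqI[where F = "\<lambda>t. radial t d 0", OF bfam_radial bfam_consts(1) lsym_radial _ rsym_radial])
    (simp_all add: lsym_simps rsym_simps pairing_radial pairing_symz)

lemma lsym_rsym_act_term:
  assumes D: "D \<in> bhom 0 (d + d)" and "d \<le> q"
  shows "lsym N q q (act_term (of_nat N) d D q)" "rsym N q q (act_term (of_nat N) d D q)"
proof -
  let ?t = "of_nat N :: complex"
  have R: "btens 0 (d + d) D (symz q) \<in> bhom q (d + (d + q))"
    using btens_in_bhom[OF D symz_in_bhom[of q]] by (simp add: add.assoc)
  have Q: "btens d d (symz d) (contr ?t d q) \<in> bhom (d + (d + q)) (d + (q - d))"
    by (intro btens_in_bhom symz_in_bhom bfam_in_bhom[OF bfam_contr])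
  have M: "mult ?t d (q - d) \<in> bhom (d + (q - d)) (d + (q - d))"
    by (rule bfam_in_bhom[OF bfam_mult])
  have l: "lsym N q (d + (d + q)) (btens 0 (d + d) D (symz q))"
    using lsym_btens_0[OF D lsym_simps(2), of N q] by (simp add: add.assoc)
  have "lsym N q (d + (q - d)) (act_term ?t d D q)" "rsym N q (d + (q - d)) (act_term ?t d D q)"
    unfolding act_term_def
    by (rule lsym_bcomp[OF bcomp_in_bhom[OF R Q] M lsym_bcomp[OF R Q l]] rsym_bcomp[OF bcomp_in_bhom[OF R Q] M rsym_mult])+
  with assms(2) show "lsym N q q (act_term ?t d D q)" "rsym N q q (act_term ?t d D q)" by simp_all
qed

text \<open>The pairing of \<open>radial t d r\<close>, multiplied by a power of the scalar product
  of \<open>v\<close> and \<open>w\<close>, is that of \<open>radial t q r\<close> up to a constant.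
  The constant is found by choosing first \<open>d\<close> of \<open>q\<close> objects and then
  \<open>2 * r\<close> of these, or the \<open>2 * r\<close> objects first.\<close>

lemma act_elt_of_radial:
  "act t (elt_of_endo t d (radial t d r)) q =
    (if d \<le> q \<and> 2 * r \<le> d then bscale (of_nat ((q - 2 * r) choose (d - 2 * r))) (radial t q r) else 0)"
proof (cases "d \<le> q \<and> 2 * r \<le> d")
  case True
  let ?D = "\<lambda>t. elt_of_endo t d (radial t d r) d"
  have D: "bfam 0 (d + d) ?D" by (rule bfam_elt_of_endo[OF bfam_radial])
  have act: "act t (elt_of_endo t d (radial t d r)) q = act_term t d (?D t) q" for t
    using True by (subst act_single_degree[of d]) (auto simp: elt_of_endo_def)
  have "act_term t d (?D t) q = bscale (of_nat ((q - 2 * r) choose (d - 2 * r))) (radial t q r)"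
  proof (rule symmetric_bfam_eqI[where F = "\<lambda>t. act_term t d (?D t) q", OF bfam_act_term[OF D] bfam_bscale[OF _ bfam_radial]])
    fix N v w
    have ch: "of_nat (q choose d) * ffact (of_nat d) (2 * r) =
          of_nat ((q - 2 * r) choose (d - 2 * r)) * (ffact (of_nat q) (2 * r) :: complex)"
    proof -
      have "(q choose d) * (d choose (2 * r)) = (q choose (2 * r)) * ((q - 2 * r) choose (d - 2 * r))"
        using True by (intro choose_mult) auto
      then have A: "of_nat (q choose d) * of_nat (d choose (2 * r)) =
          of_nat (q choose (2 * r)) * (of_nat ((q - 2 * r) choose (d - 2 * r)) :: complex)"
        by (metis of_nat_mult)
      have B: "(ffact (of_nat n) (2 * r) :: complex) = fact (2 * r) * of_nat (n choose (2 * r))" for n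
        by (simp add: binomial_gbinomial gbinomial_prod_rev ffact_def atLeast0LessThan)
      show ?thesis using arg_cong[OF A, of "\<lambda>z. fact (2 * r) * z"] unfolding B by (simp only: mult_ac)
    qed
    have "pairing N q q (act_term (of_nat N) d (?D (of_nat N)) q) v w =
      of_nat (q choose d) * (\<Sum>c<N. v c * w c) ^ (q - d) * pairing N d d (radial (of_nat N) d r) v w"
      using True unfolding act[symmetric] by (intro pairing_act_endo) auto
    also have "\<dots> = pairing N q q (bscale (of_nat ((q - 2 * r) choose (d - 2 * r))) (radial (of_nat N) q r)) v w"
    proof -
      have "(\<Sum>c<N. v c * w c) ^ (q - d) * (\<Sum>c<N. v c * w c) ^ (d - 2 * r) = (\<Sum>c<N. v c * w c) ^ (q - 2 * r)"
        using True by (simp flip: power_add)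
      moreover have "A * B * (C * (P * D)) = E * (F * (P * G))" if "B * D = G" "A * C = E * F"
        for A B C D E F G P :: complex
      proof -
        have "A * B * (C * (P * D)) = (A * C) * (P * (B * D))" by (simp only: mult_ac)
        then show ?thesis unfolding that by (simp only: mult_ac)
      qed
      ultimately show ?thesis unfolding pairing_simps pairing_radial using ch by blast
    qed
    finally show "pairing N q q (act_term (of_nat N) d (?D (of_nat N)) q) v w =
      pairing N q q (bscale (of_nat ((q - 2 * r) choose (d - 2 * r))) (radial (of_nat N) q r)) v w" .
  qed (use True bfam_in_bhom[OF D] in \<open>auto intro: lsym_rsym_act_term lsym_simps rsym_simps lsym_radial rsym_radial\<close>)
  with True act show ?thesis by simp
next
  case False
  have zero: "elt_of_endo t d 0 = (\<lambda>_. 0)" by (auto simp: elt_of_endo_def)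
  show ?thesis
  proof (cases "2 * r \<le> d")
    case True
    with False show ?thesis by (subst act_single_degree[of d]) (auto simp: elt_of_endo_def)
  next
    case False
    then show ?thesis by (subst act_single_degree[of d]) (auto simp: radial_def zero act_term_def)
  qed
qed

lemma act_E_elt: "act t E_elt d = bscale (of_nat d) (symz d)"
proof (cases "d = 0")
  case True
  then show ?thesis by (subst act_single_degree[of 1]) (auto simp: E_elt_def)
next
  case False
  then have d: "1 \<le> d" by simp
  have D: "bfam 0 (1 + 1) (\<lambda>t. bcup)" by (rule bfam_consts(4))
  have act: "act t E_elt d = act_term t 1 bcup d"
    using d by (subst act_single_degree[of 1]) (auto simp: E_elt_def)
  show ?thesis unfolding act
  proof (rule symmetric_bfam_eqI[where F = "\<lambda>t. act_term t 1 bcup d", OF bfam_act_term[OF D d] bfam_bscale[OF _ bfam_consts(1)]])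
    fix N v w
    have "(\<Sum>x\<in>colourings N 1. \<Sum>y\<in>colourings N 1. mat bcup [] (x @ y) * vpow w x * vpow v y) =
          (\<Sum>c<N. \<Sum>c'<N. if c = c' then w c * v c' else 0)"
      unfolding sum_colourings_1 by (intro sum.cong refl) (simp add: mat_bcup del: One_nat_def)
    also have "\<dots> = (\<Sum>c<N. v c * w c)" by (simp add: mult.commute)
    finally have "pairing N d d (act_term (of_nat N) 1 bcup d) v w = of_nat d * ((\<Sum>c<N. v c * w c) ^ (d - 1) * (\<Sum>c<N. v c * w c))"
      by (simp add: pairing_act_term[OF bfam_in_bhom[OF D] d] ffact_def del: One_nat_def)
    also have "(\<Sum>c<N. v c * w c) ^ (d - 1) * (\<Sum>c<N. v c * w c) = (\<Sum>c<N. v c * w c) ^ d"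
      using d by (intro power_minus_mult) simp
    finally show "pairing N d d (act_term (of_nat N) 1 bcup d) v w = pairing N d d (bscale (of_nat d) (symz d)) v w"
      by (simp add: pairing_simps pairing_symz)
  qed (use d bfam_in_bhom[OF D] in \<open>auto intro: lsym_rsym_act_term lsym_simps rsym_simps\<close>)
qed

section \<open>The operators Theta and Delta\<close>

lemma bfam_symz_bcup: "bfam 0 2 (\<lambda>t. symz 2 \<odot>\<^bsub>t\<^esub> bcup)"
  by (rule bfam_bcomp[OF bfam_const[OF bcup_in_bhom] bfam_consts(1)])

lemma bfam_Theta: "bfam d (2 + d) (\<lambda>t. Theta t d)"
proof -
  have "bfam (0 + d) (2 + d) (\<lambda>t. btens 0 2 (symz 2 \<odot>\<^bsub>t\<^esub> bcup) (symz d))"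
    by (intro bfam_btens bfam_symz_bcup bfam_consts)
  from bfam_bscale[OF _ bfam_bcomp[OF this bfam_mult], of "\<lambda>_. 1 / 2"]
  show ?thesis unfolding Theta_def by simp
qed

lemma bfam_Delta: "bfam d (d - 2) (\<lambda>t. Delta t d)"
proof -
  have "bfam (0 + d) (2 + d) (\<lambda>t. btens 0 2 (symz 2 \<odot>\<^bsub>t\<^esub> bcup) (symz d))"
    by (intro bfam_btens bfam_symz_bcup bfam_consts)
  from bfam_bscale[OF _ bfam_bcomp[OF this bfam_contr], of "\<lambda>_. 1 / 2"]
  show ?thesis unfolding Delta_def by simp
qed

lemma contr_eq_0: "q < p \<Longrightarrow> contr t p q = 0"
proof -
  have "contr_tensor t p q = 0" if "q < p" for p
    using that
  proof (induction p)
    case (Suc p)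
    then show ?case by (cases "q < p") (simp_all add: derivation_def)
  qed simp
  then show "q < p \<Longrightarrow> contr t p q = 0" by (simp add: contr_def)
qed

lemma push_Delta:
  assumes z: "z \<in> colourings N (d - 2)"
  shows "push N d (Delta (of_nat N) d) (vpow v) z = ffact (of_nat d) 2 / 2 * (\<Sum>c<N. v c ^ 2) * vpow v z"
proof -
  let ?t = "of_nat N :: complex"
  let ?c = "symz 2 \<odot>\<^bsub>?t\<^esub> bcup"
  have c: "?c \<in> bhom 0 2" by (rule bfam_in_bhom[OF bfam_symz_bcup])
  have R: "btens 0 2 ?c (symz d) \<in> bhom d (2 + d)" using btens_in_bhom[OF c symz_in_bhom[of d]] by simp
  have "push N d (btens 0 2 ?c (symz d)) (vpow v) (y @ x) = mat ?c [] y * vpow v x"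
    if "y \<in> colourings N 2" "x \<in> colourings N d" for y x
    using push_btens_mult[OF c that(1), where m' = d and f = "vpow v" and g = "\<lambda>_. 1" and h = "vpow v" and G = "symz d" and z' = x] that
    by (simp add: push_symz push_def[of N 0])
  then have "push N (2 + d) (contr ?t 2 d) (push N d (btens 0 2 ?c (symz d)) (vpow v)) z =
        ffact (of_nat d) 2 * (\<Sum>y\<in>colourings N 2. mat ?c [] y * vpow v y) * vpow v z"
    using z by (intro push_contr)
  also have "(\<Sum>y\<in>colourings N 2. mat ?c [] y * vpow v y) = pull N 2 bcup (pull N 2 (symz 2) (vpow v)) []"
    using pull_bcomp[OF bcup_in_bhom symz_in_bhom, of "[]" N "vpow v"] by (simp add: pull_def[of N 2 "_ \<odot>\<^bsub>_\<^esub> _"] del: One_nat_def)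
  also have "\<dots> = (\<Sum>c<N. v c ^ 2)"
    unfolding pull_bcup[symmetric] by (intro pull_cong pull_symz) auto
  finally have "push N d (contr ?t 2 d \<odot>\<^bsub>?t\<^esub> btens 0 2 ?c (symz d)) (vpow v) z =
        ffact (of_nat d) 2 * (\<Sum>c<N. v c ^ 2) * vpow v z"
    using push_bcomp[OF R bfam_in_bhom[OF bfam_contr] z] by simp
  then show ?thesis
    by (simp add: Delta_def push_def sum_distrib_left mult_ac flip: sum_divide_distrib)
qed

lemma pull_bscale: "pull N n (bscale c F) f x = c * pull N n F f x"
  by (simp add: pull_def sum_distrib_left mult_ac)

lemma pull_Theta:
  assumes x: "x \<in> colourings N d"
  shows "pull N (2 + d) (Theta (of_nat N) d) (vpow w) x = (\<Sum>c<N. w c ^ 2) / 2 * vpow w x"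
proof -
  let ?t = "of_nat N :: complex"
  let ?c = "symz 2 \<odot>\<^bsub>?t\<^esub> bcup"
  have c: "?c \<in> bhom 0 2" by (rule bfam_in_bhom[OF bfam_symz_bcup])
  have R: "btens 0 2 ?c (symz d) \<in> bhom d (2 + d)" using btens_in_bhom[OF c symz_in_bhom[of d]] by simp
  have "pull N (2 + d) (mult ?t 2 d \<odot>\<^bsub>?t\<^esub> btens 0 2 ?c (symz d)) (vpow w) x =
        pull N (2 + d) (btens 0 2 ?c (symz d)) (pull N (2 + d) (mult ?t 2 d) (vpow w)) x"
    by (rule pull_bcomp[OF R bfam_in_bhom[OF bfam_mult] x])
  also have "\<dots> = pull N (2 + d) (btens 0 2 ?c (symz d)) (vpow w) ([] @ x)"
    unfolding append_Nil by (intro pull_cong pull_mult_vpow)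
  also have "\<dots> = pull N 2 ?c (vpow w) [] * pull N d (symz d) (vpow w) x"
    by (rule pull_btens_mult[OF c]) auto
  also have "pull N 2 ?c (vpow w) [] = pull N 2 bcup (pull N 2 (symz 2) (vpow w)) []"
    by (rule pull_bcomp[OF bcup_in_bhom symz_in_bhom]) simp
  also have "\<dots> = (\<Sum>c<N. w c ^ 2)"
    unfolding pull_bcup[symmetric] by (intro pull_cong pull_symz) auto
  finally show ?thesis
    using x unfolding Theta_def pull_bscale by (simp add: pull_symz)
qed

text \<open>On pure powers \<open>Delta\<close> contributes half the square of \<open>v\<close>
  times \<open>d * (d - 1)\<close>, and the adjoint of \<open>Theta\<close> half the square of
  \<open>w\<close>. The two halves make up the factor 1/4.\<close>

lemma Theta_Delta: "Theta t (d - 2) \<odot>\<^bsub>t\<^esub> Delta t d = bscale (1 / 4) (radial t d 1)"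
proof (cases "2 \<le> d")
  case False
  then show ?thesis by (simp add: Delta_def contr_eq_0 radial_def)
next
  case True
  have \<Theta>: "bfam (d - 2) d (\<lambda>t. Theta t (d - 2))"
    by (rule bfam_cong[OF bfam_Theta]) (use True in auto)
  note \<Delta> = bfam_Delta[of d]
  show ?thesis
  proof (rule symmetric_bfam_eqI[where F = "\<lambda>t. Theta t (d - 2) \<odot>\<^bsub>t\<^esub> Delta t d", OF bfam_bcomp[OF \<Delta> \<Theta>] bfam_bscale[OF _ bfam_radial]])
    fix N v w
    let ?t = "of_nat N :: complex"
    have c: "symz 2 \<odot>\<^bsub>?t\<^esub> bcup \<in> bhom 0 2" by (rule bfam_in_bhom[OF bfam_symz_bcup])
    note [simp] = bfam_in_bhom[OF \<Delta>, of ?t] bfam_in_bhom[OF \<Theta>, of ?t]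
    show "lsym N d d (Theta ?t (d - 2) \<odot>\<^bsub>?t\<^esub> Delta ?t d)"
    proof (rule lsym_bcomp[of _ _ "d - 2"])
      have R: "btens 0 2 (symz 2 \<odot>\<^bsub>?t\<^esub> bcup) (symz d) \<in> bhom d (2 + d)"
        using btens_in_bhom[OF c symz_in_bhom[of d]] by simp
      show "lsym N d (d - 2) (Delta ?t d)" unfolding Delta_def
        by (intro lsym_simps lsym_bcomp[OF R bfam_in_bhom[OF bfam_contr]] lsym_btens_0[OF c])
    qed simp_all
    show "rsym N d d (Theta ?t (d - 2) \<odot>\<^bsub>?t\<^esub> Delta ?t d)"
    proof (rule rsym_bcomp[of _ _ "d - 2"])
      have R: "btens 0 2 (symz 2 \<odot>\<^bsub>?t\<^esub> bcup) (symz (d - 2)) \<in> bhom (d - 2) (2 + (d - 2))"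
        using btens_in_bhom[OF c symz_in_bhom[of "d - 2"]] by simp
      have "rsym N (d - 2) (2 + (d - 2)) (Theta ?t (d - 2))" unfolding Theta_def
        by (intro rsym_simps rsym_bcomp[OF R bfam_in_bhom[OF bfam_mult]] rsym_mult)
      moreover have "2 + (d - 2) = d" using True by simp
      ultimately show "rsym N (d - 2) d (Theta ?t (d - 2))" by (simp only:)
    qed simp_all
    have "pairing N d d (Theta ?t (d - 2) \<odot>\<^bsub>?t\<^esub> Delta ?t d) v w =
          (\<Sum>y\<in>colourings N d. push N (d - 2) (Theta ?t (d - 2)) (push N d (Delta ?t d) (vpow v)) y * vpow w y)"
      unfolding pairing_push by (intro sum.cong refl) (simp add: push_bcomp[OF bfam_in_bhom[OF \<Delta>] bfam_in_bhom[OF \<Theta>]])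
    also have "\<dots> = (\<Sum>z\<in>colourings N (d - 2). push N d (Delta ?t d) (vpow v) z * pull N d (Theta ?t (d - 2)) (vpow w) z)"
      by (rule sum_push_pull)
    also have "\<dots> = (\<Sum>z\<in>colourings N (d - 2). ffact (of_nat d) 2 / 4 * (\<Sum>c<N. v c ^ 2) * (\<Sum>c<N. w c ^ 2) * (vpow v z * vpow w z))"
    proof (intro sum.cong refl)
      fix z assume z: "z \<in> colourings N (d - 2)"
      have "2 + (d - 2) = d" using True by simp
      note pull = pull_Theta[OF z, of w, unfolded this]
      show "push N d (Delta ?t d) (vpow v) z * pull N d (Theta ?t (d - 2)) (vpow w) z =
        ffact (of_nat d) 2 / 4 * (\<Sum>c<N. v c ^ 2) * (\<Sum>c<N. w c ^ 2) * (vpow v z * vpow w z)"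
        unfolding pull push_Delta[OF z] by simp
    qed
    also have "\<dots> = ffact (of_nat d) 2 / 4 * (\<Sum>c<N. v c ^ 2) * (\<Sum>c<N. w c ^ 2) * (\<Sum>c<N. v c * w c) ^ (d - 2)"
      by (simp only: sum_vpow_mult sum_distrib_left[symmetric])
    finally show "pairing N d d (Theta ?t (d - 2) \<odot>\<^bsub>?t\<^esub> Delta ?t d) v w = pairing N d d (bscale (1 / 4) (radial ?t d 1)) v w"
      by (simp add: pairing_simps pairing_radial)
  qed (auto intro: lsym_simps rsym_simps lsym_radial rsym_radial)
qed

text \<open>Subtraction takes place in the complex numbers, so that identities between nodes hold
  for all \<open>i\<close>, also beyond \<open>d div 2\<close>.\<close>

definition node :: "complex \<Rightarrow> nat \<Rightarrow> nat \<Rightarrow> complex" where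
  "node t d i = (of_nat d - 2 * of_nat i) * (of_nat d - 2 * of_nat i + t - 2)"

text \<open>The Euler operator is the scalar \<open>d\<close> in degree \<open>d\<close>, so the
  terms without \<open>Theta\<close> and \<open>Delta\<close> add up to
  \<open>d * (d + t - 2)\<close>, the node of index 0.\<close>

lemma casimir_eq: "casimir t d = bscale (node t d 0) (symz d) - radial t d 1"
proof -
  have "node t d 0 = of_nat d * of_nat d + t * of_nat d - 2 * of_nat d"
    by (simp add: node_def algebra_simps)
  then show ?thesis
    unfolding casimir_def act_E_elt Theta_Delta
    by (simp add: bcomp_bscale_left bcomp_bscale_right symz_idem bscale_add_left bscale_diff_left)
qed

lemma symfun_push: "rsym N m n F \<Longrightarrow> symfun N n (push N m F f)"
  unfolding push_def[abs_def] rsym_def by (intro symfun_simps) blast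

text \<open>Up to the factor (n + 2) (n + 1), contracting two arguments of a symmetric form is the
  Laplacian in \<open>w\<close> of its diagonal values, here of \<open>K * q ^ r * u ^ e\<close>.
  The identity is multiplied by \<open>q\<close> because the Laplacian itself contains
  \<open>q ^ (r - 1)\<close>.\<close>

lemma contract_two_arguments:
  fixes v w :: "nat \<Rightarrow> complex"
  assumes A: "symfun N (Suc (Suc n)) A"
    and form: "\<And>w. (\<Sum>y\<in>colourings N (Suc (Suc n)). A y * vpow w y) =
        K * (\<Sum>c<N. w c ^ 2) ^ r * (\<Sum>c<N. v c * w c) ^ e"
  defines "p \<equiv> \<Sum>c<N. v c ^ 2" and "q \<equiv> \<Sum>c<N. w c ^ 2" and "u \<equiv> \<Sum>c<N. v c * w c"
  shows "of_nat (Suc (Suc n)) * of_nat (Suc n) * (\<Sum>c<N. \<Sum>y\<in>colourings N n. A (c # c # y) * vpow w y) * q =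
    K * (of_nat (2 * r) * (of_nat N + 2 * of_nat e + 2 * of_nat r - 2) * (q ^ r * u ^ e) +
         of_nat e * (of_nat e - 1) * p * (q ^ Suc r * u ^ (e - 2)))"
proof -
  \<comment> \<open>The second derivative at 0 in the direction of the basis vector
    \<open>c\<close>, computed once from the form and once from the formula for its diagonal
    values.\<close>
  have key: "of_nat (Suc (Suc n)) * of_nat (Suc n) * (\<Sum>y\<in>colourings N n. A (c # c # y) * vpow w y) =
      K * (of_nat (2 * r) * (q ^ (r - 1) * u ^ e) + of_nat (4 * r) * (of_nat r - 1) * w c ^ 2 * (q ^ (r - 2) * u ^ e) +
           of_nat (4 * r * e) * (v c * w c) * (q ^ (r - 1) * u ^ (e - 1)) +
           of_nat e * (of_nat e - 1) * v c ^ 2 * (q ^ r * u ^ (e - 2)))"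
    if c: "c < N" for c
  proof -
    let ?e = "\<lambda>i. of_bool (i = c) :: complex"
    have pick: "(\<Sum>i<N. ?e i * f i) = f c" for f :: "nat \<Rightarrow> complex"
    proof -
      have "(\<Sum>i<N. ?e i * f i) = (\<Sum>i<N. if i = c then f i else 0)" by (intro sum.cong) auto
      then show ?thesis using c by simp
    qed
    define Q where "Q = (\<lambda>\<epsilon>. q + 2 * \<epsilon> * w c + \<epsilon> ^ 2)"
    define U where "U = (\<lambda>\<epsilon>. u + \<epsilon> * v c)"
    have QU: "(\<Sum>i<N. (w i + \<epsilon> * ?e i) ^ 2) = Q \<epsilon>" "(\<Sum>i<N. v i * (w i + \<epsilon> * ?e i)) = U \<epsilon>" for \<epsilon>
    proof -
      have "(\<Sum>i<N. (w i + \<epsilon> * ?e i) ^ 2) = (\<Sum>i<N. w i ^ 2) + (\<Sum>i<N. ?e i * (2 * \<epsilon> * w i + \<epsilon> ^ 2))"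
        unfolding sum.distrib[symmetric] by (intro sum.cong) (auto simp: power2_eq_square algebra_simps)
      then show "(\<Sum>i<N. (w i + \<epsilon> * ?e i) ^ 2) = Q \<epsilon>" unfolding pick by (simp add: Q_def q_def)
      have "(\<Sum>i<N. v i * (w i + \<epsilon> * ?e i)) = (\<Sum>i<N. v i * w i) + (\<Sum>i<N. ?e i * (\<epsilon> * v i))"
        unfolding sum.distrib[symmetric] by (intro sum.cong) (auto simp: algebra_simps)
      then show "(\<Sum>i<N. v i * (w i + \<epsilon> * ?e i)) = U \<epsilon>" unfolding pick by (simp add: U_def u_def)
    qed
    define A1 where "A1 = (\<lambda>\<epsilon>. of_nat (Suc (Suc n)) * (\<Sum>x\<in>colourings N (Suc n). A (c # x) * vpow (\<lambda>i. w i + \<epsilon> * ?e i) x))"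
    define B1 where "B1 = (\<lambda>\<epsilon>. K * (of_nat r * (2 * w c + 2 * \<epsilon>) * Q \<epsilon> ^ (r - 1) * U \<epsilon> ^ e +
        of_nat e * v c * Q \<epsilon> ^ r * U \<epsilon> ^ (e - 1)))"
    have "((\<lambda>\<epsilon>. K * Q \<epsilon> ^ r * U \<epsilon> ^ e) has_field_derivative A1 \<epsilon>) (at \<epsilon>)" for \<epsilon>
      using symmetric_form_has_field_derivative[OF A, of w ?e \<epsilon>] unfolding form QU pick A1_def .
    moreover have "((\<lambda>\<epsilon>. K * Q \<epsilon> ^ r * U \<epsilon> ^ e) has_field_derivative B1 \<epsilon>) (at \<epsilon>)" for \<epsilon>
      unfolding Q_def U_def B1_def by (auto intro!: derivative_eq_intros simp: algebra_simps)
    ultimately have AB: "A1 = B1" by (auto intro: DERIV_unique)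
    have "(A1 has_field_derivative of_nat (Suc (Suc n)) * (of_nat (Suc n) *
        (\<Sum>y\<in>colourings N n. A (c # c # y) * vpow (\<lambda>i. w i + 0 * ?e i) y))) (at 0)"
      unfolding A1_def
      using symmetric_form_has_field_derivative[OF symfun_Cons[OF A c], of w ?e 0] unfolding pick
      by (rule DERIV_cmult)
    moreover have "(B1 has_field_derivative
      K * (of_nat (2 * r) * (q ^ (r - 1) * u ^ e) + of_nat (4 * r) * of_nat (r - 1) * w c ^ 2 * (q ^ (r - 2) * u ^ e) +
           of_nat (4 * r * e) * (v c * w c) * (q ^ (r - 1) * u ^ (e - 1)) +
           of_nat e * of_nat (e - 1) * v c ^ 2 * (q ^ r * u ^ (e - 2)))) (at 0)"
      unfolding B1_def Q_def U_def
      by (auto intro!: derivative_eq_intros simp: algebra_simps power2_eq_square numeral_2_eq_2)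
    ultimately have "of_nat (Suc (Suc n)) * (of_nat (Suc n) *
        (\<Sum>y\<in>colourings N n. A (c # c # y) * vpow (\<lambda>i. w i + 0 * ?e i) y)) =
      K * (of_nat (2 * r) * (q ^ (r - 1) * u ^ e) + of_nat (4 * r) * of_nat (r - 1) * w c ^ 2 * (q ^ (r - 2) * u ^ e) +
           of_nat (4 * r * e) * (v c * w c) * (q ^ (r - 1) * u ^ (e - 1)) +
           of_nat e * of_nat (e - 1) * v c ^ 2 * (q ^ r * u ^ (e - 2)))"
      unfolding AB by (rule DERIV_unique)
    moreover have m1: "of_nat (4 * r) * of_nat (r - 1) = (of_nat (4 * r) * (of_nat r - 1) :: complex)"
      by (cases r) auto
    moreover have m2: "of_nat e * of_nat (e - 1) = (of_nat e * (of_nat e - 1) :: complex)"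
      by (cases e) auto
    ultimately show ?thesis unfolding m1 m2 by (simp add: mult.assoc)
  qed
  \<comment> \<open>The truncated exponents occur only with coefficients that vanish where the
    truncation takes effect, so multiplying by \<open>q\<close> or \<open>u\<close> restores the
    full powers.\<close>
  have r: "of_nat r * q ^ (r - 1) * q = of_nat r * q ^ r"
    by (cases r) auto
  have r2: "of_nat r * (of_nat r - 1) * q * q ^ (r - 2) * q = of_nat r * (of_nat r - 1) * q ^ r"
  proof (cases "r < 2")
    case False
    then obtain k where "r = Suc (Suc k)" by (metis add_2_eq_Suc le_Suc_ex linorder_not_less)
    then show ?thesis by simp
  qed (auto simp: less_2_cases_iff)
  have e: "of_nat e * u * u ^ (e - 1) = of_nat e * u ^ e"
    by (cases e) auto
  have "of_nat (Suc (Suc n)) * of_nat (Suc n) * (\<Sum>c<N. \<Sum>y\<in>colourings N n. A (c # c # y) * vpow w y) =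
    (\<Sum>c<N. K * (of_nat (2 * r) * (q ^ (r - 1) * u ^ e) + of_nat (4 * r) * (of_nat r - 1) * w c ^ 2 * (q ^ (r - 2) * u ^ e) +
           of_nat (4 * r * e) * (v c * w c) * (q ^ (r - 1) * u ^ (e - 1)) +
           of_nat e * (of_nat e - 1) * v c ^ 2 * (q ^ r * u ^ (e - 2))))"
    unfolding sum_distrib_left[of _ _ "{..<N}"] by (intro sum.cong refl key) simp
  also have "\<dots> = K * (of_nat N * (of_nat (2 * r) * (q ^ (r - 1) * u ^ e)) + of_nat (4 * r) * (of_nat r - 1) * q * (q ^ (r - 2) * u ^ e) +
           of_nat (4 * r * e) * u * (q ^ (r - 1) * u ^ (e - 1)) +
           of_nat e * (of_nat e - 1) * p * (q ^ r * u ^ (e - 2)))"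
    unfolding p_def q_def u_def sum_distrib_left[of K, symmetric] sum.distrib
    by (simp add: sum_distrib_left sum_distrib_right)
  finally have "of_nat (Suc (Suc n)) * of_nat (Suc n) * (\<Sum>c<N. \<Sum>y\<in>colourings N n. A (c # c # y) * vpow w y) * q =
     K * (of_nat N * (of_nat (2 * r) * (q ^ (r - 1) * u ^ e)) + of_nat (4 * r) * (of_nat r - 1) * q * (q ^ (r - 2) * u ^ e) +
           of_nat (4 * r * e) * u * (q ^ (r - 1) * u ^ (e - 1)) +
           of_nat e * (of_nat e - 1) * p * (q ^ r * u ^ (e - 2))) * q"
    by (rule arg_cong)
  also have "\<dots> =
     K * (2 * of_nat N * (of_nat r * q ^ (r - 1) * q) * u ^ e + 4 * (of_nat r * (of_nat r - 1) * q * q ^ (r - 2) * q) * u ^ e +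
           4 * (of_nat r * q ^ (r - 1) * q) * (of_nat e * u * u ^ (e - 1)) +
           of_nat e * (of_nat e - 1) * p * (q ^ Suc r * u ^ (e - 2)))"
    by (simp add: algebra_simps)
  also have "\<dots> = K * (of_nat (2 * r) * (of_nat N + 2 * of_nat e + 2 * of_nat r - 2) * (q ^ r * u ^ e) +
         of_nat e * (of_nat e - 1) * p * (q ^ Suc r * u ^ (e - 2)))"
    unfolding r r2 e by (simp add: algebra_simps)
  finally show ?thesis .
qed

text \<open>This is the relation that moves \<open>Delta\<close> past a power of
  \<open>Theta\<close>. In terms of pairings, \<open>radial t d 1\<close> contracts two arguments of
  the symmetric form obtained from \<open>radial t d r\<close> and \<open>v\<close> and multiplies
  by the square of \<open>w\<close>, so \<open>contract_two_arguments\<close> applies.\<close>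

lemma radial_1_mult_radial:
  assumes "2 * r \<le> d"
  shows "radial t d 1 \<odot>\<^bsub>t\<^esub> radial t d r =
    radial t d (Suc r) + bscale (of_nat (2 * r) * (of_nat (2 * d) - of_nat (2 * r) + t - 2)) (radial t d r)"
proof (cases "2 \<le> d")
  case False
  with assms have "r = 0" by auto
  with False show ?thesis by (simp add: radial_def)
next
  case True
  then obtain n where d: "d = Suc (Suc n)" by (metis add_2_eq_Suc le_Suc_ex)
  let ?c = "\<lambda>t. of_nat (2 * r) * (of_nat (2 * d) - of_nat (2 * r) + t - 2) :: complex"
  show ?thesis
  proof (rule symmetric_bfam_eqI[where F = "\<lambda>t. radial t d 1 \<odot>\<^bsub>t\<^esub> radial t d r"
        and G = "\<lambda>t. radial t d (Suc r) + bscale (?c t) (radial t d r)", OF bfam_bcomp[OF bfam_radial bfam_radial]])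
    show "bfam d d (\<lambda>t. radial t d (Suc r) + bscale (?c t) (radial t d r))"
      by (intro bfam_add bfam_bscale bfam_radial) simp
    fix N and v w :: "nat \<Rightarrow> complex"
    let ?t = "of_nat N :: complex"
    show "lsym N d d (radial ?t d 1 \<odot>\<^bsub>?t\<^esub> radial ?t d r)"
      by (rule lsym_bcomp[OF radial_in_bhom radial_in_bhom lsym_radial])
    show "rsym N d d (radial ?t d 1 \<odot>\<^bsub>?t\<^esub> radial ?t d r)"
      by (rule rsym_bcomp[OF radial_in_bhom radial_in_bhom rsym_radial])
    show "lsym N d d (radial ?t d (Suc r) + bscale (?c ?t) (radial ?t d r))"
      "rsym N d d (radial ?t d (Suc r) + bscale (?c ?t) (radial ?t d r))"
      by (intro lsym_simps rsym_simps lsym_radial rsym_radial)+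
    define A where "A = push N d (radial ?t d r) (vpow v)"
    have A: "symfun N d A" unfolding A_def by (rule symfun_push[OF rsym_radial])
    define p where "p = (\<Sum>c<N. v c ^ 2)"
    define q where "q = (\<Sum>c<N. w c ^ 2)"
    define u where "u = (\<Sum>c<N. v c * w c)"
    define e where "e = d - 2 * r"
    have de: "of_nat d = (2 * of_nat r + of_nat e :: complex)"
      unfolding e_def using assms by (simp add: of_nat_diff)
    define K where "K = ffact (of_nat d) (2 * r) * p ^ r"
    have form: "(\<Sum>y\<in>colourings N d. A y * vpow w y) = K * (\<Sum>c<N. w c ^ 2) ^ r * (\<Sum>c<N. v c * w c) ^ e" for w
      using pairing_radial[of N d r v w] unfolding pairing_push A_def K_def p_def e_def by simp
    define g where "g = pull N d (cupcaps 1 n) (vpow w)"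
    have g: "g ([a, b] @ y) = of_bool (a = b) * q * vpow w y" if "a < N" "b < N" "y \<in> colourings N n" for a b y
    proof -
      have ab: "[a, b] \<in> colourings N 2" using that by (simp add: numeral_2_eq_2)
      have "g ([a, b] @ y) = pull N 2 (btens 2 0 bcap bcup) (vpow w) [a, b] * pull N n (bid n) (vpow w) y"
      proof -
        have "cupcaps 1 n = btens 2 2 (btens 2 0 bcap bcup) (bid n)" by simp
        moreover have "d = 2 + n" using d by simp
        ultimately show ?thesis unfolding g_def by (simp only:) (rule pull_btens_mult[OF cupcap_in_bhom ab], rule vpow_simps)
      qed
      also have "pull N 2 (btens 2 0 bcap bcup) (vpow w) [a, b] = pull N 2 (btens 2 0 bcap bcup) (vpow w) ([a, b] @ [])"
        by simp
      also have "pull N 2 (btens 2 0 bcap bcup) (vpow w) ([a, b] @ []) = pull N 0 bcap (\<lambda>_. 1) [a, b] * pull N 2 bcup (vpow w) []"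
      proof -
        have "pull N (0 + 2) (btens 2 0 bcap bcup) (vpow w) ([a, b] @ []) =
            pull N 0 bcap (\<lambda>_. 1) [a, b] * pull N 2 bcup (vpow w) []"
          by (rule pull_btens_mult[OF bcap_in_bhom ab]) auto
        then show ?thesis by (simp only: add_0)
      qed
      also have "pull N 0 bcap (\<lambda>_. 1) [a, b] = of_bool (a = b)"
        by (simp add: pull_def mat_bcap)
      also have "pull N n (bid n) (vpow w) y = vpow w y"
      proof -
        have "pull N n (bid n) (vpow w) y = (\<Sum>x\<in>colourings N n. if x = y then vpow w x else 0)"
          unfolding pull_def using that by (intro sum.cong) (auto simp: mat_bid)
        then show ?thesis using that by simp
      qed
      finally show ?thesis by (simp add: pull_bcup q_def del: One_nat_def)
    qed
    have X: "cupcaps 1 n \<in> bhom d d" using cupcaps_in_bhom[of 1 n] d by simp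
    have radial_1: "radial ?t d 1 = bscale (of_nat (Suc (Suc n)) * of_nat (Suc n))
        (symz d \<odot>\<^bsub>?t\<^esub> (cupcaps 1 n \<odot>\<^bsub>?t\<^esub> symz d))"
      unfolding radial_def using d by (simp add: ffact_def numeral_2_eq_2)
    have "pairing N d d (radial ?t d 1 \<odot>\<^bsub>?t\<^esub> radial ?t d r) v w =
       (\<Sum>y\<in>colourings N d. push N d (radial ?t d 1) A y * vpow w y)"
      unfolding pairing_push A_def by (intro sum.cong refl) (simp only: push_bcomp[OF radial_in_bhom radial_in_bhom])
    also have "\<dots> = (\<Sum>y\<in>colourings N d. A y * pull N d (radial ?t d 1) (vpow w) y)"
      by (rule sum_push_pull)
    also have "\<dots> = of_nat (Suc (Suc n)) * of_nat (Suc n) * (\<Sum>y\<in>colourings N d. A y * pull N d (symz d) g y)"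
      unfolding radial_1 pull_bscale sum_distrib_left g_def
      by (intro sum.cong refl) (simp only: pull_symmetrized[OF X] mult_ac)
    also have "(\<Sum>y\<in>colourings N d. A y * pull N d (symz d) g y) = (\<Sum>y\<in>colourings N d. A y * g y)"
      unfolding sum_push_pull[symmetric] by (intro sum.cong refl) (simp add: push_symz A)
    also have "\<dots> = (\<Sum>a<N. \<Sum>b<N. \<Sum>y\<in>colourings N n. A (a # b # y) * g ([a, b] @ y))"
      by (simp add: d sum_colourings_Suc)
    also have "\<dots> = (\<Sum>a<N. \<Sum>b<N. if a = b then (\<Sum>y\<in>colourings N n. A (a # b # y) * vpow w y) * q else 0)"
    proof (intro sum.cong refl)
      fix a b assume ab: "a \<in> {..<N}" "b \<in> {..<N}"
      have "(\<Sum>y\<in>colourings N n. A (a # b # y) * g ([a, b] @ y)) =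
            (\<Sum>y\<in>colourings N n. (A (a # b # y) * vpow w y) * (of_bool (a = b) * q))"
        using ab by (intro sum.cong refl) (simp only: g lessThan_iff mult_ac)
      then show "(\<Sum>y\<in>colourings N n. A (a # b # y) * g ([a, b] @ y)) =
            (if a = b then (\<Sum>y\<in>colourings N n. A (a # b # y) * vpow w y) * q else 0)"
        unfolding sum_distrib_right[symmetric] by (simp only: of_bool_def) simp
    qed
    also have "\<dots> = (\<Sum>c<N. \<Sum>y\<in>colourings N n. A (c # c # y) * vpow w y) * q"
      by (simp add: sum_distrib_right)
    also have "of_nat (Suc (Suc n)) * of_nat (Suc n) * \<dots> =
        K * (of_nat (2 * r) * (of_nat N + 2 * of_nat e + 2 * of_nat r - 2) * (q ^ r * u ^ e) +
         of_nat e * (of_nat e - 1) * p * (q ^ Suc r * u ^ (e - 2)))"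
      using contract_two_arguments[of N n A K r v e w] A form unfolding d p_def q_def u_def by (simp add: mult.assoc)
    also have "\<dots> = pairing N d d (radial ?t d (Suc r) + bscale (?c ?t) (radial ?t d r)) v w"
    proof -
      have f: "ffact (of_nat d) (2 * Suc r) = ffact (of_nat d) (2 * r) * (of_nat e * (of_nat e - 1) :: complex)"
        by (simp add: ffact_Suc de)
      have ex: "d - 2 * Suc r = e - 2" "d - 2 * r = e" by (simp_all add: e_def)
      have c: "?c ?t = of_nat (2 * r) * (of_nat N + 2 * of_nat e + 2 * of_nat r - 2)"
        by (simp add: de algebra_simps)
      show ?thesis
        unfolding pairing_simps pairing_radial f ex c K_def p_def[symmetric] q_def[symmetric] u_def[symmetric]
        by (simp only: power_Suc) (simp add: algebra_simps)
    qed
    finally show "pairing N d d (radial ?t d 1 \<odot>\<^bsub>?t\<^esub> radial ?t d r) v w =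
      pairing N d d (radial ?t d (Suc r) + bscale (?c ?t) (radial ?t d r)) v w" .
  qed
qed

text \<open>The scalar in \<open>radial_1_mult_radial\<close> equals
  \<open>node t d 0 - node t d r\<close>, so subtracting the Casimir operator from the node of index
  \<open>r\<close> removes the multiple of \<open>radial t d r\<close>.\<close>

lemma casimir_mult_radial:
  "bscale (node t d r) (radial t d r) - casimir t d \<odot>\<^bsub>t\<^esub> radial t d r = radial t d (Suc r)"
proof (cases "2 * r \<le> d")
  case True
  have "node t d r = node t d 0 - of_nat (2 * r) * (of_nat (2 * d) - of_nat (2 * r) + t - 2)"
    by (simp add: node_def algebra_simps)
  then show ?thesis
    unfolding casimir_eq
    by (simp add: bcomp_diff_left bcomp_bscale_left radial_symz radial_1_mult_radial[OF True, simplified] bscale_diff_left)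
qed (simp add: radial_def)


section \<open>The minimal polynomial of the Casimir operator\<close>

text \<open>Composing with a permutation creates no loops: over two colours the constant colouring of the
  outer points extends in exactly one way to the middle points.\<close>

lemma loops_bperm:
  assumes \<pi>: "\<pi> permutes {..<n}" and b: "bperm n \<pi> = Poly_Mapping.single b 1"
  shows "a \<in> diagrams m n \<Longrightarrow> loops b a = 0" "a \<in> diagrams n p \<Longrightarrow> loops a b = 0"
proof -
  have b_diag: "b \<in> diagrams n n"
    using bperm_in_bhom[OF \<pi>] by (simp add: b bhom_def)
  have compat_b: "compat b x y \<longleftrightarrow> x = permute_list \<pi> y"
    if "x \<in> colourings 2 n" "y \<in> colourings 2 n" for x y
    using mat_bperm[OF \<pi> that] by (simp add: b of_bool_eq_iff)
  have rep: "replicate k 0 \<in> colourings 2 k" for k by (auto simp: colourings_def)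
  have perm_rep: "permute_list \<pi> (replicate n 0) = replicate n (0::nat)"
    using \<pi> permutes_in_image[OF \<pi>] by (intro nth_equalityI) (auto simp: permute_list_nth)
  have const: "compat c (replicate k 0) (replicate l 0)" if c: "c \<in> diagrams k l" for c k l
  proof -
    have "case_sum ((!) (replicate k 0)) ((!) (replicate l 0)) s = (0::nat)" if "s \<in> Field c" for s
    proof -
      have "s \<in> Inl ` {..<k} \<union> Inr ` {..<l}" using c that by (simp add: diagrams_def)
      then show ?thesis by auto
    qed
    then show ?thesis unfolding compat_def using FieldI1[of _ _ c] FieldI2[of _ _ c] by fastforce
  qed
  have two: "l = 0" if "(2::nat) ^ l = 1 \<or> (1::nat) = 2 ^ l" for l
    using that by (cases l) auto
  show "loops b a = 0" if a: "a \<in> diagrams m n"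
  proof -
    have "{y \<in> colourings 2 n. compat a (replicate m 0) y \<and> compat b y (replicate n 0)} = {replicate n 0}"
      using rep const[OF a] by (auto simp: compat_b perm_rep)
    then have "card {y \<in> colourings 2 n. compat a (replicate m 0) y \<and> compat b y (replicate n 0)} = 1" by simp
    then show ?thesis
      unfolding card_middle_colourings[OF a b_diag rep rep]
      using const[OF dcomp_in_diagrams[OF a b_diag]] two by simp
  qed
  show "loops a b = 0" if a: "a \<in> diagrams n p"
  proof -
    have "y = replicate n 0" if "y \<in> colourings 2 n" "replicate n 0 = permute_list \<pi> y" for y
    proof -
      have "mset y = mset (replicate n 0)"
        using mset_permute_list[of \<pi> y] \<pi> that by (simp add: colourings_def)
      then show ?thesis using that(1) set_mset_mset[of y]
        by (intro nth_equalityI) (auto simp: colourings_def dest!: mset_eq_setD in_set_conv_nth[THEN iffD2, OF exI])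
    qed
    then have "{y \<in> colourings 2 n. compat b (replicate n 0) y \<and> compat a y (replicate p 0)} = {replicate n 0}"
      using rep const[OF a] by (auto simp: compat_b perm_rep)
    then have "card {y \<in> colourings 2 n. compat b (replicate n 0) y \<and> compat a y (replicate p 0)} = 1" by simp
    then show ?thesis
      unfolding card_middle_colourings[OF b_diag a rep rep]
      using const[OF dcomp_in_diagrams[OF b_diag a]] two by simp
  qed
qed

lemma bcomp_bperm_indep:
  assumes \<pi>: "\<pi> permutes {..<n}"
  shows "F \<in> bhom m n \<Longrightarrow> bperm n \<pi> \<odot>\<^bsub>t\<^esub> F = bperm n \<pi> \<odot>\<^bsub>s\<^esub> F"
    and "G \<in> bhom n p \<Longrightarrow> G \<odot>\<^bsub>t\<^esub> bperm n \<pi> = G \<odot>\<^bsub>s\<^esub> bperm n \<pi>"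
proof -
  obtain b where b: "bperm n \<pi> = Poly_Mapping.single b 1" by (simp add: bperm_def)
  show "bperm n \<pi> \<odot>\<^bsub>t\<^esub> F = bperm n \<pi> \<odot>\<^bsub>s\<^esub> F" if "F \<in> bhom m n"
    unfolding bcomp_def b using that loops_bperm(1)[OF \<pi> b] by (auto simp: bhom_def intro!: sum.cong)
  show "G \<odot>\<^bsub>t\<^esub> bperm n \<pi> = G \<odot>\<^bsub>s\<^esub> bperm n \<pi>" if "G \<in> bhom n p"
    unfolding bcomp_def b using that loops_bperm(2)[OF \<pi> b] by (auto simp: bhom_def intro!: sum.cong)
qed

lemma bcomp_symz_indep:
  "F \<in> bhom m n \<Longrightarrow> symz n \<odot>\<^bsub>t\<^esub> F = symz n \<odot>\<^bsub>s\<^esub> F"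
  "G \<in> bhom n p \<Longrightarrow> G \<odot>\<^bsub>t\<^esub> symz n = G \<odot>\<^bsub>s\<^esub> symz n"
  unfolding symz_def bcomp_bscale_left bcomp_bscale_right bcomp_sum_left bcomp_sum_right
  by (intro arg_cong[where f = "bscale _"] sum.cong refl bcomp_bperm_indep; simp)+

text \<open>Each composition in \<open>radial\<close> has a symmetrizer as a factor and so creates
  no loops. This carries linear independence from one value of \<open>t\<close> to all
  others.\<close>

lemma radial_indep: "radial t d r = radial s d r"
proof (cases "2 * r \<le> d")
  case True
  have "cupcaps r (d - 2 * r) \<odot>\<^bsub>t\<^esub> symz d = cupcaps r (d - 2 * r) \<odot>\<^bsub>s\<^esub> symz d"
    by (rule bcomp_symz_indep(2)[OF cupcaps_in_bhom'[OF True]])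
  moreover have "symz d \<odot>\<^bsub>t\<^esub> (cupcaps r (d - 2 * r) \<odot>\<^bsub>s\<^esub> symz d) = symz d \<odot>\<^bsub>s\<^esub> (cupcaps r (d - 2 * r) \<odot>\<^bsub>s\<^esub> symz d)"
    by (rule bcomp_symz_indep(1)[OF bcomp_in_bhom[OF symz_in_bhom cupcaps_in_bhom'[OF True]]])
  ultimately show ?thesis by (simp add: radial_def)
qed (simp add: radial_def)

text \<open>By \<open>radial_indep\<close> it is enough to argue at \<open>t = 2\<close>. There
  \<open>v\<close> is a unit vector and \<open>w\<close> has scalar product 1 with it and an
  arbitrary square \<open>z\<close>; the pairing becomes a polynomial in \<open>z\<close> whose
  coefficients are the \<open>b r\<close> times non-zero falling factorials.\<close>

lemma radial_independent:
  assumes zero: "(\<Sum>r\<le>d div 2. bscale (b r) (radial t d r)) = 0" and r: "r \<le> d div 2"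
  shows "b r = 0"
proof -
  define p where "p = (\<Sum>r\<le>d div 2. monom (b r * ffact (of_nat d) (2 * r)) r)"
  have "poly p z = 0" for z
  proof -
    define v :: "nat \<Rightarrow> complex" where "v = (\<lambda>c. of_bool (c = 0))"
    define w :: "nat \<Rightarrow> complex" where "w = (\<lambda>c. if c = 0 then 1 else csqrt (z - 1))"
    have vw: "(\<Sum>c<2. v c ^ 2) = 1" "(\<Sum>c<2. w c ^ 2) = z" "(\<Sum>c<2. v c * w c) = 1"
    proof -
      have two: "{..<2} = {0, 1 :: nat}" by auto
      show "(\<Sum>c<2. v c ^ 2) = 1" "(\<Sum>c<2. w c ^ 2) = z" "(\<Sum>c<2. v c * w c) = 1"
        unfolding two by (simp_all add: v_def w_def)
    qed
    have S: "pairing 2 d d (\<Sum>r\<in>S. bscale (b r) (radial t d r)) v w = (\<Sum>r\<in>S. b r * ffact (of_nat d) (2 * r) * z ^ r)" for S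
    proof (induction S rule: infinite_finite_induct)
      case (insert r S)
      then show ?case
        using pairing_radial[of 2 d r v w] radial_indep[of t d r "of_nat 2"] by (simp add: pairing_simps vw)
    qed (auto simp: pairing_simps)
    then have "(\<Sum>r\<le>d div 2. b r * ffact (of_nat d) (2 * r) * z ^ r) = 0"
      using S[of "{..d div 2}"] unfolding zero by (simp add: pairing_simps)
    then show ?thesis by (simp add: p_def poly_sum poly_monom)
  qed
  then have "p = 0" using poly_all_0_iff_0[of p] by blast
  then have "coeff p r = 0" by simp
  also have "coeff p r = b r * ffact (of_nat d) (2 * r)"
    using r by (simp add: p_def coeff_sum)
  finally have "b r * ffact (of_nat d) (2 * r) = 0" .
  moreover have "ffact (of_nat d :: complex) (2 * r) \<noteq> 0"
    using r by (auto simp: ffact_def)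
  ultimately show ?thesis by simp
qed

section \<open>Polynomials in an endomorphism of a symmetric power\<close>

lemma kpow_simps: "kpow t X F 0 = kid X" "kpow t X F (Suc n) = F \<odot>\<^bsub>t\<^esub> kpow t X F n"
  by (simp_all add: kpow_def)

lemma kpoly_eq_sum:
  assumes "degree p \<le> n"
  shows "kpoly t X p F = (\<Sum>i\<le>n. bscale (coeff p i) (kpow t X F i))"
  unfolding kpoly_def using assms
  by (intro sum.mono_neutral_left) (auto simp: coeff_eq_0)

lemma kpoly_add: "kpoly t X (p + q) F = kpoly t X p F + kpoly t X q F"
  using degree_add_le_max[of p q]
  by (simp add: kpoly_eq_sum[of _ "max (degree p) (degree q)"] sum.distrib bscale_add_left)

lemma kpoly_smult: "kpoly t X (smult c p) F = bscale c (kpoly t X p F)"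
  using degree_smult_le[of c p] by (simp add: kpoly_eq_sum[of _ "degree p"] bscale_sum)

lemma kpoly_0 [simp]: "kpoly t X 0 F = 0"
  by (simp add: kpoly_def)

lemma kpoly_diff: "kpoly t X (p - q) F = kpoly t X p F - kpoly t X q F"
  using kpoly_add[of t X "p - q" q F] by (simp add: algebra_simps)

lemma kpoly_sum: "kpoly t X (\<Sum>i\<in>S. p i) F = (\<Sum>i\<in>S. kpoly t X (p i) F)"
  by (induction S rule: infinite_finite_induct) (auto simp: kpoly_add)

lemma kpoly_pCons: "kpoly t X (pCons a p) F = bscale a (kid X) + F \<odot>\<^bsub>t\<^esub> kpoly t X p F"
proof -
  have "kpoly t X (pCons a p) F = (\<Sum>i\<le>Suc (degree p). bscale (coeff (pCons a p) i) (kpow t X F i))"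
    by (rule kpoly_eq_sum) (simp add: degree_pCons_le)
  also have "\<dots> = bscale a (kid X) + (\<Sum>i\<le>degree p. bscale (coeff p i) (F \<odot>\<^bsub>t\<^esub> kpow t X F i))"
    unfolding sum.atMost_Suc_shift by (simp add: kpow_simps)
  finally show ?thesis by (simp add: kpoly_def bcomp_sum_right bcomp_bscale_right)
qed

lemma kpoly_1: "kpoly t X 1 F = kid X"
  by (simp add: kpoly_def kpow_simps)

context
  fixes t :: complex and d :: nat and F :: bmor
  assumes F: "F \<in> bhom d d" "symz d \<odot>\<^bsub>t\<^esub> F = F" "F \<odot>\<^bsub>t\<^esub> symz d = F"
begin

lemma kpoly_in_bhom: "kpoly t (Sym d) p F \<in> bhom d d"
proof (induction p)
  case (pCons a p)
  then show ?case using F(1) by (auto simp: kpoly_pCons kid_def Sym_def intro!: bhom_simps bcomp_in_bhom)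
qed simp

lemma symz_kpoly: "symz d \<odot>\<^bsub>t\<^esub> kpoly t (Sym d) p F = kpoly t (Sym d) p F"
proof (induction p)
  case (pCons a p)
  have "symz d \<odot>\<^bsub>t\<^esub> F \<odot>\<^bsub>t\<^esub> kpoly t (Sym d) p F = F \<odot>\<^bsub>t\<^esub> kpoly t (Sym d) p F"
    using bcomp_assoc[OF kpoly_in_bhom F(1) symz_in_bhom, of t p] F(2) by simp
  then show ?case
    by (simp add: kpoly_pCons kid_def Sym_def bcomp_add_right bcomp_bscale_right symz_idem)
qed simp

lemma kpoly_mult: "kpoly t (Sym d) (p * q) F = kpoly t (Sym d) p F \<odot>\<^bsub>t\<^esub> kpoly t (Sym d) q F"
proof (induction p)
  case (pCons a p)
  have "kpoly t (Sym d) (pCons a p * q) F =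
        bscale a (kpoly t (Sym d) q F) + F \<odot>\<^bsub>t\<^esub> (kpoly t (Sym d) p F \<odot>\<^bsub>t\<^esub> kpoly t (Sym d) q F)"
    by (simp add: kpoly_add kpoly_smult kpoly_pCons pCons.IH)
  also have "\<dots> = kpoly t (Sym d) (pCons a p) F \<odot>\<^bsub>t\<^esub> kpoly t (Sym d) q F"
    using bcomp_assoc[OF kpoly_in_bhom kpoly_in_bhom F(1), of t p q] symz_kpoly[of q]
    by (simp add: kpoly_pCons bcomp_add_left bcomp_bscale_left kid_def Sym_def)
  finally show ?case .
qed simp

lemma kpoly_symz: "kpoly t (Sym d) p F \<odot>\<^bsub>t\<^esub> symz d = kpoly t (Sym d) p F"
  using kpoly_mult[of p 1] by (simp add: kpoly_1 kid_def Sym_def)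

lemma kpoly_linear: "kpoly t (Sym d) [:b, c:] F = bscale b (symz d) + bscale c F"
  using F(3) by (simp add: kpoly_pCons kid_def Sym_def bcomp_bscale_right)

lemma kpow_shift: "kpow t (Sym d) (F - bscale c (kid (Sym d))) n = kpoly t (Sym d) ([:- c, 1:] ^ n) F"
proof (induction n)
  case 0
  then show ?case by (simp add: kpow_simps kpoly_1)
next
  case (Suc n)
  have "F - bscale c (kid (Sym d)) = kpoly t (Sym d) [:- c, 1:] F"
    unfolding kpoly_linear
    by (rule poly_mapping_eqI) (simp add: lookup_minus lookup_add kid_def Sym_def)
  with Suc show ?case by (simp add: kpow_simps kpoly_mult del: mult_pCons_left)
qed

end

lemma casimir_sym: "casimir t d \<in> bhom d d" "symz d \<odot>\<^bsub>t\<^esub> casimir t d = casimir t d"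
  "casimir t d \<odot>\<^bsub>t\<^esub> symz d = casimir t d"
  by (simp_all add: casimir_eq bcomp_diff_left bcomp_diff_right bcomp_bscale_left bcomp_bscale_right symz_idem
      radial_symz)

text \<open>The Newton basis for the nodes. The factors are node minus variable, opposite to the
  usual sign, so that the value at the Casimir operator is \<open>radial t d r\<close> without a
  sign.\<close>

definition newton :: "complex \<Rightarrow> nat \<Rightarrow> nat \<Rightarrow> complex poly" where
  "newton t d r = (\<Prod>i<r. [:node t d i, - 1:])"

abbreviation cpoly :: "complex \<Rightarrow> nat \<Rightarrow> complex poly \<Rightarrow> bmor" where
  "cpoly t d p \<equiv> kpoly t (Sym d) p (casimir t d)"

lemmas cpoly_mult = kpoly_mult[OF casimir_sym]

lemma cpoly_newton: "cpoly t d (newton t d r) = radial t d r"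
proof (induction r)
  case 0
  then show ?case by (simp add: newton_def kpoly_1 radial_0 kid_def Sym_def)
next
  case (Suc r)
  have "cpoly t d (newton t d (Suc r)) = cpoly t d [:node t d r, - 1:] \<odot>\<^bsub>t\<^esub> radial t d r"
    unfolding Suc.IH[symmetric] cpoly_mult[symmetric]
    by (rule arg_cong[where f = "cpoly t d"]) (simp only: newton_def prod.lessThan_Suc mult.commute)
  also have "\<dots> = bscale (node t d r) (radial t d r) + bscale (- 1) (casimir t d \<odot>\<^bsub>t\<^esub> radial t d r)"
    by (simp add: kpoly_linear[OF casimir_sym] bcomp_add_left bcomp_bscale_left radial_symz)
  also have "\<dots> = bscale (node t d r) (radial t d r) - casimir t d \<odot>\<^bsub>t\<^esub> radial t d r"
    by (rule poly_mapping_eqI) (simp add: lookup_minus lookup_add)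
  finally show ?case by (simp only: casimir_mult_radial)
qed

lemma degree_newton: "degree (newton t d r) = r"
  unfolding newton_def by (subst degree_prod_eq_sum_degree) auto

lemma newton_expansion:
  assumes "degree p \<le> n"
  shows "\<exists>b. p = (\<Sum>i\<le>n. smult (b i) (newton t d i))"
  using assms
proof (induction n arbitrary: p)
  case 0
  then obtain c where "p = [:c:]" by (auto elim: degree_eq_zeroE)
  then show ?case by (intro exI[of _ "\<lambda>_. c"]) (simp add: newton_def)
next
  case (Suc n)
  define c where "c = coeff p (Suc n) / coeff (newton t d (Suc n)) (Suc n)"
  have "lead_coeff (newton t d (Suc n)) \<noteq> 0"
    using degree_newton[of t d "Suc n"] by (metis Zero_not_Suc degree_0 leading_coeff_0_iff)
  then have c: "coeff (p - smult c (newton t d (Suc n))) (Suc n) = 0"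
    by (simp add: c_def degree_newton)
  moreover have "degree (p - smult c (newton t d (Suc n))) \<le> Suc n"
    using Suc.prems degree_newton[of t d "Suc n"] by (intro degree_diff_le) (auto intro: order_trans[OF degree_smult_le])
  ultimately have "degree (p - smult c (newton t d (Suc n))) \<le> n"
    by (metis eq_zero_or_degree_less le_SucE le_eq_less_or_eq less_Suc_eq_le degree_0 zero_le)
  then obtain b where b: "p - smult c (newton t d (Suc n)) = (\<Sum>i\<le>n. smult (b i) (newton t d i))"
    using Suc.IH by blast
  have "p = (\<Sum>i\<le>Suc n. smult ((b(Suc n := c)) i) (newton t d i))"
    using b by (simp add: algebra_simps)
  then show ?case by blast
qed

text \<open>Factors are repeated when nodes coincide, so roots may be multiple. It turns out to be
  the minimal polynomial of the Casimir operator (\<open>kminpoly_casimir\<close>).\<close>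

definition char_poly :: "complex \<Rightarrow> nat \<Rightarrow> complex poly" where
  "char_poly t d = (\<Prod>i\<le>d div 2. [:- node t d i, 1:])"

lemma char_poly_monic: "lead_coeff (char_poly t d) = 1"
  by (simp add: char_poly_def lead_coeff_prod)

lemma degree_char_poly: "degree (char_poly t d) = Suc (d div 2)"
  unfolding char_poly_def by (subst degree_prod_eq_sum_degree) auto

lemma bscale_eq_0_iff: "bscale c F = 0 \<longleftrightarrow> c = 0 \<or> F = 0"
proof (cases "c = 0")
  case False
  then have "F = bscale (inverse c) (bscale c F)" by simp
  with False show ?thesis by (metis bscale_simps(3))
qed simp

text \<open>Up to sign this is the Newton polynomial of index \<open>d div 2 + 1\<close>, whose
  value at the Casimir operator is \<open>radial\<close> with \<open>2 * r > d\<close>, that is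
  zero.\<close>

lemma cpoly_char_poly: "cpoly t d (char_poly t d) = 0"
proof -
  have "newton t d (Suc (d div 2)) = (\<Prod>i\<le>d div 2. smult (- 1) [:- node t d i, 1:])"
    unfolding newton_def lessThan_Suc_atMost by simp
  also have "\<dots> = smult ((- 1) ^ Suc (d div 2)) (char_poly t d)"
    unfolding char_poly_def by (subst prod_smult) simp
  finally have "bscale ((- 1) ^ Suc (d div 2)) (cpoly t d (char_poly t d)) = radial t d (Suc (d div 2))"
    using cpoly_newton[of t d "Suc (d div 2)"] unfolding kpoly_smult[symmetric] by (simp only:)
  also have "\<dots> = 0"
  proof -
    have "\<not> 2 * Suc (d div 2) \<le> d" by arith
    then show ?thesis by (simp only: radial_def if_False)
  qed
  finally show ?thesis by (simp add: bscale_eq_0_iff)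
qed

text \<open>The remainder on division by \<open>char_poly\<close> has a Newton expansion with
  indices up to \<open>d div 2\<close>, so its value at the Casimir operator is a linear combination
  of independent elements.\<close>

lemma cpoly_eq_0_iff: "cpoly t d p = 0 \<longleftrightarrow> char_poly t d dvd p"
proof
  assume "char_poly t d dvd p"
  then show "cpoly t d p = 0" by (auto simp: dvd_def cpoly_mult cpoly_char_poly)
next
  assume p: "cpoly t d p = 0"
  let ?r = "p mod char_poly t d"
  have "char_poly t d \<noteq> 0" using char_poly_monic[of t d] by auto
  then have "degree ?r \<le> d div 2"
    using degree_mod_less[of "char_poly t d" p] degree_char_poly[of t d] by auto
  then obtain b where b: "?r = (\<Sum>i\<le>d div 2. smult (b i) (newton t d i))"
    using newton_expansion by blast
  have "cpoly t d p = cpoly t d (p div char_poly t d * char_poly t d) + cpoly t d ?r"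
    unfolding kpoly_add[symmetric] by (simp only: div_mult_mod_eq)
  then have "cpoly t d ?r = 0"
    using p by (simp add: cpoly_mult cpoly_char_poly)
  then have "(\<Sum>i\<le>d div 2. bscale (b i) (radial t d i)) = 0"
    by (simp add: b kpoly_sum kpoly_smult cpoly_newton)
  then have "\<forall>i\<le>d div 2. b i = 0" using radial_independent by blast
  then have "?r = 0" unfolding b by simp
  then show "char_poly t d dvd p" by (simp add: mod_eq_0_iff_dvd)
qed

lemma kminpoly_casimir: "kminpoly t (Sym d) (casimir t d) = char_poly t d"
  unfolding kminpoly_def
proof (rule the_equality)
  show "lead_coeff (char_poly t d) = 1 \<and> cpoly t d (char_poly t d) = 0 \<and> (\<forall>q. cpoly t d q = 0 \<longrightarrow> char_poly t d dvd q)"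
    by (simp add: char_poly_monic cpoly_eq_0_iff)
  fix p assume p: "lead_coeff p = 1 \<and> cpoly t d p = 0 \<and> (\<forall>q. cpoly t d q = 0 \<longrightarrow> p dvd q)"
  then have "char_poly t d dvd p" "p dvd char_poly t d" by (simp_all add: cpoly_eq_0_iff)
  moreover from this(1) obtain k where k: "p = char_poly t d * k" by (auto simp: dvd_def)
  moreover have "char_poly t d \<noteq> 0" "p \<noteq> 0" using char_poly_monic[of t d] p by auto
  ultimately have "degree k = 0"
    using dvd_imp_degree_le[of p "char_poly t d"] degree_mult_eq[of "char_poly t d" k] by auto
  then obtain c where "k = [:c:]" by (auto elim: degree_eq_zeroE)
  moreover have "lead_coeff p = lead_coeff (char_poly t d) * lead_coeff k"
    unfolding k by (rule lead_coeff_mult)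
  ultimately have "k = 1" using p char_poly_monic[of t d] by simp
  with k show "p = char_poly t d" by simp
qed


section \<open>The decomposition into generalized eigenspaces\<close>

lemma inverse_mod_linear_power:
  fixes h :: "complex poly"
  assumes "poly h c \<noteq> 0"
  shows "\<exists>b. [:- c, 1:] ^ m dvd 1 - b * h"
proof (induction m)
  case (Suc m)
  then obtain b s where s: "1 - b * h = [:- c, 1:] ^ m * s" by (auto simp: dvd_def)
  \<comment> \<open>The correction of \<open>b\<close> is chosen such that
    \<open>s - smult g h\<close> vanishes at \<open>c\<close>, which gains one more power.\<close>
  define g where "g = poly s c / poly h c"
  have "1 - (b + smult g ([:- c, 1:] ^ m)) * h = [:- c, 1:] ^ m * (s - smult g h)"
    using s by (simp add: algebra_simps)
  moreover have "[:- c, 1:] dvd s - smult g h"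
    using assms by (simp add: g_def flip: poly_eq_0_iff_dvd)
  ultimately have "[:- c, 1:] ^ Suc m dvd 1 - (b + smult g ([:- c, 1:] ^ m)) * h"
    by (simp only: power_Suc2 mult_dvd_mono dvd_refl)
  then show ?case by blast
qed simp

lemma linear_power_dvd_cancel:
  fixes q :: "complex poly"
  assumes "[:- c, 1:] ^ m dvd A * q" "poly A c \<noteq> 0"
  shows "[:- c, 1:] ^ m dvd q"
proof -
  obtain b where b: "[:- c, 1:] ^ m dvd 1 - b * A" using inverse_mod_linear_power[OF assms(2)] by blast
  have "q = (1 - b * A) * q + b * (A * q)" by (simp add: algebra_simps)
  then show ?thesis using b assms(1) by (metis dvd_add dvd_mult dvd_mult2)
qed

lemma prod_linear_powers_dvd:
  fixes q :: "complex poly"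
  assumes "finite J" "inj_on c J" "\<And>j. j \<in> J \<Longrightarrow> [:- c j, 1:] ^ m j dvd q"
  shows "(\<Prod>j\<in>J. [:- c j, 1:] ^ m j) dvd q"
  using assms
proof (induction J)
  case (insert i J)
  then obtain s where s: "q = (\<Prod>j\<in>J. [:- c j, 1:] ^ m j) * s" by (auto simp: dvd_def)
  have "c i \<noteq> c j" if "j \<in> J" for j
    using that insert.hyps(2) insert.prems(1) by (auto simp: inj_on_def)
  then have "poly (\<Prod>j\<in>J. [:- c j, 1:] ^ m j) (c i) \<noteq> 0"
    using insert.hyps(1) by (auto simp: poly_prod poly_power)
  then have "[:- c i, 1:] ^ m i dvd s"
    using insert.prems(2)[of i] linear_power_dvd_cancel unfolding s by blast
  then show ?case unfolding s prod.insert[OF insert.hyps] by (simp only: mult.commute[of "_ ^ _"] mult_dvd_mono dvd_refl)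
qed simp

lemma order_prod_linear:
  assumes "finite S"
  shows "order z (\<Prod>i\<in>S. [:- f i, 1:] :: complex poly) = card {i \<in> S. f i = z}"
  using assms
proof (induction S)
  case (insert i S)
  have "(\<Prod>i\<in>insert i S. [:- f i, 1:]) \<noteq> 0" by (subst prod_zero_iff) (use insert.hyps in auto)
  then have "[:- f i, 1:] * (\<Prod>i\<in>S. [:- f i, 1:]) \<noteq> 0" unfolding prod.insert[OF insert.hyps] .
  then have "order z (\<Prod>i\<in>insert i S. [:- f i, 1:]) = order z [:- f i, 1:] + order z (\<Prod>i\<in>S. [:- f i, 1:])"
    unfolding prod.insert[OF insert.hyps] by (rule order_mult)
  moreover have "order z [:- f i, 1:] = (if f i = z then 1 else 0)"
    using order_power_n_n[of z 1] by (auto intro: order_0I)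
  moreover have "{j \<in> insert i S. f j = z} = (if f i = z then insert i {j \<in> S. f j = z} else {j \<in> S. f j = z})"
    by auto
  ultimately show ?case using insert by simp
qed (simp add: order_0I)

section \<open>Indices of the summands and coincidences among the nodes\<close>

definition indices :: "nat \<Rightarrow> nat \<Rightarrow> (nat \<times> nat) set" where
  "indices k d = {lam. lam \<in> I' k \<and> psize lam = d}"

lemma I'_iff: "lam \<in> I' k \<longleftrightarrow> snd lam \<le> fst lam \<and> \<not> k_singular k lam"
  by (cases lam) (auto simp: I'_def partitions2_def k_regular_def k_quasiregular_def k_singular_def)

lemma finite_indices: "finite (indices k d)"
  by (rule finite_subset[of _ "{..d} \<times> {..d}"]) (auto simp: indices_def psize_def)

lemma c_eig_node:
  assumes "snd lam \<le> fst lam"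
  shows "c_eig lam t = node t (psize lam) (snd lam)"
  using assms by (simp add: c_eig_def node_def psize_def of_nat_diff)

context
  fixes k :: nat and t :: complex
  assumes t: "t = - 2 * of_nat k"
begin

text \<open>A node is quadratic in its index, so the difference of two nodes factors. The
  coincidence \<open>i + j + k + 1 = d\<close> is the one between the second parts of a partition
  and of its \<open>dagger\<close>.\<close>

lemma node_eq_iff: "node t d i = node t d j \<longleftrightarrow> i = j \<or> i + j + k + 1 = d"
proof -
  have "node t d i - node t d j = 4 * (of_nat j - of_nat i) * (of_nat d - of_nat (i + j + k + 1))"
    by (simp add: node_def t algebra_simps)
  then have "node t d i = node t d j \<longleftrightarrow>
        of_nat i = (of_nat j :: complex) \<or> of_nat (i + j + k + 1) = (of_nat d :: complex)"
    by (metis (no_types, lifting) eq_iff_diff_eq_0 mult_eq_0_iff zero_neq_numeral)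
  then show ?thesis unfolding of_nat_eq_iff .
qed

text \<open>Of two different partitions with the same size and eigenvalue, the one with the smaller
  second part is singular, hence not an index.\<close>

lemma inj_on_c_eig: "inj_on (\<lambda>lam. c_eig lam t) (indices k d)"
proof (rule inj_onI)
  fix lam mu assume lm: "lam \<in> indices k d" "mu \<in> indices k d" "c_eig lam t = c_eig mu t"
  then have "snd lam = snd mu \<or> snd lam + snd mu + k + 1 = d"
    unfolding node_eq_iff[symmetric] by (simp add: indices_def I'_iff c_eig_node)
  then show "lam = mu"
    using lm(1,2) unfolding indices_def I'_iff k_singular_def psize_def
    by (cases lam; cases mu) auto
qed

text \<open>The candidate is \<open>(d - i, i)\<close>; if it is singular, its \<open>dagger\<close>
  is an index with the same node.\<close>

lemma ex_index_of_node:
  assumes "i \<le> d div 2"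
  shows "\<exists>lam\<in>indices k d. c_eig lam t = node t d i"
proof (cases "k_singular k (d - i, i)")
  case False
  then show ?thesis using assms
    by (intro bexI[of _ "(d - i, i)"]) (auto simp: indices_def I'_iff psize_def c_eig_node)
next
  case True
  have "node t d (d - k - 1 - i) = node t d i"
    unfolding node_eq_iff using True assms by (auto simp: k_singular_def)
  then show ?thesis using True assms
    by (intro bexI[of _ "(i + k + 1, d - k - 1 - i)"])
      (auto simp: indices_def I'_iff psize_def c_eig_node k_singular_def)
qed

lemma char_poly_roots: "{z. poly (char_poly t d) z = 0} = (\<lambda>lam. c_eig lam t) ` indices k d"
proof -
  have 1: "{z. poly (char_poly t d) z = 0} = node t d ` {..d div 2}"
    by (auto simp: char_poly_def poly_prod)
  have "node t d i \<in> (\<lambda>lam. c_eig lam t) ` indices k d" if "i \<le> d div 2" for i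
    using ex_index_of_node[OF that] by (metis imageI)
  moreover have "c_eig lam t \<in> node t d ` {..d div 2}" if "lam \<in> indices k d" for lam
    using that by (auto simp: indices_def I'_iff c_eig_node psize_def)
  ultimately show ?thesis unfolding 1 by auto
qed

lemma order_char_poly:
  "order z (char_poly t d) = card {i \<in> {..d div 2}. node t d i = z}"
  unfolding char_poly_def by (rule order_prod_linear) simp

lemma char_poly_factorization:
  "char_poly t d = (\<Prod>lam\<in>indices k d. [:- c_eig lam t, 1:] ^ order (c_eig lam t) (char_poly t d))"
proof -
  have nodes: "node t d ` {..d div 2} = (\<lambda>lam. c_eig lam t) ` indices k d"
    unfolding char_poly_roots[symmetric] by (auto simp: char_poly_def poly_prod)
  have "char_poly t d = (\<Prod>z\<in>node t d ` {..d div 2}. \<Prod>i\<in>{i \<in> {..d div 2}. node t d i = z}. [:- node t d i, 1:])"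
    unfolding char_poly_def by (rule prod.image_gen) simp
  also have "\<dots> = (\<Prod>z\<in>node t d ` {..d div 2}. [:- z, 1:] ^ order z (char_poly t d))"
    unfolding order_char_poly by (intro prod.cong refl) (simp del: atMost_iff)
  also have "\<dots> = (\<Prod>lam\<in>indices k d. [:- c_eig lam t, 1:] ^ order (c_eig lam t) (char_poly t d))"
    unfolding nodes using inj_on_c_eig[of d] by (simp add: prod.reindex)
  finally show ?thesis .
qed

text \<open>At most the index \<open>snd lam\<close> and its mirror image can give the node of
  \<open>lam\<close>. The upper bound 2 is what makes the nilpotent parts square to zero.\<close>

lemma order_char_poly_bounds:
  assumes "lam \<in> indices k d"
  shows "1 \<le> order (c_eig lam t) (char_poly t d)" "order (c_eig lam t) (char_poly t d) \<le> 2"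
proof -
  have "poly (char_poly t d) (c_eig lam t) = 0" using char_poly_roots[of d] assms by blast
  moreover have "char_poly t d \<noteq> 0" using char_poly_monic[of t d] by auto
  ultimately show "1 \<le> order (c_eig lam t) (char_poly t d)"
    by (metis One_nat_def Suc_leI gr0I order_root)
  have "{i \<in> {..d div 2}. node t d i = c_eig lam t} \<subseteq> {snd lam, d - k - 1 - snd lam}"
    using assms by (auto simp: indices_def I'_iff c_eig_node node_eq_iff)
  then have "card {i \<in> {..d div 2}. node t d i = c_eig lam t} \<le> card {snd lam, d - k - 1 - snd lam}"
    by (intro card_mono) auto
  also have "\<dots> \<le> 2" by (simp add: card_insert_if)
  finally show "order (c_eig lam t) (char_poly t d) \<le> 2" by (simp add: order_char_poly)
qed

end

section \<open>The projections as polynomials in the Casimir operator\<close>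

lemma Sym_sel [simp]: "fst (Sym d) = d" "snd (Sym d) = symz d"
  by (simp_all add: Sym_def)

lemma cpoly_in_khom: "cpoly t d p \<in> khom t (Sym d) (Sym d)"
  using kpoly_in_bhom[OF casimir_sym] symz_kpoly[OF casimir_sym] kpoly_symz[OF casimir_sym]
  by (simp add: khom_def)

lemma cpoly_in_bhom: "cpoly t d p \<in> bhom d d"
  by (rule kpoly_in_bhom[OF casimir_sym])

lemma cpoly_eqI: "char_poly t d dvd p - q \<Longrightarrow> cpoly t d p = cpoly t d q"
  using kpoly_diff[of t "Sym d" p q "casimir t d"] by (simp flip: cpoly_eq_0_iff)

lemma cpoly_commute: "cpoly t d p \<odot>\<^bsub>t\<^esub> cpoly t d q = cpoly t d q \<odot>\<^bsub>t\<^esub> cpoly t d p"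
  by (simp flip: cpoly_mult add: mult.commute)

lemma casimir_shift_kpow:
  "kpow t (Sym (psize lam)) (casimir_shift t lam) n = cpoly t (psize lam) ([:- c_eig lam t, 1:] ^ n)"
  unfolding casimir_shift_def by (rule kpow_shift[OF casimir_sym])

lemma m_mult_eq: "m_mult t lam = order (c_eig lam t) (char_poly t (psize lam))"
  by (simp add: m_mult_def kminpoly_casimir)

lemma is_decompositionD:
  assumes "is_decomposition t k d e"
  shows "lam \<in> I' k \<Longrightarrow> psize lam = d \<Longrightarrow> is_kernel t (d, e lam) (e lam) (Sym d)
      (kpow t (Sym d) (casimir_shift t lam) (m_mult t lam)) (Sym d)"
    and "\<not> (lam \<in> I' k \<and> psize lam = d) \<Longrightarrow> e lam = 0"
    and "lam \<in> I' k \<Longrightarrow> mu \<in> I' k \<Longrightarrow> lam \<noteq> mu \<Longrightarrow> e lam \<odot>\<^bsub>t\<^esub> e mu = 0"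
    and "lam \<in> I' k \<Longrightarrow> e lam \<in> khom t (Sym d) (Sym d)"
    and "(\<Sum>lam | lam \<in> I' k \<and> psize lam = d. e lam) = kid (Sym d)"
proof -
  note * = assms[unfolded is_decomposition_def]
  show "lam \<in> I' k \<Longrightarrow> psize lam = d \<Longrightarrow> is_kernel t (d, e lam) (e lam) (Sym d)
      (kpow t (Sym d) (casimir_shift t lam) (m_mult t lam)) (Sym d)"
    using *[THEN conjunct1] by blast
  show "\<not> (lam \<in> I' k \<and> psize lam = d) \<Longrightarrow> e lam = 0"
    using *[THEN conjunct2, THEN conjunct1] by blast
  show "lam \<in> I' k \<Longrightarrow> mu \<in> I' k \<Longrightarrow> lam \<noteq> mu \<Longrightarrow> e lam \<odot>\<^bsub>t\<^esub> e mu = 0"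
    using *[THEN conjunct2, THEN conjunct2, THEN conjunct1] by blast
  show "lam \<in> I' k \<Longrightarrow> e lam \<in> khom t (Sym d) (Sym d)"
    using *[THEN conjunct2, THEN conjunct2, THEN conjunct2, THEN conjunct1] by blast
  show "(\<Sum>lam | lam \<in> I' k \<and> psize lam = d. e lam) = kid (Sym d)"
    using *[THEN conjunct2, THEN conjunct2, THEN conjunct2, THEN conjunct2] .
qed

text \<open>The two families describe the same kernels, so \<open>e' mu\<close> fixes
  \<open>e mu\<close>, and orthogonality annihilates the products with different indices.
  Multiplying the identity, the sum of all \<open>e mu\<close>, by \<open>e' lam\<close> therefore
  leaves \<open>e lam\<close>.\<close>

lemma is_decomposition_unique:
  assumes e: "is_decomposition t k d e" and e': "is_decomposition t k d e'"
  shows "e = e'"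
proof
  fix lam
  show "e lam = e' lam"
  proof (cases "lam \<in> I' k \<and> psize lam = d")
    case False
    then show ?thesis using is_decompositionD(2)[OF e] is_decompositionD(2)[OF e'] by metis
  next
    case lam: True
    let ?J = "{mu. mu \<in> I' k \<and> psize mu = d}"
    have bh: "f mu \<in> bhom d d" if "is_decomposition t k d f" "mu \<in> I' k" for f mu
      using is_decompositionD(4)[OF that] by (simp add: khom_def)
    \<comment> \<open>Both are kernels of the same morphism, so \<open>e mu\<close> factors through
      \<open>e' mu\<close>.\<close>
    have absorb: "e' mu \<odot>\<^bsub>t\<^esub> e mu = e mu" if "mu \<in> ?J" for mu
    proof -
      let ?h = "kpow t (Sym d) (casimir_shift t mu) (m_mult t mu)"
      have k1: "is_kernel t (d, e mu) (e mu) (Sym d) ?h (Sym d)"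
        and k2: "is_kernel t (d, e' mu) (e' mu) (Sym d) ?h (Sym d)"
        using that is_decompositionD(1)[OF e] is_decompositionD(1)[OF e'] by blast+
      then obtain u where u: "u \<in> khom t (d, e mu) (d, e' mu)" "e' mu \<odot>\<^bsub>t\<^esub> u = e mu"
        unfolding is_kernel_def by blast
      from u(1) have "e' mu \<odot>\<^bsub>t\<^esub> u = u" by (simp add: khom_def)
      with u(2) have "u = e mu" by simp
      with u(2) show ?thesis by simp
    qed
    have cross: "e' lam \<odot>\<^bsub>t\<^esub> e mu = 0" if "mu \<in> ?J" "mu \<noteq> lam" for mu
    proof -
      have "e' lam \<odot>\<^bsub>t\<^esub> e mu = e' lam \<odot>\<^bsub>t\<^esub> e' mu \<odot>\<^bsub>t\<^esub> e mu" by (simp only: absorb[OF that(1)])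
      also have "\<dots> = (e' lam \<odot>\<^bsub>t\<^esub> e' mu) \<odot>\<^bsub>t\<^esub> e mu"
        by (rule bcomp_assoc[OF bh[OF e] bh[OF e'] bh[OF e'], symmetric]) (use that lam in auto)
      also have "e' lam \<odot>\<^bsub>t\<^esub> e' mu = 0"
        using is_decompositionD(3)[OF e'] that lam by blast
      finally show ?thesis by simp
    qed
    have "e' lam = e' lam \<odot>\<^bsub>t\<^esub> kid (Sym d)"
      using is_decompositionD(4)[OF e'] lam by (simp add: khom_def kid_def)
    also have "kid (Sym d) = (\<Sum>mu\<in>?J. e mu)"
      using is_decompositionD(5)[OF e] by simp
    also have "e' lam \<odot>\<^bsub>t\<^esub> (\<Sum>mu\<in>?J. e mu) = (\<Sum>mu\<in>?J. if mu = lam then e lam else 0)"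
      unfolding bcomp_sum_right using cross absorb lam by (intro sum.cong) auto
    also have "\<dots> = e lam"
      using lam finite_indices[of k d] by (simp add: indices_def)
    finally show ?thesis by simp
  qed
qed

text \<open>The conditions of the Chinese remainder theorem: 1 modulo the power of the linear factor
  that belongs to \<open>lam\<close>, 0 modulo the complementary factor of
  \<open>char_poly\<close>.\<close>

definition is_projector :: "complex \<Rightarrow> nat \<times> nat \<Rightarrow> complex poly \<Rightarrow> bool" where
  "is_projector t lam \<epsilon> \<longleftrightarrow>
     [:- c_eig lam t, 1:] ^ order (c_eig lam t) (char_poly t (psize lam)) dvd 1 - \<epsilon> \<and>
     char_poly t (psize lam) dvd [:- c_eig lam t, 1:] ^ order (c_eig lam t) (char_poly t (psize lam)) * \<epsilon>"

text \<open>The complementary factor \<open>h\<close> is multiplied by an inverse of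
  \<open>h\<close> modulo the power of the linear factor.\<close>

lemma ex_projector:
  assumes t: "t = - 2 * of_nat k" and lam: "lam \<in> I' k"
  shows "\<exists>\<epsilon>. is_projector t lam \<epsilon>"
proof -
  let ?d = "psize lam"
  define n where "n = (\<lambda>mu. order (c_eig mu t) (char_poly t ?d))"
  let ?P = "\<lambda>mu. [:- c_eig mu t, 1:] ^ n mu"
  have lam': "lam \<in> indices k ?d" using lam by (simp add: indices_def)
  define h where "h = (\<Prod>mu\<in>indices k ?d - {lam}. ?P mu)"
  have "char_poly t ?d = (\<Prod>mu\<in>indices k ?d. ?P mu)"
    unfolding n_def by (rule char_poly_factorization[OF t])
  also have "\<dots> = ?P lam * h"
    unfolding h_def by (rule prod.remove[OF finite_indices lam'])
  finally have fac: "char_poly t ?d = ?P lam * h" .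
  have "c_eig lam t \<noteq> c_eig mu t" if "mu \<in> indices k ?d - {lam}" for mu
    using that lam' inj_on_c_eig[OF t, of ?d] by (auto simp: inj_on_def)
  then have "poly h (c_eig lam t) \<noteq> 0"
    unfolding h_def using finite_indices[of k ?d] by (auto simp: poly_prod)
  then obtain b where "?P lam dvd 1 - b * h" using inverse_mod_linear_power by blast
  moreover have "char_poly t ?d dvd ?P lam * (b * h)"
    unfolding fac by (intro mult_dvd_mono dvd_triv_right dvd_refl)
  ultimately have "is_projector t lam (b * h)"
    unfolding is_projector_def n_def by blast
  then show ?thesis by blast
qed

text \<open>Idempotence, orthogonality and completeness are congruences modulo
  \<open>char_poly\<close>; the last two are verified modulo each of the powers
  \<open>?P lam\<close> separately.\<close>

lemma is_decomposition_projectors: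
  assumes t: "t = - 2 * of_nat k"
    and \<epsilon>: "\<And>lam. lam \<in> indices k d \<Longrightarrow> is_projector t lam (\<epsilon> lam)"
  shows "is_decomposition t k d (\<lambda>lam. if lam \<in> indices k d then cpoly t d (\<epsilon> lam) else 0)"
    (is "is_decomposition t k d ?e")
proof -
  let ?\<chi> = "char_poly t d"
  let ?P = "\<lambda>mu. [:- c_eig mu t, 1:] ^ order (c_eig mu t) ?\<chi>"
  have p1: "?P lam dvd 1 - \<epsilon> lam" and p2: "?\<chi> dvd ?P lam * \<epsilon> lam" if "lam \<in> indices k d" for lam
    using \<epsilon>[OF that] that by (auto simp: is_projector_def indices_def)
  have dvd_of_factors: "?\<chi> dvd p" if "\<And>lam. lam \<in> indices k d \<Longrightarrow> ?P lam dvd p" for p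
  proof -
    have "(\<Prod>mu\<in>indices k d. ?P mu) dvd p"
      by (rule prod_linear_powers_dvd[OF finite_indices inj_on_c_eig[OF t]]) (rule that)
    then show ?thesis by (subst char_poly_factorization[OF t])
  qed
  have off: "?P mu dvd \<epsilon> lam" if "lam \<in> indices k d" "mu \<in> indices k d" "lam \<noteq> mu" for lam mu
  proof (rule linear_power_dvd_cancel)
    show "?P mu dvd ?P lam * \<epsilon> lam"
      using p2[OF that(1)] order_1 dvd_trans by blast
    show "poly (?P lam) (c_eig mu t) \<noteq> 0"
      using that inj_on_c_eig[OF t, of d] by (auto simp: inj_on_def)
  qed
  have idem: "cpoly t d (\<epsilon> lam) \<odot>\<^bsub>t\<^esub> cpoly t d (\<epsilon> lam) = cpoly t d (\<epsilon> lam)" if lam: "lam \<in> indices k d" for lam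
  proof -
    have "?P lam * \<epsilon> lam dvd (1 - \<epsilon> lam) * \<epsilon> lam" by (intro mult_dvd_mono p1 lam) simp
    then have "?\<chi> dvd \<epsilon> lam - \<epsilon> lam * \<epsilon> lam" using p2[OF lam] by (simp add: algebra_simps dvd_trans)
    from cpoly_eqI[OF this] show ?thesis by (simp add: cpoly_mult)
  qed
  have in_khom: "?e lam \<in> khom t (Sym d) (Sym d)" for lam
    using cpoly_in_khom[of t d "\<epsilon> lam"] by (simp add: khom_def)
  have kernel: "is_kernel t (d, ?e lam) (?e lam) (Sym d)
          (kpow t (Sym d) (casimir_shift t lam) (m_mult t lam)) (Sym d)"
    if "lam \<in> I' k \<and> psize lam = d" for lam
  proof -
    have lam: "lam \<in> indices k d" using that by (simp add: indices_def)
    have h: "kpow t (Sym d) (casimir_shift t lam) (m_mult t lam) = cpoly t d (?P lam)"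
      using that casimir_shift_kpow[of t lam] by (auto simp: m_mult_eq)
    show ?thesis unfolding is_kernel_def h if_P[OF lam]
    proof (intro conjI ballI impI)
      show "(d, cpoly t d (\<epsilon> lam)) \<in> kobjs t"
        by (simp add: kobjs_def cpoly_in_bhom idem lam)
      show "cpoly t d (\<epsilon> lam) \<in> khom t (d, cpoly t d (\<epsilon> lam)) (Sym d)"
        using cpoly_in_khom[of t d "\<epsilon> lam"] by (simp add: khom_def idem lam)
      show "cpoly t d (?P lam) \<in> khom t (Sym d) (Sym d)" by (rule cpoly_in_khom)
      show "cpoly t d (?P lam) \<odot>\<^bsub>t\<^esub> cpoly t d (\<epsilon> lam) = 0"
        using p2[OF lam] by (simp add: cpoly_eq_0_iff flip: cpoly_mult)
      fix Z g assume Z: "Z \<in> kobjs t" and g: "g \<in> khom t Z (Sym d)" and "cpoly t d (?P lam) \<odot>\<^bsub>t\<^esub> g = 0"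
      \<comment> \<open>Since \<open>1 - \<epsilon> lam\<close> is a multiple of the power that
        defines the kernel, it annihilates \<open>g\<close>. So \<open>g\<close> is fixed by the
        projection and is itself the required factorization.\<close>
      obtain s where s: "1 - \<epsilon> lam = s * ?P lam" using p1[OF lam] by (auto simp: dvd_def mult.commute)
      have gb: "g \<in> bhom (fst Z) d" "symz d \<odot>\<^bsub>t\<^esub> g = g" "g \<odot>\<^bsub>t\<^esub> snd Z = g"
        using g by (auto simp: khom_def)
      have "cpoly t d (1 - \<epsilon> lam) \<odot>\<^bsub>t\<^esub> g = cpoly t d s \<odot>\<^bsub>t\<^esub> cpoly t d (?P lam) \<odot>\<^bsub>t\<^esub> g"
        unfolding s cpoly_mult by (rule bcomp_assoc[OF gb(1) cpoly_in_bhom cpoly_in_bhom])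
      also have "\<dots> = 0" using \<open>cpoly t d (?P lam) \<odot>\<^bsub>t\<^esub> g = 0\<close> by simp
      finally have eg: "cpoly t d (\<epsilon> lam) \<odot>\<^bsub>t\<^esub> g = g"
        using gb(2) by (simp add: kpoly_diff kpoly_1 kid_def bcomp_diff_left)
      show "\<exists>!u. u \<in> khom t Z (d, cpoly t d (\<epsilon> lam)) \<and> cpoly t d (\<epsilon> lam) \<odot>\<^bsub>t\<^esub> u = g"
      proof (rule ex1I[of _ g])
        show "g \<in> khom t Z (d, cpoly t d (\<epsilon> lam)) \<and> cpoly t d (\<epsilon> lam) \<odot>\<^bsub>t\<^esub> g = g"
          using eg gb by (simp add: khom_def)
      qed (auto simp: khom_def)
    qed
  qed
  have orth: "?e lam \<odot>\<^bsub>t\<^esub> ?e mu = 0" if "lam \<noteq> mu" for lam mu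
  proof (cases "lam \<in> indices k d \<and> mu \<in> indices k d")
    case True
    have "?\<chi> dvd \<epsilon> lam * \<epsilon> mu"
    proof (rule dvd_of_factors)
      fix nu assume "nu \<in> indices k d"
      then show "?P nu dvd \<epsilon> lam * \<epsilon> mu"
        using off[of lam nu] off[of mu nu] True that by (cases "nu = lam") auto
    qed
    with True show ?thesis by (simp add: cpoly_eq_0_iff flip: cpoly_mult)
  qed auto
  have "?\<chi> dvd (\<Sum>lam\<in>indices k d. \<epsilon> lam) - 1"
  proof (rule dvd_of_factors)
    fix mu assume mu: "mu \<in> indices k d"
    have eq: "(\<Sum>lam\<in>indices k d. \<epsilon> lam) - 1 = (\<Sum>lam\<in>indices k d - {mu}. \<epsilon> lam) - (1 - \<epsilon> mu)"
      by (simp add: sum.remove[OF finite_indices mu])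
    have "?P mu dvd (\<Sum>lam\<in>indices k d - {mu}. \<epsilon> lam)"
      using off mu by (intro dvd_sum) auto
    then show "?P mu dvd (\<Sum>lam\<in>indices k d. \<epsilon> lam) - 1"
      unfolding eq by (intro dvd_diff p1[OF mu])
  qed
  from cpoly_eqI[OF this] have "(\<Sum>lam\<in>indices k d. cpoly t d (\<epsilon> lam)) = kid (Sym d)"
    by (simp add: kpoly_sum kpoly_1)
  then have "(\<Sum>lam | lam \<in> I' k \<and> psize lam = d. ?e lam) = kid (Sym d)"
    by (simp flip: indices_def)
  moreover have "\<forall>lam. \<not> (lam \<in> I' k \<and> psize lam = d) \<longrightarrow> ?e lam = 0"
    by (simp add: indices_def)
  ultimately show ?thesis
    unfolding is_decomposition_def using kernel in_khom orth by blast
qed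

text \<open>Because the decomposition is unique, the definite description in \<open>V_idem\<close>
  denotes the family built from polynomials in the Casimir operator.\<close>

lemma V_idem_eq:
  assumes t: "t = - 2 * of_nat k" and lam: "lam \<in> I' k"
  shows "\<exists>\<epsilon>. is_projector t lam \<epsilon> \<and> V_idem t k lam = cpoly t (psize lam) \<epsilon>"
proof -
  define \<epsilon> where "\<epsilon> = (\<lambda>mu. SOME \<epsilon>. is_projector t mu \<epsilon>)"
  have \<epsilon>: "is_projector t mu (\<epsilon> mu)" if "mu \<in> I' k" for mu
    unfolding \<epsilon>_def by (rule someI_ex[OF ex_projector[OF t that]])
  let ?d = "psize lam"
  have "is_decomposition t k ?d (\<lambda>lam. if lam \<in> indices k ?d then cpoly t ?d (\<epsilon> lam) else 0)"
    using t \<epsilon> by (intro is_decomposition_projectors) (auto simp: indices_def)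
  then have "(THE e. is_decomposition t k ?d e) = (\<lambda>lam. if lam \<in> indices k ?d then cpoly t ?d (\<epsilon> lam) else 0)"
    using is_decomposition_unique by blast
  then have "V_idem t k lam = cpoly t ?d (\<epsilon> lam)"
    using lam by (simp add: V_idem_def indices_def)
  with \<epsilon>[OF lam] show ?thesis by blast
qed


section \<open>Eigenvalue polynomials\<close>

lemma is_projectorD:
  assumes "is_projector t lam \<epsilon>"
  shows "char_poly t (psize lam) dvd \<epsilon> * \<epsilon> - \<epsilon>"
proof -
  let ?P = "[:- c_eig lam t, 1:] ^ order (c_eig lam t) (char_poly t (psize lam))"
  have "?P * \<epsilon> dvd (1 - \<epsilon>) * \<epsilon>" using assms by (intro mult_dvd_mono) (auto simp: is_projector_def)
  then have "char_poly t (psize lam) dvd - ((1 - \<epsilon>) * \<epsilon>)"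
    using assms dvd_trans unfolding is_projector_def dvd_minus_iff by blast
  then show ?thesis by (simp add: algebra_simps)
qed

text \<open>The regular partitions \<open>(x + k + 1, y)\<close> with
  \<open>x \<ge> y + k + 2\<close> already provide enough points \<open>(x, y)\<close>: infinitely
  many \<open>x\<close> for each of infinitely many \<open>y\<close>.\<close>

lemma eval2_eqI:
  fixes f g :: "complex poly poly"
  assumes "\<And>mu. mu \<in> I' k \<Longrightarrow>
    eval2 f (of_nat (fst mu) - of_nat k - 1) (of_nat (snd mu)) = eval2 g (of_nat (fst mu) - of_nat k - 1) (of_nat (snd mu))"
  shows "f = g"
proof -
  have zero: "poly (f - g) [:of_nat y:] = 0" for y :: nat
  proof -
    have "poly (poly (f - g) [:of_nat y:]) (of_nat x) = 0" if "x \<ge> y + k + 2" for x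
    proof -
      have "(x + k + 1, y) \<in> I' k" using that by (auto simp: I'_iff k_singular_def)
      from assms[OF this] show ?thesis by (simp add: eval2_def)
    qed
    then have sub: "(of_nat :: nat \<Rightarrow> complex) ` {y + k + 2..} \<subseteq> {z. poly (poly (f - g) [:of_nat y:]) z = 0}"
      by auto
    have "infinite ((of_nat :: nat \<Rightarrow> complex) ` {y + k + 2..})"
      by (subst finite_image_iff) (auto simp: inj_on_def infinite_Ici)
    with sub show ?thesis using poly_roots_finite finite_subset by blast
  qed
  have "infinite (range (\<lambda>y. [:of_nat y :: complex:]))"
    by (rule range_inj_infinite) (auto simp: inj_def)
  moreover have "range (\<lambda>y. [:of_nat y :: complex:]) \<subseteq> {z. poly (f - g) z = 0}"
    using zero by blast
  ultimately have "f - g = 0" using poly_roots_finite finite_subset by blast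
  then show ?thesis by simp
qed

text \<open>If \<open>D\<close> acts by polynomials in the Casimir operator, its eigenvalue on the
  summand \<open>mu\<close> is the value of the polynomial at the root \<open>c_eig mu t\<close>:
  the polynomial minus this value is divisible by the linear factor, and the root has multiplicity
  at most 2, so the remaining part squares to zero. Conversely, a square-zero remainder determines
  the eigenvalue by evaluation at the root.\<close>

lemma eigenvalue_poly_eqI:
  assumes t: "t = - 2 * of_nat k"
    and act: "\<And>q. act t D q = cpoly t q (H q)"
    and f: "symmetric2 f"
      "\<And>mu. mu \<in> I' k \<Longrightarrow> eval2 f (of_nat (fst mu) - of_nat k - 1) (of_nat (snd mu)) = poly (H (psize mu)) (c_eig mu t)"
  shows "eigenvalue_poly t k D = f"
  unfolding eigenvalue_poly_def
proof (rule the_equality)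
  show "is_eigenvalue_poly t k D f"
    unfolding is_eigenvalue_poly_def
  proof (intro conjI ballI f(1))
    fix mu assume mu: "mu \<in> I' k"
    let ?q = "psize mu" and ?c = "c_eig mu t"
    obtain \<epsilon> where \<epsilon>: "is_projector t mu \<epsilon>" and V: "V_idem t k mu = cpoly t ?q \<epsilon>"
      using V_idem_eq[OF t mu] by blast
    let ?\<chi> = "char_poly t ?q"
    note idem = is_projectorD[OF \<epsilon>]
    define h where "h = poly (H ?q) ?c"
    define g where "g = H ?q - [:h:]"
    let ?\<eta> = "cpoly t ?q (g * \<epsilon>)"
    have absorb: "?\<chi> dvd \<epsilon> * (g * \<epsilon>) - g * \<epsilon>"
      using dvd_mult[OF idem, of g] by (simp add: algebra_simps)
    have "?\<eta> \<in> khom t (V_obj t k mu) (V_obj t k mu)"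
      using cpoly_eqI[OF absorb] cpoly_commute[of t ?q \<epsilon> "g * \<epsilon>"]
      by (simp add: khom_def V_obj_def V cpoly_in_bhom cpoly_mult[of t ?q \<epsilon> "g * \<epsilon>"])
    moreover have "?\<eta> \<odot>\<^bsub>t\<^esub> ?\<eta> = 0"
    proof -
      let ?m = "order ?c ?\<chi>"
      have "?m \<le> 2" using order_char_poly_bounds(2)[OF t, of mu ?q] mu by (simp add: indices_def)
      then have "[:- ?c, 1:] ^ ?m dvd [:- ?c, 1:] ^ 2" by (rule le_imp_power_dvd)
      also have "[:- ?c, 1:] dvd g" by (simp add: g_def h_def flip: poly_eq_0_iff_dvd)
      then have "[:- ?c, 1:] ^ 2 dvd g * g" by (simp only: power2_eq_square mult_dvd_mono)
      finally have "[:- ?c, 1:] ^ ?m * \<epsilon> dvd g * g * (\<epsilon> * \<epsilon>)"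
        by (intro mult_dvd_mono) simp_all
      then have "?\<chi> dvd g * g * (\<epsilon> * \<epsilon>)"
        using \<epsilon> dvd_trans unfolding is_projector_def by blast
      then have "cpoly t ?q ((g * \<epsilon>) * (g * \<epsilon>)) = 0"
        unfolding cpoly_eq_0_iff by (simp only: mult_ac)
      then show ?thesis by (simp only: cpoly_mult)
    qed
    moreover have "act t D ?q \<odot>\<^bsub>t\<^esub> V_idem t k mu = bscale h (kid (V_obj t k mu)) + ?\<eta>"
    proof -
      have "act t D ?q \<odot>\<^bsub>t\<^esub> V_idem t k mu = cpoly t ?q (H ?q * \<epsilon>)"
        unfolding act V by (simp only: cpoly_mult)
      also have "H ?q * \<epsilon> = smult h \<epsilon> + g * \<epsilon>" by (simp add: g_def algebra_simps)
      finally show ?thesis by (simp add: kpoly_add kpoly_smult kid_def V_obj_def V)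
    qed
    ultimately show "\<exists>\<eta>\<in>khom t (V_obj t k mu) (V_obj t k mu). \<eta> \<odot>\<^bsub>t\<^esub> \<eta> = 0 \<and>
        act t D (psize mu) \<odot>\<^bsub>t\<^esub> V_idem t k mu =
          bscale (eval2 f (of_nat (fst mu) - of_nat k - 1) (of_nat (snd mu))) (kid (V_obj t k mu)) + \<eta>"
      unfolding f(2)[OF mu] h_def by blast
  qed
next
  fix f' assume f': "is_eigenvalue_poly t k D f'"
  show "f' = f"
  proof (rule eval2_eqI)
    fix mu assume mu: "mu \<in> I' k"
    let ?q = "psize mu" and ?c = "c_eig mu t"
    let ?z = "eval2 f' (of_nat (fst mu) - of_nat k - 1) (of_nat (snd mu))"
    obtain \<epsilon> where \<epsilon>: "is_projector t mu \<epsilon>" and V: "V_idem t k mu = cpoly t ?q \<epsilon>"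
      using V_idem_eq[OF t mu] by blast
    obtain \<eta> where \<eta>: "\<eta> \<odot>\<^bsub>t\<^esub> \<eta> = 0"
        "act t D ?q \<odot>\<^bsub>t\<^esub> V_idem t k mu = bscale ?z (kid (V_obj t k mu)) + \<eta>"
      using f' mu unfolding is_eigenvalue_poly_def by blast
    let ?g = "(H ?q - [:?z:]) * \<epsilon>"
    have "cpoly t ?q (H ?q * \<epsilon>) = bscale ?z (cpoly t ?q \<epsilon>) + \<eta>"
      using \<eta>(2) unfolding act V kid_def V_obj_def by (simp add: cpoly_mult)
    moreover have "?g = H ?q * \<epsilon> - smult ?z \<epsilon>" by (simp add: algebra_simps)
    ultimately have "cpoly t ?q ?g = \<eta>" by (simp add: kpoly_diff kpoly_smult)
    with \<eta>(1) have "cpoly t ?q (?g * ?g) = 0" by (simp only: cpoly_mult)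
    then obtain s where s: "?g * ?g = char_poly t ?q * s" unfolding cpoly_eq_0_iff by (elim dvdE)
    have ord: "1 \<le> order ?c (char_poly t ?q)"
      using order_char_poly_bounds(1)[OF t, of mu ?q] mu by (simp add: indices_def)
    then have "poly (char_poly t ?q) ?c = 0" by (simp add: order_root)
    then have "poly (?g * ?g) ?c = 0" unfolding s by simp
    moreover have "poly \<epsilon> ?c = 1"
    proof -
      have "[:- ?c, 1:] ^ 1 dvd [:- ?c, 1:] ^ order ?c (char_poly t ?q)" using ord by (rule le_imp_power_dvd)
      then have "[:- ?c, 1:] dvd 1 - \<epsilon>" using \<epsilon> dvd_trans unfolding is_projector_def power_one_right by blast
      then show ?thesis by (simp flip: poly_eq_0_iff_dvd)
    qed
    ultimately have "?z = poly (H ?q) ?c" by simp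
    then show "?z = eval2 f (of_nat (fst mu) - of_nat k - 1) (of_nat (snd mu))"
      by (simp add: f(2)[OF mu])
  qed
qed

section \<open>The Capelli operator in the Newton basis\<close>

lemma act_term_sum: "act_term t d (\<Sum>i\<in>S. bscale (g i) (D i)) q = (\<Sum>i\<in>S. bscale (g i) (act_term t d (D i) q))"
proof -
  have "btens 0 (d + d) (\<Sum>i\<in>S. bscale (g i) (D i)) (symz q) = (\<Sum>i\<in>S. bscale (g i) (btens 0 (d + d) (D i) (symz q)))"
    by (simp add: btens_sum_left btens_bscale_left)
  then show ?thesis by (simp add: act_term_def bcomp_sum_right bcomp_bscale_right)
qed

lemma act_elt_of_cpoly:
  assumes "p = (\<Sum>r\<le>d div 2. smult (g r) (newton t d r))"
  shows "act t (elt_of_endo t d (cpoly t d p)) q =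
    cpoly t q (if d \<le> q then \<Sum>r\<le>d div 2. smult (g r * of_nat ((q - 2 * r) choose (d - 2 * r))) (newton t q r) else 0)"
proof -
  have single: "act t (elt_of_endo t d F) q = (if d \<le> q then act_term t d (elt_of_endo t d F d) q else 0)" for F
    by (rule act_single_degree) (simp add: elt_of_endo_def)
  have "elt_of_endo t d (cpoly t d p) d = (\<Sum>r\<le>d div 2. bscale (g r) (elt_of_endo t d (radial t d r) d))"
    by (simp add: elt_of_endo_def assms kpoly_sum kpoly_smult cpoly_newton btens_sum_left btens_bscale_left
        bcomp_sum_left bcomp_bscale_left)
  then have "act t (elt_of_endo t d (cpoly t d p)) q =
      (\<Sum>r\<le>d div 2. bscale (g r) (act t (elt_of_endo t d (radial t d r)) q))"
    unfolding single by (simp add: act_term_sum)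
  also have "\<dots> = (\<Sum>r\<le>d div 2. bscale (g r)
      (if d \<le> q then bscale (of_nat ((q - 2 * r) choose (d - 2 * r))) (radial t q r) else 0))"
    by (intro sum.cong refl) (auto simp: act_elt_of_radial)
  finally show ?thesis by (simp add: kpoly_sum kpoly_smult cpoly_newton)
qed

text \<open>The eigenvalue is itself the node of index \<open>snd mu\<close>, and the node of index
  \<open>i\<close> minus it is 4 times the product of \<open>fst mu - k - 1 - i\<close> and
  \<open>snd mu - i\<close>. This is where the shift of the first coordinate in the eigenvalue
  polynomials comes from.\<close>

lemma poly_newton_c_eig:
  assumes t: "t = - 2 * of_nat k" and mu: "snd mu \<le> fst mu"
  shows "poly (newton t (psize mu) r) (c_eig mu t) =
    4 ^ r * ffact (of_nat (fst mu) - of_nat k - 1) r * ffact (of_nat (snd mu)) r"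
proof -
  have "poly (newton t (psize mu) r) (c_eig mu t) =
      (\<Prod>i<r. 4 * (of_nat (fst mu) - of_nat k - 1 - of_nat i) * (of_nat (snd mu) - of_nat i))"
    unfolding newton_def poly_prod c_eig_node[OF mu]
    by (intro prod.cong refl) (simp add: node_def psize_def t algebra_simps)
  then show ?thesis by (simp only: ffact_def prod.distrib prod_constant card_lessThan)
qed

lemma smult_sum_right: "smult c (\<Sum>i\<in>S. f i) = (\<Sum>i\<in>S. smult c (f i))"
  by (induction S rule: infinite_finite_induct) (auto simp: smult_add_right)

text \<open>The Newton expansion of a Lagrange basis polynomial, without its normalization.\<close>

lemma prod_omit_newton:
  fixes z :: "nat \<Rightarrow> complex"
  assumes "j \<le> R"
  shows "(\<Prod>i\<in>{..R} - {j}. [:- z i, 1:]) =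
    (\<Sum>r\<in>{j..R}. smult (\<Prod>i\<in>{r<..R}. z j - z i) (\<Prod>i<r. [:- z i, 1:]))"
  using assms
proof (induction R rule: dec_induct)
  case base
  have "{..j} - {j} = {..<j}" by auto
  then show ?case by simp
next
  case (step R)
  have 1: "{..Suc R} - {j} = insert (Suc R) ({..R} - {j})" using step.hyps by auto
  let ?Q = "\<Prod>i\<in>{..R} - {j}. [:- z i, 1:]"
  have full: "[:- z j, 1:] * ?Q = (\<Prod>i<Suc R. [:- z i, 1:])"
    using step.hyps by (simp add: lessThan_Suc_atMost prod.remove[of "{..R}" j] del: mult_pCons_left)
  have lin: "[:- z (Suc R), 1:] = [:- z j, 1:] + [:z j - z (Suc R):]" by simp
  have "(\<Prod>i\<in>{..Suc R} - {j}. [:- z i, 1:]) = [:- z (Suc R), 1:] * ?Q"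
    unfolding 1 by (subst prod.insert) auto
  also have "\<dots> = (\<Prod>i<Suc R. [:- z i, 1:]) + smult (z j - z (Suc R)) ?Q"
    unfolding lin distrib_right full by simp
  also have "smult (z j - z (Suc R)) ?Q =
      (\<Sum>r\<in>{j..R}. smult (\<Prod>i\<in>{r<..Suc R}. z j - z i) (\<Prod>i<r. [:- z i, 1:]))"
    unfolding step.IH smult_sum_right
  proof (intro sum.cong refl)
    fix r assume "r \<in> {j..R}"
    then have "{r<..Suc R} = insert (Suc R) {r<..R}" by auto
    then show "smult (z j - z (Suc R)) (smult (\<Prod>i\<in>{r<..R}. z j - z i) (\<Prod>i<r. [:- z i, 1:])) =
       smult (\<Prod>i\<in>{r<..Suc R}. z j - z i) (\<Prod>i<r. [:- z i, 1:])" by simp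
  qed
  finally show ?case using step.hyps by (simp add: add.commute)
qed

text \<open>For singular \<open>lam\<close>, the Newton coefficients of the interpolation polynomial
  in \<open>capelli_eq\<close>: \<open>j'\<close> and \<open>j\<close> are the indices of the two
  coinciding nodes, the second parts of \<open>lam\<close> and of its \<open>dagger\<close>, and
  \<open>s\<close> is their distance.\<close>

definition capelli_coeff :: "nat \<Rightarrow> nat \<times> nat \<Rightarrow> nat \<Rightarrow> complex" where
  "capelli_coeff k lam r = (let s = fst lam - snd lam - k - 1; j = fst lam - k - 1; j' = snd lam
     in if j \<le> r then 4 * of_nat s ^ 2 * (- 1) ^ s / (4 ^ r * fact j * fact j' * fact (r - j) * fact (r - j')) else 0)"

lemma prod_int_differences:
  assumes "j \<le> r"
  shows "(\<Prod>i\<in>{..r} - {j}. of_nat j - of_nat i :: complex) = (- 1) ^ (r - j) * fact j * fact (r - j)"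
proof -
  have split: "{..r} - {j} = {..<j} \<union> {j<..r}" using assms by auto
  have "(\<Prod>i\<in>{..r} - {j}. of_nat j - of_nat i :: complex) =
      (\<Prod>i<j. of_nat j - of_nat i) * (\<Prod>i\<in>{j<..r}. of_nat j - of_nat i)"
    unfolding split by (rule prod.union_disjoint) auto
  also have "(\<Prod>i<j. of_nat j - of_nat i :: complex) = fact j"
    unfolding fact_prod_rev of_nat_prod atLeast0LessThan by (intro prod.cong refl) (simp add: of_nat_diff)
  also have "(\<Prod>i\<in>{j<..r}. of_nat j - of_nat i :: complex) = (\<Prod>i\<in>{1..r - j}. - of_nat i)"
    using assms by (intro prod.reindex_bij_witness[of _ "\<lambda>i. i + j" "\<lambda>i. i - j"]) (auto simp: of_nat_diff)
  also have "\<dots> = (- 1) ^ (r - j) * fact (r - j)"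
    by (simp add: prod_uminus fact_prod)
  finally show ?thesis by simp
qed


context
  fixes k :: nat and t :: complex and lam :: "nat \<times> nat" and j j' s d :: nat
  assumes t: "t = - 2 * of_nat k" and lam: "lam \<in> partitions2" "k_singular k lam"
  defines "j \<equiv> fst lam - k - 1" and "j' \<equiv> snd lam" and "s \<equiv> fst lam - snd lam - k - 1" and "d \<equiv> psize lam"
begin

lemma singular_facts: "s \<ge> 1" "j = j' + s" "d = j + j' + k + 1" "2 * j \<le> d" "s \<le> k + 1"
  using lam unfolding j_def j'_def s_def d_def psize_def partitions2_def k_singular_def
  by (cases lam; auto)+

lemma dagger_facts: "dagger k lam \<in> I' k" "psize (dagger k lam) = d" "snd (dagger k lam) = j"
  "snd (dagger k lam) \<le> fst (dagger k lam)" "fst (dagger k lam) = j' + k + 1"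
  using singular_facts unfolding I'_iff k_singular_def dagger_def psize_def j_def j'_def by auto

text \<open>After normalization, the Newton coefficient of index \<open>r\<close> is the inverse of
  this product of differences with \<open>j\<close> and \<open>j'\<close> left out. The differences
  are -4 (j - i) (j' - i), which produces the factorials; the sign on the right is that of the
  factors in \<open>newton\<close>.\<close>

lemma capelli_coeff_eq:
  assumes r: "j \<le> r"
  shows "(\<Prod>i\<in>{..r} - {j, j'}. node t d j - node t d i) * capelli_coeff k lam r = (- 1) ^ r"
proof -
  note sf = singular_facts
  \<comment> \<open>Each of the two products lacks one factor, equal to \<open>s\<close> up to sign,
    of a product over all differences; the two missing factors account for the square of
    \<open>s\<close>.\<close>
  define A where "A = (\<Prod>i\<in>{..r} - {j, j'}. of_nat j - of_nat i :: complex)"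
  define B where "B = (\<Prod>i\<in>{..r} - {j, j'}. of_nat j' - of_nat i :: complex)"
  have jj: "j' \<noteq> j" "j' \<le> r" using sf r by auto
  have sets: "{..r} - {j} = insert j' ({..r} - {j, j'})" "{..r} - {j'} = insert j ({..r} - {j, j'})"
    using jj r by auto
  have A: "of_nat s * A = (- 1) ^ (r - j) * fact j * fact (r - j)"
    unfolding prod_int_differences[OF r, symmetric] sets A_def using sf(2) by (subst prod.insert) auto
  have B: "- of_nat s * B = (- 1) ^ (r - j') * fact j' * fact (r - j')"
    unfolding prod_int_differences[OF jj(2), symmetric] sets B_def using sf(2) by (subst prod.insert) auto
  have card: "card ({..r} - {j, j'}) = r - 1"
    using jj r by (subst card_Diff_subset) auto
  have diff: "node t d j - node t d i = - 4 * ((of_nat j - of_nat i) * (of_nat j' - of_nat i))" for i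
  proof -
    have "of_nat d = of_nat j + of_nat j' + of_nat k + (1 :: complex)" using sf(3) by simp
    then show ?thesis unfolding node_def t by (simp only:) (simp add: algebra_simps)
  qed
  have W: "(\<Prod>i\<in>{..r} - {j, j'}. node t d j - node t d i) = (- 4) ^ (r - 1) * (A * B)"
    by (simp only: diff prod.distrib prod_constant card A_def B_def)
  have "of_nat s ^ 2 * (A * B) = - ((of_nat s * A) * (- of_nat s * B))" by (simp add: power2_eq_square)
  also have "\<dots> = - ((- 1) ^ (r - j) * (- 1) ^ (r - j')) * (fact j * fact j' * fact (r - j) * fact (r - j'))"
    unfolding A B by simp
  also have "(- 1) ^ (r - j) * (- 1) ^ (r - j') = ((- 1) ^ s :: complex)"
  proof -
    have "r - j' = (r - j) + s" using sf(2) r by simp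
    then show ?thesis by (simp add: power_add flip: mult.assoc power_mult_distrib)
  qed
  finally have AB: "of_nat s ^ 2 * (A * B) = - ((- 1) ^ s) * (fact j * fact j' * fact (r - j) * fact (r - j'))" .
  have r1: "r = Suc (r - 1)" using sf r by simp
  have p4: "(- 4) ^ (r - 1) * 4 = (- ((- 1) ^ r) * 4 ^ r :: complex)"
    by (subst (2 3) r1) (simp add: power_minus[of 4])
  have coeff: "capelli_coeff k lam r = 4 * of_nat s ^ 2 * (- 1) ^ s / (4 ^ r * (fact j * fact j' * fact (r - j) * fact (r - j')))"
    unfolding capelli_coeff_def Let_def s_def[symmetric] unfolding j_def[symmetric] j'_def[symmetric]
    using r by (simp only: if_True mult.assoc)
  have "(- 4) ^ (r - 1) * (A * B) * (4 * of_nat s ^ 2 * (- 1) ^ s) =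
        ((- 4) ^ (r - 1) * 4) * (- 1) ^ s * (of_nat s ^ 2 * (A * B))" by (simp only: mult_ac)
  also have "\<dots> = (- 1) ^ r * (4 ^ r * (fact j * fact j' * fact (r - j) * fact (r - j')))"
    unfolding AB p4 by (simp flip: mult.assoc power_mult_distrib)
  finally show ?thesis unfolding W coeff by simp
qed

text \<open>With \<open>char_poly\<close> equal to (x - c)^2 h, the projection has the form h b with
  h(c) b(c) = 1. In (x - c) h b only the value of b at c matters modulo \<open>char_poly\<close>, so
  b may be replaced by the constant 1 / h(c).\<close>

lemma capelli_eq:
  "capelli t k lam = elt_of_endo t d (cpoly t d (\<Sum>r\<le>d div 2. smult (capelli_coeff k lam r) (newton t d r)))"
proof -
  note sf = singular_facts and df = dagger_facts
  let ?R = "d div 2" and ?\<chi> = "char_poly t d"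
  let ?z = "node t d"
  define c where "c = ?z j"
  have c1: "c_eig (dagger k lam) t = c"
    using c_eig_node[OF df(4), of t] df(2,3) by (simp add: c_def)
  have zj': "?z j' = c" unfolding c_def node_eq_iff[OF t] using sf by simp
  have c2: "c_eig lam t = c"
    using c_eig_node[of lam t] lam zj' by (auto simp: d_def j'_def partitions2_def)
  have R: "j \<le> ?R" "j' \<le> ?R" "j' \<noteq> j" using sf by auto
  define h where "h = (\<Prod>i\<in>{..?R} - {j, j'}. [:- ?z i, 1:])"
  \<comment> \<open>Of the two equal nodes the one with the larger index \<open>j\<close> is left
    out: the Newton expansion then begins at \<open>r = j\<close>, the second part of
    \<open>dagger k lam\<close>, as the Knop-Sahi polynomial does.\<close>
  have "{..?R} - {j} = insert j' ({..?R} - {j, j'})" using R by auto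
  then have omit_j: "(\<Prod>i\<in>{..?R} - {j}. [:- ?z i, 1:]) = [:- c, 1:] * h"
    unfolding h_def by (simp only:) (subst prod.insert, auto simp: zj')
  have \<chi>: "?\<chi> = [:- c, 1:] ^ 2 * h"
    unfolding char_poly_def using R(1) omit_j
    by (simp only: prod.remove[of "{..?R}" j] finite_atMost atMost_iff c_def[symmetric] power2_eq_square mult.assoc)
  define K where "K = poly h c"
  have K: "K = (\<Prod>i\<in>{..?R} - {j, j'}. ?z j - ?z i)"
    by (simp add: K_def h_def poly_prod c_def)
  have K0: "K \<noteq> 0"
  proof -
    have "?z j \<noteq> ?z i" if "i \<in> {..?R} - {j, j'}" for i
      using that sf(3) unfolding node_eq_iff[OF t] by auto
    then show ?thesis unfolding K by auto
  qed
  have "{i \<in> {..?R}. ?z i = c} = {j, j'}"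
    using R sf(3) unfolding c_def node_eq_iff[OF t] by auto
  then have ord: "order c ?\<chi> = 2" unfolding order_char_poly[OF t] using R(3) by simp
  obtain \<epsilon> where \<epsilon>: "is_projector t (dagger k lam) \<epsilon>" and V: "V_idem t k (dagger k lam) = cpoly t d \<epsilon>"
    using V_idem_eq[OF t df(1)] df(2) by auto
  have e1: "[:- c, 1:] ^ 2 dvd 1 - \<epsilon>" and e2: "[:- c, 1:] ^ 2 * h dvd [:- c, 1:] ^ 2 * \<epsilon>"
    using \<epsilon> unfolding is_projector_def df(2) c1 ord by (simp_all only: \<chi>[symmetric])
  have "h dvd \<epsilon>" using e2 unfolding dvd_times_left_cancel_iff by simp
  then obtain b where b: "\<epsilon> = h * b" by (elim dvdE)
  have "[:- c, 1:] dvd 1 - \<epsilon>" using e1 by (rule dvd_trans[rotated]) (simp only: power2_eq_square dvd_triv_left)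
  then have "K * poly b c = 1" by (simp add: b K_def flip: poly_eq_0_iff_dvd)
  then have "[:- c, 1:] dvd b - [:1 / K:]" using K0 by (simp add: field_simps flip: poly_eq_0_iff_dvd)
  then have dvd: "?\<chi> dvd [:- c, 1:] * h * (b - [:1 / K:])"
  proof (elim dvdE)
    fix e assume e: "b - [:1 / K:] = [:- c, 1:] * e"
    have "[:- c, 1:] * h * (b - [:1 / K:]) = [:- c, 1:] ^ 2 * h * e"
      unfolding e power2_eq_square by (simp only: mult_ac)
    then show ?thesis unfolding \<chi> by (simp only: dvd_triv_left)
  qed
  have G: "(\<Sum>r\<le>?R. smult (capelli_coeff k lam r) (newton t d r)) = smult (1 / K) ([:- c, 1:] * h)"
  proof -
    have "smult (1 / K) ([:- c, 1:] * h) =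
        (\<Sum>r\<in>{j..?R}. smult (1 / K * (\<Prod>i\<in>{r<..?R}. ?z j - ?z i)) (\<Prod>i<r. [:- ?z i, 1:]))"
      unfolding omit_j[symmetric] prod_omit_newton[OF R(1)] smult_sum_right by simp
    also have "\<dots> = (\<Sum>r\<in>{j..?R}. smult (capelli_coeff k lam r) (newton t d r))"
    proof (intro sum.cong refl)
      fix r assume r: "r \<in> {j..?R}"
      have "newton t d r = (\<Prod>i<r. smult (- 1) [:- ?z i, 1:])" by (simp add: newton_def)
      also have "\<dots> = smult ((- 1) ^ r) (\<Prod>i<r. [:- ?z i, 1:])" by (subst prod_smult) simp
      finally have nw: "newton t d r = smult ((- 1) ^ r) (\<Prod>i<r. [:- ?z i, 1:])" .
      have split: "{..?R} - {j, j'} = ({..r} - {j, j'}) \<union> {r<..?R}" using r R sf by auto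
      have KW: "K = (\<Prod>i\<in>{..r} - {j, j'}. ?z j - ?z i) * (\<Prod>i\<in>{r<..?R}. ?z j - ?z i)"
        unfolding K split by (rule prod.union_disjoint) auto
      have "1 / K * (\<Prod>i\<in>{r<..?R}. ?z j - ?z i) = capelli_coeff k lam r * (- 1) ^ r"
      proof -
        have "1 / K * Z = C * g" if "K = W * Z" "W * C = g" "g * g = 1" "K \<noteq> 0" for W Z C g
        proof -
          have "W \<noteq> 0" "Z \<noteq> 0" using that by auto
          then have "C = g / W" using that(2) by (simp add: field_simps)
          with \<open>W \<noteq> 0\<close> \<open>Z \<noteq> 0\<close> that(1,3) show ?thesis by simp
        qed
        moreover have "(- 1) ^ r * (- 1) ^ r = (1 :: complex)" by (simp flip: power_mult_distrib)
        ultimately show ?thesis using KW capelli_coeff_eq[of r] r K0 by (metis atLeastAtMost_iff)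
      qed
      then show "smult (1 / K * (\<Prod>i\<in>{r<..?R}. ?z j - ?z i)) (\<Prod>i<r. [:- ?z i, 1:]) =
          smult (capelli_coeff k lam r) (newton t d r)" by (simp add: nw)
    qed
    also have "\<dots> = (\<Sum>r\<le>?R. smult (capelli_coeff k lam r) (newton t d r))"
      by (intro sum.mono_neutral_left) (auto simp: capelli_coeff_def j_def Let_def)
    finally show ?thesis by simp
  qed
  have "casimir_shift t lam \<odot>\<^bsub>t\<^esub> V_idem t k (dagger k lam) = cpoly t d ([:- c, 1:] * \<epsilon>)"
  proof -
    have "casimir_shift t lam = cpoly t d [:- c, 1:]"
      unfolding kpoly_linear[OF casimir_sym] casimir_shift_def c2 d_def
      by (rule poly_mapping_eqI) (simp add: lookup_minus lookup_add kid_def)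
    then show ?thesis unfolding V by (simp only: cpoly_mult)
  qed
  also have "\<dots> = cpoly t d (\<Sum>r\<le>?R. smult (capelli_coeff k lam r) (newton t d r))"
  proof (rule cpoly_eqI)
    have "[:- c, 1:] * \<epsilon> - smult (1 / K) ([:- c, 1:] * h) = [:- c, 1:] * h * (b - [:1 / K:])"
      unfolding b right_diff_distrib by (simp only: mult.assoc) (simp del: mult_pCons_left)
    with dvd show "?\<chi> dvd [:- c, 1:] * \<epsilon> - (\<Sum>r\<le>?R. smult (capelli_coeff k lam r) (newton t d r))"
      unfolding G by simp
  qed
  finally show ?thesis unfolding capelli_def d_def by simp
qed

end


section \<open>Knop--Sahi polynomials\<close>

lemma ffact_add: "ffact a (m + n) = ffact a m * ffact (a - of_nat m) n"
  by (induction n) (simp_all add: ffact_Suc algebra_simps)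

lemma ffact_gbinomial: "ffact (a :: complex) n = fact n * (a gchoose n)"
  by (simp add: gbinomial_prod_rev ffact_def atLeast0LessThan)

lemma ffact_of_nat: "r \<le> n \<Longrightarrow> ffact (of_nat n :: complex) r = fact n / fact (n - r)"
proof (induction r)
  case (Suc r)
  then have "fact (n - r) = (of_nat n - of_nat r) * (fact (n - Suc r) :: complex)"
    by (simp add: fact_reduce of_nat_diff)
  moreover have "of_nat n - of_nat r \<noteq> (0 :: complex)" using Suc.prems by simp
  ultimately show ?case using Suc by (simp add: ffact_Suc)
qed simp

text \<open>Up to a common denominator the terms are products of binomial coefficients with upper
  entries \<open>i'\<close> and \<open>s + i\<close>, so the sum is Vandermonde's.\<close>

lemma chu_vandermonde_factorials:
  "(\<Sum>m\<le>min i i'. 1 / (fact m * fact (i - m) * fact (i' - m) * fact (s + m)) :: complex) =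
     fact (s + i + i') / (fact i * fact i' * fact (s + i) * fact (s + i'))"
proof -
  have "(\<Sum>m\<le>min i i'. 1 / (fact m * fact (i - m) * fact (i' - m) * fact (s + m)) :: complex) =
        (\<Sum>m\<le>min i i'. of_nat (i' choose m) * of_nat ((s + i) choose (i - m)) / (fact i' * fact (s + i)))"
  proof (intro sum.cong refl)
    fix m assume "m \<in> {..min i i'}"
    then have m: "m \<le> i'" "i - m \<le> s + i" "s + i - (i - m) = s + m" by auto
    show "1 / (fact m * fact (i - m) * fact (i' - m) * fact (s + m)) =
      of_nat (i' choose m) * of_nat ((s + i) choose (i - m)) / (fact i' * fact (s + i) :: complex)"
      using m by (simp add: binomial_fact)
  qed
  also have "\<dots> = (\<Sum>m\<le>i. of_nat (i' choose m) * of_nat ((s + i) choose (i - m)) / (fact i' * fact (s + i)))"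
    by (intro sum.mono_neutral_left) auto
  also have "\<dots> = of_nat (\<Sum>m\<le>i. (i' choose m) * ((s + i) choose (i - m))) / (fact i' * fact (s + i))"
    by (simp add: sum_divide_distrib)
  also have "(\<Sum>m\<le>i. (i' choose m) * ((s + i) choose (i - m))) = (i' + (s + i)) choose i"
    by (rule vandermonde)
  also have "of_nat ((i' + (s + i)) choose i) = (fact (s + i + i') / (fact i * fact (s + i')) :: complex)"
    by (simp add: binomial_fact add_ac)
  finally show ?thesis by (simp add: mult_ac)
qed

lemma gbinomial_three_terms:
  "((X + Y + c) gchoose N :: complex) =
     (\<Sum>u\<le>N. \<Sum>v\<le>N - u. (X gchoose u) * (Y gchoose v) * (c gchoose (N - u - v)))"
proof -
  have "((X + Y + c) gchoose N) = (\<Sum>u\<le>N. (X gchoose u) * ((Y + c) gchoose (N - u)))"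
    using gbinomial_Vandermonde[of X "Y + c" N] by (simp add: add.assoc atLeast0AtMost)
  also have "\<dots> = (\<Sum>u\<le>N. (X gchoose u) * (\<Sum>v\<le>N - u. (Y gchoose v) * (c gchoose (N - u - v))))"
    unfolding gbinomial_Vandermonde[of Y c, symmetric] atLeast0AtMost by simp
  finally show ?thesis by (simp add: sum_distrib_left mult.assoc)
qed

text \<open>On the right the binomial coefficient is expanded by Vandermonde in the three summands X
  - m, Y - m and k + 1, which turns \<open>ffact X m * ffact Y m\<close> into falling factorials of
  orders i = m + u and i' = m + v. For fixed i and i' the sum over m is then evaluated by
  \<open>chu_vandermonde_factorials\<close>.\<close>

lemma knop_sahi_identity:
  fixes X Y :: complex and s n k :: nat
  assumes s: "s + n = k + 1"
  shows "(\<Sum>i\<le>n. \<Sum>i'\<le>n - i. fact n * ffact (of_nat k + 1) (n - i) * ffact (of_nat k + 1) (n - i') /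
            (fact i * fact i' * fact (n - i - i') * ffact (of_nat k + 1) n) * (ffact X i * ffact Y i')) =
         (\<Sum>m\<le>n div 2. fact n * fact s / (fact m * fact (s + m)) *
            ((X + Y + of_nat k + 1 - 2 * of_nat m) gchoose (n - 2 * m)) * (ffact X m * ffact Y m))"
    (is "?L = ?R")
proof -
  define T where "T = (\<lambda>m i i'. fact n * fact s / (fact m * fact (i - m) * fact (i' - m) * fact (s + m)) *
      ((of_nat k + 1) gchoose (n - i - i')) * (ffact X i * ffact Y i') :: complex)"
  have R: "fact n * fact s / (fact m * fact (s + m)) *
      ((X + Y + of_nat k + 1 - 2 * of_nat m) gchoose (n - 2 * m)) * (ffact X m * ffact Y m) =
      (\<Sum>u\<le>n - 2 * m. \<Sum>v\<le>n - 2 * m - u. T m (m + u) (m + v))"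
    if m: "m \<le> n div 2" for m
  proof -
    have eq: "X + Y + of_nat k + 1 - 2 * of_nat m = (X - of_nat m) + (Y - of_nat m) + (of_nat k + 1)"
      by simp
    have step: "ffact Z m * ((Z - of_nat m) gchoose u) = ffact Z (m + u) / fact u" for Z :: complex and u
      by (simp add: ffact_add ffact_gbinomial[of "Z - of_nat m"])
    have "fact n * fact s / (fact m * fact (s + m)) *
        (((X - of_nat m) gchoose u) * ((Y - of_nat m) gchoose v) * ((of_nat k + 1) gchoose (n - 2 * m - u - v))) * (ffact X m * ffact Y m) = T m (m + u) (m + v)"
      if "u \<le> n - 2 * m" "v \<le> n - 2 * m - u" for u v
    proof -
      have "n - (m + u) - (m + v) = n - 2 * m - u - v" by simp
      then have "T m (m + u) (m + v) = fact n * fact s / (fact m * fact (s + m)) *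
        ((of_nat k + 1) gchoose (n - 2 * m - u - v)) * ((ffact X (m + u) / fact u) * (ffact Y (m + v) / fact v))"
        by (simp add: T_def)
      then show ?thesis unfolding step[symmetric] by (simp add: mult_ac)
    qed
    then show ?thesis
      unfolding eq gbinomial_three_terms sum_distrib_left sum_distrib_right by (intro sum.cong refl) auto
  qed
  have "?R = (\<Sum>m\<le>n div 2. \<Sum>u\<le>n - 2 * m. \<Sum>v\<le>n - 2 * m - u. T m (m + u) (m + v))"
    by (intro sum.cong refl R) simp
  also have "\<dots> = (\<Sum>(m, u, v)\<in>(SIGMA m:{..n div 2}. SIGMA u:{..n - 2 * m}. {..n - 2 * m - u}). T m (m + u) (m + v))"
    by (simp add: sum.Sigma)
  also have "\<dots> = (\<Sum>(i, i', m)\<in>(SIGMA i:{..n}. SIGMA i':{..n - i}. {..min i i'}). T m i i')"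
    by (rule sum.reindex_bij_witness[of _ "\<lambda>(i, i', m). (m, i - m, i' - m)" "\<lambda>(m, u, v). (m + u, m + v, m)"]) auto
  also have "\<dots> = (\<Sum>i\<le>n. \<Sum>i'\<le>n - i. \<Sum>m\<le>min i i'. T m i i')"
    by (simp add: sum.Sigma)
  also have "\<dots> = ?L"
  proof (intro sum.cong refl)
    fix i i' assume "i \<in> {..n}" "i' \<in> {..n - i}"
    then have i: "i + i' \<le> n" by auto
    have k1: "of_nat k + 1 = (of_nat (k + 1) :: complex)" by simp
    have "(\<Sum>m\<le>min i i'. T m i i') = fact n * fact s * ((of_nat k + 1) gchoose (n - i - i')) * (ffact X i * ffact Y i') *
        (\<Sum>m\<le>min i i'. 1 / (fact m * fact (i - m) * fact (i' - m) * fact (s + m)))"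
      by (simp add: T_def sum_distrib_left mult_ac)
    also have "(of_nat k + 1) gchoose (n - i - i') = (fact (k + 1) / (fact (n - i - i') * fact (s + i + i')) :: complex)"
    proof -
      have "k + 1 - (n - i - i') = s + i + i'" "n - i - i' \<le> k + 1" using s i by auto
      then show ?thesis unfolding k1 by (simp only: binomial_gbinomial[symmetric] binomial_fact)
    qed
    also have "fact n * fact s * (fact (k + 1) / (fact (n - i - i') * fact (s + i + i'))) * (ffact X i * ffact Y i') *
        (\<Sum>m\<le>min i i'. 1 / (fact m * fact (i - m) * fact (i' - m) * fact (s + m))) =
      fact n * fact s * fact (k + 1) / (fact i * fact i' * fact (n - i - i') * fact (s + i) * fact (s + i')) *
        (ffact X i * ffact Y i')"
    proof -
      have cancel: "c * (K / (p * A)) * xy * (A / q) = c * K / (p * q) * xy" if "A \<noteq> 0" for c K p A xy q :: complex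
        using that by simp
      show ?thesis
        unfolding chu_vandermonde_factorials
        by (subst cancel[OF fact_nonzero]) (simp add: mult_ac del: fact_Suc)
    qed
    finally have 1: "(\<Sum>m\<le>min i i'. T m i i') = fact n * fact s * fact (k + 1) / (fact i * fact i' * fact (n - i - i') * fact (s + i) * fact (s + i')) *
        (ffact X i * ffact Y i')" .
    have f: "k + 1 - (n - i) = s + i" "k + 1 - (n - i') = s + i'" "k + 1 - n = s" "n - i \<le> k + 1" "n - i' \<le> k + 1" "n \<le> k + 1"
      using s i by auto
    show "(\<Sum>m\<le>min i i'. T m i i') = fact n * ffact (of_nat k + 1) (n - i) * ffact (of_nat k + 1) (n - i') /
            (fact i * fact i' * fact (n - i - i') * ffact (of_nat k + 1) n) * (ffact X i * ffact Y i')"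
      unfolding 1 k1 ffact_of_nat[OF f(4)] ffact_of_nat[OF f(5)] ffact_of_nat[OF f(6)] f(1-3)
      by (simp add: field_simps del: fact_Suc of_nat_Suc)
  qed
  finally show ?thesis by simp
qed

section \<open>Coefficients and values of the Knop-Sahi polynomials\<close>

lemma coeff_ffact_prod:
  "coeff (coeff (ffact Xv a * ffact Yv b) i) j = coeff (ffact [:0, 1:] a) j * coeff (ffact [:0, 1:] b :: complex poly) i"
proof -
  have X: "ffact Xv a = [:ffact [:0, 1:] a:]" for a
    by (induction a) (simp_all add: ffact_Suc of_nat_poly one_pCons)
  have "coeff (ffact Yv b) i = [:coeff (ffact [:0, 1:] b :: complex poly) i:]" for i
  proof (induction b arbitrary: i)
    case (Suc b)
    have "ffact Yv (Suc b) = smult (- of_nat b) (ffact Yv b) + pCons 0 (ffact Yv b)"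
      by (simp add: ffact_Suc of_nat_poly)
    moreover have "ffact [:0, 1:] (Suc b) = smult (- of_nat b) (ffact [:0, 1:] b :: complex poly) + pCons 0 (ffact [:0, 1:] b)"
      by (simp add: ffact_Suc of_nat_poly)
    ultimately show ?case
      by (cases i) (simp_all add: Suc.IH of_nat_poly)
  qed (simp add: one_pCons coeff_pCons split: nat.splits)
  then show ?thesis by (simp add: X)
qed

lemma eval2_simps:
  "eval2 (smult [:c:] f) x y = c * eval2 f x y"
  "eval2 (\<Sum>i\<in>S. F i) x y = (\<Sum>i\<in>S. eval2 (F i) x y)"
  "eval2 (f * g) x y = eval2 f x y * eval2 g x y"
  by (simp_all add: eval2_def poly_sum)

lemma eval2_ffact: "eval2 (ffact Xv a) x y = ffact x a" "eval2 (ffact Yv a) x y = ffact y a"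
  by (induction a) (simp_all add: ffact_Suc eval2_simps, simp_all add: eval2_def of_nat_poly)

definition knop_coeff :: "complex \<Rightarrow> nat \<Rightarrow> nat \<Rightarrow> nat \<Rightarrow> complex" where
  "knop_coeff \<kappa> n a b = fact n * ffact (\<kappa> + 1) (n - a) * ffact (\<kappa> + 1) (n - b) /
     (fact a * fact b * fact (n - a - b) * ffact (\<kappa> + 1) n)"

lemma knop_sahi_eq:
  "knop_sahi \<kappa> mu = (\<Sum>a\<le>fst mu - snd mu. \<Sum>b\<le>fst mu - snd mu - a.
     smult [:knop_coeff \<kappa> (fst mu - snd mu) a b:] (ffact Xv (snd mu + a) * ffact Yv (snd mu + b)))"
  unfolding knop_sahi_def knop_coeff_def Let_def ..

lemma coeff_knop_sahi:
  "coeff (coeff (knop_sahi \<kappa> mu) i) j = (\<Sum>a\<le>fst mu - snd mu. \<Sum>b\<le>fst mu - snd mu - a.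
     knop_coeff \<kappa> (fst mu - snd mu) a b *
       (coeff (ffact [:0, 1:] (snd mu + a)) j * coeff (ffact [:0, 1:] (snd mu + b)) i))"
  unfolding knop_sahi_eq coeff_sum
  by (intro sum.cong refl) (simp add: coeff_ffact_prod)

lemma sum_triangle_swap:
  fixes f :: "nat \<Rightarrow> nat \<Rightarrow> 'a::comm_monoid_add"
  shows "(\<Sum>a\<le>n. \<Sum>b\<le>n - a. f a b) = (\<Sum>a\<le>n. \<Sum>b\<le>n - a. f b a)"
proof -
  have "(\<Sum>(a, b)\<in>(SIGMA a:{..n}. {..n - a}). f a b) = (\<Sum>(a, b)\<in>(SIGMA a:{..n}. {..n - a}). f b a)"
    by (rule sum.reindex_bij_witness[of _ "\<lambda>(a, b). (b, a)" "\<lambda>(a, b). (b, a)"]) auto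
  then show ?thesis by (simp add: sum.Sigma)
qed

lemma symmetric2_knop_sahi: "symmetric2 (smult [:c:] (knop_sahi \<kappa> mu))"
proof -
  have sub: "n - a - b = n - b - a" for n a b :: nat by simp
  have "knop_coeff \<kappa> n a b = knop_coeff \<kappa> n b a" for n a b
    unfolding knop_coeff_def by (subst sub) (simp only: mult_ac)
  then have "coeff (coeff (knop_sahi \<kappa> mu) i) j = coeff (coeff (knop_sahi \<kappa> mu) j) i" for i j
    unfolding coeff_knop_sahi
    by (subst sum_triangle_swap) (simp add: mult_ac)
  then show ?thesis by (simp add: symmetric2_def)
qed

lemma eval2_knop_sahi:
  "eval2 (knop_sahi \<kappa> mu) x y = (\<Sum>a\<le>fst mu - snd mu. \<Sum>b\<le>fst mu - snd mu - a.
     knop_coeff \<kappa> (fst mu - snd mu) a b * (ffact x (snd mu + a) * ffact y (snd mu + b)))"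
  unfolding knop_sahi_eq eval2_simps eval2_ffact ..

lemma tendsto_ffact:
  fixes g :: "complex \<Rightarrow> complex"
  assumes "(g \<longlongrightarrow> l) F"
  shows "((\<lambda>z. ffact (g z) r) \<longlongrightarrow> ffact l r) F"
  unfolding ffact_def by (intro tendsto_intros assms)

section \<open>The eigenvalue polynomial of the Capelli operator and the limit\<close>

context
  fixes k :: nat and t :: complex and lam :: "nat \<times> nat" and j j' s d n :: nat
  assumes t: "t = - 2 * of_nat k" and lam: "lam \<in> partitions2" "k_singular k lam"
  defines "j \<equiv> fst lam - k - 1" and "j' \<equiv> snd lam" and "s \<equiv> fst lam - snd lam - k - 1" and "d \<equiv> psize lam"
    and "n \<equiv> d - 2 * j"
begin

private lemma facts: "s \<ge> 1" "j = j' + s" "d = j + j' + k + 1" "d = 2 * j + n" "s + n = k + 1"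
  "snd (dagger k lam) = j" "fst (dagger k lam) = j' + k + 1" "fst (dagger k lam) - snd (dagger k lam) = n"
  "fst lam - snd lam = s + k + 1" "snd lam \<le> fst lam"
  using lam unfolding j_def j'_def s_def d_def n_def psize_def partitions2_def k_singular_def dagger_def
  by (cases lam; auto)+

text \<open>The limit at \<open>t\<close> of the scalar factor in the theorem, as
  \<open>norm_tendsto\<close> shows.\<close>

private definition norm_const :: complex where
  "norm_const = 4 * of_nat s * (- 1) ^ s / (fact n * fact j * fact j' * fact (s - 1))"

text \<open>The common factor \<open>ffact x j * ffact y j\<close> is split off, and
  \<open>knop_sahi_identity\<close> is applied at x - j and y - j.\<close>

private lemma eval2_limit:
  "eval2 (smult [:norm_const:] (knop_sahi (of_nat k) (dagger k lam))) x y =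
     (\<Sum>m\<le>n div 2. 4 * of_nat s ^ 2 * (- 1) ^ s / (fact j * fact j' * fact m * fact (s + m)) *
        ((x + y + of_nat k + 1 - 2 * of_nat (j + m)) gchoose (n - 2 * m)) * (ffact x (j + m) * ffact y (j + m)))"
proof -
  let ?X = "x - of_nat j" and ?Y = "y - of_nat j"
  have "eval2 (knop_sahi (of_nat k) (dagger k lam)) x y = ffact x j * ffact y j *
     (\<Sum>a\<le>n. \<Sum>b\<le>n - a. knop_coeff (of_nat k) n a b * (ffact ?X a * ffact ?Y b))"
    unfolding eval2_knop_sahi facts(8) unfolding facts(6) ffact_add[of _ j] sum_distrib_left
    by (intro sum.cong refl) (simp only: mult_ac)
  also have "(\<Sum>a\<le>n. \<Sum>b\<le>n - a. knop_coeff (of_nat k) n a b * (ffact ?X a * ffact ?Y b)) =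
      (\<Sum>m\<le>n div 2. fact n * fact s / (fact m * fact (s + m)) *
            ((?X + ?Y + of_nat k + 1 - 2 * of_nat m) gchoose (n - 2 * m)) * (ffact ?X m * ffact ?Y m))"
    unfolding knop_coeff_def by (rule knop_sahi_identity[OF facts(5)])
  finally have "eval2 (smult [:norm_const:] (knop_sahi (of_nat k) (dagger k lam))) x y =
     (\<Sum>m\<le>n div 2. norm_const * (ffact x j * ffact y j * (fact n * fact s / (fact m * fact (s + m)) *
            ((?X + ?Y + of_nat k + 1 - 2 * of_nat m) gchoose (n - 2 * m)) * (ffact ?X m * ffact ?Y m))))"
    by (simp only: eval2_simps sum_distrib_left)
  also have "\<dots> = (\<Sum>m\<le>n div 2. 4 * of_nat s ^ 2 * (- 1) ^ s / (fact j * fact j' * fact m * fact (s + m)) *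
        ((x + y + of_nat k + 1 - 2 * of_nat (j + m)) gchoose (n - 2 * m)) * (ffact x (j + m) * ffact y (j + m)))"
  proof (intro sum.cong refl)
    fix m
    have fs: "fact s = of_nat s * (fact (s - 1) :: complex)" using facts(1) by (simp add: fact_reduce)
    have c: "norm_const * (fact n * fact s / (fact m * fact (s + m))) =
        4 * of_nat s ^ 2 * (- 1) ^ s / (fact j * fact j' * fact m * fact (s + m))"
      unfolding norm_const_def fs by (simp add: power2_eq_square mult_ac)
    have g: "?X + ?Y + of_nat k + 1 - 2 * of_nat m = x + y + of_nat k + 1 - 2 * of_nat (j + m)" by simp
    show "norm_const * (ffact x j * ffact y j * (fact n * fact s / (fact m * fact (s + m)) *
            ((?X + ?Y + of_nat k + 1 - 2 * of_nat m) gchoose (n - 2 * m)) * (ffact ?X m * ffact ?Y m))) =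
        4 * of_nat s ^ 2 * (- 1) ^ s / (fact j * fact j' * fact m * fact (s + m)) *
        ((x + y + of_nat k + 1 - 2 * of_nat (j + m)) gchoose (n - 2 * m)) * (ffact x (j + m) * ffact y (j + m))"
      unfolding c[symmetric] g ffact_add[of _ j] by (simp only: mult_ac)
  qed
  finally show ?thesis .
qed

private lemma capelli_coeff_shift:
  "capelli_coeff k lam (j + m) * 4 ^ (j + m) = 4 * of_nat s ^ 2 * (- 1) ^ s / (fact j * fact j' * fact m * fact (s + m))"
proof -
  have "j + m - j' = s + m" using facts(2) by simp
  then show ?thesis
    unfolding capelli_coeff_def Let_def s_def[symmetric] unfolding j_def[symmetric] j'_def[symmetric]
    by (simp add: mult_ac)
qed

text \<open>At \<open>mu\<close> the shifted coordinates satisfy x + y + k + 1 = q, the size of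
  \<open>mu\<close>. For q at least \<open>d\<close> the binomial coefficients in
  \<open>eval2_limit\<close> thus become those of the action on degree q, and the two sums agree
  term by term.\<close>

lemma eigenvalue_poly_capelli:
  "eigenvalue_poly t k (capelli t k lam) = smult [:norm_const:] (knop_sahi (of_nat k) (dagger k lam))"
proof (rule eigenvalue_poly_eqI[OF t _ symmetric2_knop_sahi])
  define H where "H = (\<lambda>q. if d \<le> q then \<Sum>r\<le>d div 2.
      smult (capelli_coeff k lam r * of_nat ((q - 2 * r) choose (d - 2 * r))) (newton t q r) else 0)"
  show "act t (capelli t k lam) q = cpoly t q (H q)" for q
    unfolding capelli_eq[OF t lam] d_def[symmetric] H_def by (rule act_elt_of_cpoly[OF refl])
  fix mu assume mu: "mu \<in> I' k"
  let ?x = "of_nat (fst mu) - of_nat k - 1 :: complex" and ?y = "of_nat (snd mu) :: complex"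
  let ?q = "psize mu"
  have le: "snd mu \<le> fst mu" using mu by (simp add: I'_iff)
  have q: "?x + ?y + of_nat k + 1 = of_nat ?q" by (simp add: psize_def)
  let ?A = "\<lambda>m. 4 * of_nat s ^ 2 * (- 1) ^ s / (fact j * fact j' * fact m * fact (s + m)) :: complex"
  have E: "eval2 (smult [:norm_const:] (knop_sahi (of_nat k) (dagger k lam))) ?x ?y =
    (\<Sum>m\<le>n div 2. ?A m * ((of_nat ?q - 2 * of_nat (j + m)) gchoose (n - 2 * m)) * (ffact ?x (j + m) * ffact ?y (j + m)))"
    unfolding eval2_limit q ..
  have n_div: "d div 2 = j + n div 2" using facts(4) by simp
  show "eval2 (smult [:norm_const:] (knop_sahi (of_nat k) (dagger k lam))) ?x ?y = poly (H ?q) (c_eig mu t)"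
  proof (cases "d \<le> ?q")
    case True
    have "poly (H ?q) (c_eig mu t) = (\<Sum>r\<le>d div 2. capelli_coeff k lam r * of_nat ((?q - 2 * r) choose (d - 2 * r)) *
        (4 ^ r * ffact ?x r * ffact ?y r))"
      using True by (simp add: H_def poly_sum poly_newton_c_eig[OF t le])
    also have "\<dots> = (\<Sum>r\<in>{j..d div 2}. capelli_coeff k lam r * of_nat ((?q - 2 * r) choose (d - 2 * r)) *
        (4 ^ r * ffact ?x r * ffact ?y r))"
      by (intro sum.mono_neutral_right) (auto simp: capelli_coeff_def Let_def j_def)
    also have "\<dots> = (\<Sum>m\<le>n div 2. capelli_coeff k lam (j + m) * of_nat ((?q - 2 * (j + m)) choose (d - 2 * (j + m))) *
        (4 ^ (j + m) * ffact ?x (j + m) * ffact ?y (j + m)))"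
      unfolding n_div by (intro sum.reindex_bij_witness[of _ "\<lambda>m. j + m" "\<lambda>r. r - j"]) auto
    also have "\<dots> = (\<Sum>m\<le>n div 2. ?A m * ((of_nat ?q - 2 * of_nat (j + m)) gchoose (n - 2 * m)) * (ffact ?x (j + m) * ffact ?y (j + m)))"
    proof (intro sum.cong refl)
      fix m assume "m \<in> {..n div 2}"
      then have "2 * (j + m) \<le> d" using facts(4) by auto
      then have "of_nat ((?q - 2 * (j + m)) choose (n - 2 * m)) = ((of_nat ?q - 2 * of_nat (j + m)) gchoose (n - 2 * m) :: complex)"
        using True by (simp add: binomial_gbinomial of_nat_diff)
      moreover have "d - 2 * (j + m) = n - 2 * m" using facts(4) by simp
      ultimately show "capelli_coeff k lam (j + m) * of_nat ((?q - 2 * (j + m)) choose (d - 2 * (j + m))) *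
        (4 ^ (j + m) * ffact ?x (j + m) * ffact ?y (j + m)) =
        ?A m * ((of_nat ?q - 2 * of_nat (j + m)) gchoose (n - 2 * m)) * (ffact ?x (j + m) * ffact ?y (j + m))"
        unfolding capelli_coeff_shift[symmetric] by (simp only: mult_ac)
    qed
    finally show ?thesis unfolding E by simp
  next
    case False
    \<comment> \<open>The operator is zero in degrees below \<open>d\<close>, so the polynomial has
      to vanish there: either the upper entry of the binomial coefficient is a natural number
      smaller than the lower one, or \<open>snd mu < j + m\<close> and the second falling factorial
      is zero.\<close>
    have "?A m * ((of_nat ?q - 2 * of_nat (j + m)) gchoose (n - 2 * m)) * (ffact ?x (j + m) * ffact ?y (j + m)) = 0"
      if m: "m \<le> n div 2" for m
    proof (cases "2 * (j + m) \<le> ?q")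
      case True
      have "((of_nat ?q - 2 * of_nat (j + m)) gchoose (n - 2 * m) :: complex) = of_nat ((?q - 2 * (j + m)) choose (n - 2 * m))"
        using True by (simp add: binomial_gbinomial of_nat_diff)
      also have "(?q - 2 * (j + m)) choose (n - 2 * m) = 0"
        using False True facts(4) by (intro binomial_eq_0) auto
      finally show ?thesis by simp
    next
      case False
      then have "snd mu < j + m" using le by (simp add: psize_def)
      then show ?thesis by (simp add: ffact_of_nat_eq_0)
    qed
    then have "(\<Sum>m\<le>n div 2. ?A m * ((of_nat ?q - 2 * of_nat (j + m)) gchoose (n - 2 * m)) * (ffact ?x (j + m) * ffact ?y (j + m))) = 0"
      by (intro sum.neutral) auto
    then show ?thesis unfolding E using False by (simp add: H_def)
  qed
qed

text \<open>Numerator and denominator have a simple zero at \<open>t\<close>: the numerator is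
  \<open>- 4 * s * (k + z / 2)\<close>, and \<open>k + z / 2\<close> is the factor of index
  \<open>j'\<close> of the falling factorial in \<open>H_norm\<close>.\<close>

private lemma norm_tendsto:
  "((\<lambda>z. (c_eig (dagger k lam) z - c_eig lam z) / H_norm (dagger k lam) (- z / 2)) \<longlongrightarrow> norm_const) (at t)"
proof -
  \<comment> \<open>The quotient after cancelling \<open>k + z / 2\<close>, continuous at
    \<open>t\<close>.\<close>
  define \<rho> where "\<rho> = (\<lambda>z::complex. - 4 * of_nat s /
      (fact n * fact j * (\<Prod>i\<in>{..j - 1} - {j'}. of_nat j' - of_nat i + (of_nat k + z / 2))))"
  have j: "j' \<le> j - 1" "{..<j} = insert j' ({..j - 1} - {j'})" "j - 1 - j' = s - 1"
    using facts(1,2) by auto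
  have eq: "(c_eig (dagger k lam) z - c_eig lam z) / H_norm (dagger k lam) (- z / 2) = \<rho> z" if "z \<noteq> t" for z
  proof -
    have n: "of_nat n = of_nat k + 1 - (of_nat s :: complex)"
      using arg_cong[OF facts(5), of "of_nat :: nat \<Rightarrow> complex"] by (simp add: algebra_simps)
    have num: "c_eig (dagger k lam) z - c_eig lam z = - 4 * of_nat s * (of_nat k + z / 2)"
      unfolding c_eig_def facts(8,9) of_nat_add n by (simp add: algebra_simps)
    have shift: "of_nat (j' + k + 1) - 1 - - z / 2 - of_nat i = of_nat j' - of_nat i + (of_nat k + z / 2)" for i
      by (simp add: algebra_simps)
    have "ffact (of_nat (j' + k + 1) - 1 - - z / 2) j = (\<Prod>i<j. of_nat j' - of_nat i + (of_nat k + z / 2))"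
      unfolding ffact_def shift ..
    also have "\<dots> =
        (of_nat k + z / 2) * (\<Prod>i\<in>{..j - 1} - {j'}. of_nat j' - of_nat i + (of_nat k + z / 2))"
      unfolding j(2) by (subst prod.insert) auto
    finally have den: "H_norm (dagger k lam) (- z / 2) = fact n * fact j *
        ((of_nat k + z / 2) * (\<Prod>i\<in>{..j - 1} - {j'}. of_nat j' - of_nat i + (of_nat k + z / 2)))"
      unfolding H_norm_def facts(8) unfolding facts(6,7) by (simp only:)
    have "of_nat k + z / 2 \<noteq> 0" using that t by (auto simp: field_simps add_eq_0_iff)
    then show ?thesis unfolding num den \<rho>_def by simp
  qed
  have at_t: "of_nat j' - of_nat i + (of_nat k + t / 2) = (of_nat j' - of_nat i :: complex)" for i
    by (simp add: t)
  have "(\<Prod>i\<in>{..j - 1} - {j'}. of_nat j' - of_nat i :: complex) = (- 1) ^ (s - 1) * fact j' * fact (s - 1)"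
    using prod_int_differences[OF j(1)] j(3) by simp
  then have "\<rho> t = - 4 * of_nat s / (fact n * fact j * ((- 1) ^ (s - 1) * fact j' * fact (s - 1)))"
    unfolding \<rho>_def at_t by simp
  also have "\<dots> = norm_const"
  proof -
    have "(- 1) ^ s = - ((- 1) ^ (s - 1) :: complex)" using facts(1) by (cases s) auto
    moreover have "(- 1) ^ (s - 1) * (- 1) ^ (s - 1) = (1 :: complex)" by (simp flip: power_mult_distrib)
    ultimately show ?thesis unfolding norm_const_def by (simp add: field_simps)
  qed
  finally have \<rho>t: "\<rho> t = norm_const" .
  have "(\<rho> \<longlongrightarrow> \<rho> t) (at t)"
    unfolding \<rho>_def by (intro tendsto_intros) (auto simp: at_t)
  moreover have "\<forall>\<^sub>F z in at t. \<rho> z = (c_eig (dagger k lam) z - c_eig lam z) / H_norm (dagger k lam) (- z / 2)"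
    using eq by (auto simp: eventually_at_filter)
  ultimately show ?thesis unfolding \<rho>t by (rule Lim_transform_eventually)
qed

text \<open>The coefficients of the Knop-Sahi polynomial have no pole at \<open>t\<close>: their
  denominators contain the falling factorial of \<open>k + 1\<close> of order \<open>n\<close>,
  which is non-zero because \<open>n \<le> k\<close>.\<close>

lemma knop_sahi_coeffwise_tendsto:
  "coeffwise_tendsto
     (\<lambda>z. smult [:(c_eig (dagger k lam) z - c_eig lam z) / H_norm (dagger k lam) (- z / 2):]
            (knop_sahi (- z / 2) (dagger k lam)))
     (eigenvalue_poly t k (capelli t k lam)) (at t)"
proof -
  have "((\<lambda>z. - z / 2 + 1) \<longlongrightarrow> - t / 2 + 1) (at t)" by (intro tendsto_intros) auto
  then have lim: "((\<lambda>z. - z / 2 + 1) \<longlongrightarrow> of_nat k + 1) (at t)" by (simp add: t)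
  have "of_nat k + 1 = (of_nat (k + 1) :: complex)" by simp
  moreover have "ffact (of_nat (k + 1) :: complex) n = fact (k + 1) / fact (k + 1 - n)"
    by (rule ffact_of_nat) (use facts(5) in simp)
  ultimately have nz: "ffact (of_nat k + 1 :: complex) n \<noteq> 0"
    by (simp only: divide_eq_0_iff fact_nonzero simp_thms)
  have "((\<lambda>z. coeff (coeff (knop_sahi (- z / 2) (dagger k lam)) a) b) \<longlongrightarrow>
      coeff (coeff (knop_sahi (of_nat k) (dagger k lam)) a) b) (at t)" for a b
    unfolding coeff_knop_sahi facts(8) knop_coeff_def
    by (intro tendsto_intros tendsto_ffact lim) (use nz in auto)
  moreover have "coeff (coeff (smult [:c:] f) a) b = c * coeff (coeff f a) b"
    for c and f :: "complex poly poly" and a b by simp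
  ultimately show ?thesis
    unfolding coeffwise_tendsto_def eigenvalue_poly_capelli by (simp only:) (intro allI tendsto_mult norm_tendsto)
qed

end

theorem mainTheorem7:
  fixes t :: complex and k :: nat and lam :: "nat \<times> nat"
  assumes "t = - 2 * of_nat k"
    and "lam \<in> partitions2"
    and "k_singular k lam"
  shows "coeffwise_tendsto
           (\<lambda>s. smult [:(c_eig (dagger k lam) s - c_eig lam s) / H_norm (dagger k lam) (- s / 2):]
                  (knop_sahi (- s / 2) (dagger k lam)))
           (eigenvalue_poly t k (capelli t k lam))
           (at t)"
  using assms by (rule knop_sahi_coeffwise_tendsto)

end
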